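(* Let $R$ and $R'$ be commutative rings, let $A$ be an Azumaya algebra over $R$ and $A'$ an Azumaya algebra over $R'$, of the same constant rank, and let $\phi: A \to A'$ be a ring homomorphism. Then $\phi$ is an isomorphism if and only if $\phi$ induces (by restriction to $R = Z(A)$) an isomorphism from $R$ onto $R' = Z(A')$.
   Context: Rings are associative with unit and ring homomorphisms preserve the unit; $\phi$ is not assumed to be linear over any base ring. An Azumaya algebra over a commutative ring $R$ is an $R$-algebra $A$ (not necessarily commutative) which is a finitely generated faithful $R$-module such that for each maximal ideal $\mathfrak{m}$ of $R$ the quotient $A/\mathfrak{m}A$ is a central simple $R/\mathfrak{m}$-algebra. It is a standard fact that then $A$ is a finitely generated projective $R$-module whose center $Z(A)$ is $R\cdot 1_A \cong R$; the ring $R$ is identified with its image $R\cdot 1_A$ in $A$. For each prime $\mathfrak{p}$ of $R$, $A \otimes_R R_{\mathfrak{p}}$ is a free $R_{\mathfrak{p}}$-module of finite rank $r_{\mathfrak{p}}(A)$. $A$ has constant rank $r$ if $r_{\mathfrak{p}}(A) = r$ for every $\mathfrak{p} \in \mathrm{Spec}(R)$. "Of the same constant rank" means that there is one integer $r$ such that $A$ has constant rank $r$ over $R$ and $A'$ has constant rank $r$ over $R'$. *)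

theory Defs
  imports "HOL-Algebra.Algebra"
begin

text \<open>The library locale \<^locale>\<open>algebra\<close> requires both rings to be commutative; here only the
  base ring is.\<close>

locale assoc_algebra = module + ring M +
  assumes smult_assoc2:
      "\<lbrakk>a \<in> carrier R; x \<in> carrier M; y \<in> carrier M\<rbrakk> \<Longrightarrow>
       (a \<odot>\<^bsub>M\<^esub> x) \<otimes>\<^bsub>M\<^esub> y = a \<odot>\<^bsub>M\<^esub> (x \<otimes>\<^bsub>M\<^esub> y)"
    and smult_assoc3:
      "\<lbrakk>a \<in> carrier R; x \<in> carrier M; y \<in> carrier M\<rbrakk> \<Longrightarrow>
       x \<otimes>\<^bsub>M\<^esub> (a \<odot>\<^bsub>M\<^esub> y) = a \<odot>\<^bsub>M\<^esub> (x \<otimes>\<^bsub>M\<^esub> y)"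

definition finitely_generated_module ::
    "('a, 'r) ring_scheme \<Rightarrow> ('a, 'b, 'm) module_scheme \<Rightarrow> bool"
  where "finitely_generated_module R M \<longleftrightarrow>
    (\<exists>B. finite B \<and> B \<subseteq> carrier M \<and>
      (\<forall>x\<in>carrier M. \<exists>c\<in>B \<rightarrow> carrier R. x = (\<Oplus>\<^bsub>M\<^esub>b\<in>B. c b \<odot>\<^bsub>M\<^esub> b)))"

definition faithful_module ::
    "('a, 'r) ring_scheme \<Rightarrow> ('a, 'b, 'm) module_scheme \<Rightarrow> bool"
  where "faithful_module R M \<longleftrightarrow>
    (\<forall>a\<in>carrier R. (\<forall>x\<in>carrier M. a \<odot>\<^bsub>M\<^esub> x = \<zero>\<^bsub>M\<^esub>) \<longrightarrow> a = \<zero>\<^bsub>R\<^esub>)"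

definition free_module_of_rank ::
    "('a, 'r) ring_scheme \<Rightarrow> ('a, 'b, 'm) module_scheme \<Rightarrow> nat \<Rightarrow> bool"
  where "free_module_of_rank R M n \<longleftrightarrow>
    (\<exists>B. finite B \<and> card B = n \<and> B \<subseteq> carrier M \<and>
      (\<forall>x\<in>carrier M. \<exists>!c. c \<in> B \<rightarrow>\<^sub>E carrier R \<and> x = (\<Oplus>\<^bsub>M\<^esub>b\<in>B. c b \<odot>\<^bsub>M\<^esub> b)))"


subsection \<open>Central simple algebras and Azumaya algebras\<close>

definition ring_center :: "('b, 'm) ring_scheme \<Rightarrow> 'b set"
  where "ring_center A = {z \<in> carrier A. \<forall>x\<in>carrier A. z \<otimes>\<^bsub>A\<^esub> x = x \<otimes>\<^bsub>A\<^esub> z}"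

text \<open>The image \<open>R \<cdot> 1\<close> of the base ring in an algebra.\<close>

definition scalars :: "('a, 'r) ring_scheme \<Rightarrow> ('a, 'b, 'm) module_scheme \<Rightarrow> 'b set"
  where "scalars R A = (\<lambda>a. a \<odot>\<^bsub>A\<^esub> \<one>\<^bsub>A\<^esub>) ` carrier R"

definition simple_ring :: "('b, 'm) ring_scheme \<Rightarrow> bool"
  where "simple_ring A \<longleftrightarrow> ring A \<and> carrier A \<noteq> {\<zero>\<^bsub>A\<^esub>} \<and>
    (\<forall>I. ideal I A \<longrightarrow> I = {\<zero>\<^bsub>A\<^esub>} \<or> I = carrier A)"

definition central_simple_algebra ::
    "('a, 'r) ring_scheme \<Rightarrow> ('a, 'b, 'm) module_scheme \<Rightarrow> bool"
  where "central_simple_algebra K A \<longleftrightarrow>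
    field K \<and> assoc_algebra K A \<and> finitely_generated_module K A \<and>
    simple_ring A \<and> ring_center A = scalars K A"

definition ideal_times_module ::
    "'a set \<Rightarrow> ('a, 'b, 'm) module_scheme \<Rightarrow> 'b set"
  where "ideal_times_module I M =
    generate (add_monoid M) {a \<odot>\<^bsub>M\<^esub> x | a x. a \<in> I \<and> x \<in> carrier M}"

text \<open>The ring \<open>A/IA\<close> with its structure of an \<open>R/I\<close>-algebra. As in \<^const>\<open>rcoset_mult\<close>, the
  scalar multiplication takes the union of the results over all pairs of representatives.\<close>

definition quotient_algebra ::
    "'a set \<Rightarrow> ('a, 'b, 'm) module_scheme \<Rightarrow> ('a set, 'b set) module"
  where "quotient_algebra I A =
    (let J = ideal_times_module I A; Q = A Quot J in
      \<lparr>carrier = carrier Q, monoid.mult = monoid.mult Q, one = one Q,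
       ring.zero = ring.zero Q, add = add Q,
       smult = (\<lambda>C D. \<Union>a\<in>C. \<Union>x\<in>D. J +>\<^bsub>A\<^esub> (a \<odot>\<^bsub>A\<^esub> x))\<rparr>)"

locale azumaya_algebra = assoc_algebra R A for R and A (structure) +
  assumes finitely_generated: "finitely_generated_module R A"
    and faithful: "faithful_module R A"
    and central_simple_quotient:
      "maximalideal m R \<Longrightarrow> central_simple_algebra (R Quot m) (quotient_algebra m A)"


subsection \<open>Localization, base change and rank\<close>

text \<open>Fractions over a multiplicative set \<open>S\<close> are equivalence classes of pairs
  (numerator, denominator); the operations take the union over all representatives.\<close>

definition frac_class :: "('a, 'r) ring_scheme \<Rightarrow> 'a set \<Rightarrow> 'a \<Rightarrow> 'a \<Rightarrow> ('a \<times> 'a) set"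
  where "frac_class R S a s =
    {(b, t). b \<in> carrier R \<and> t \<in> S \<and>
      (\<exists>u\<in>S. u \<otimes>\<^bsub>R\<^esub> (t \<otimes>\<^bsub>R\<^esub> a) = u \<otimes>\<^bsub>R\<^esub> (s \<otimes>\<^bsub>R\<^esub> b))}"

definition localization :: "('a, 'r) ring_scheme \<Rightarrow> 'a set \<Rightarrow> ('a \<times> 'a) set ring"
  where "localization R S =
    \<lparr>carrier = {frac_class R S a s | a s. a \<in> carrier R \<and> s \<in> S},
     monoid.mult = (\<lambda>C D. \<Union>(a, s)\<in>C. \<Union>(b, t)\<in>D. frac_class R S (a \<otimes>\<^bsub>R\<^esub> b) (s \<otimes>\<^bsub>R\<^esub> t)),
     one = frac_class R S \<one>\<^bsub>R\<^esub> \<one>\<^bsub>R\<^esub>,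
     ring.zero = frac_class R S \<zero>\<^bsub>R\<^esub> \<one>\<^bsub>R\<^esub>,
     add = (\<lambda>C D. \<Union>(a, s)\<in>C. \<Union>(b, t)\<in>D.
       frac_class R S (t \<otimes>\<^bsub>R\<^esub> a \<oplus>\<^bsub>R\<^esub> s \<otimes>\<^bsub>R\<^esub> b) (s \<otimes>\<^bsub>R\<^esub> t))\<rparr>"

text \<open>The tensor product \<open>M \<otimes>\<^sub>R S\<close> along a ring homomorphism \<open>f : R \<rightarrow> S\<close>, as the free abelian
  group on \<open>M \<times> S\<close> modulo the relations of biadditivity and \<open>R\<close>-balancedness, with \<open>S\<close> acting
  on the second factor.\<close>

definition base_change_relations ::
    "('a, 'r) ring_scheme \<Rightarrow> ('s, 't) ring_scheme \<Rightarrow> ('a \<Rightarrow> 's) \<Rightarrow> ('a, 'b, 'm) module_scheme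
      \<Rightarrow> ('b \<times> 's \<Rightarrow>\<^sub>0 int) set"
  where "base_change_relations R S f M =
    {frag_of (x \<oplus>\<^bsub>M\<^esub> y, s) - frag_of (x, s) - frag_of (y, s) | x y s.
       x \<in> carrier M \<and> y \<in> carrier M \<and> s \<in> carrier S} \<union>
    {frag_of (x, s \<oplus>\<^bsub>S\<^esub> t) - frag_of (x, s) - frag_of (x, t) | x s t.
       x \<in> carrier M \<and> s \<in> carrier S \<and> t \<in> carrier S} \<union>
    {frag_of (a \<odot>\<^bsub>M\<^esub> x, s) - frag_of (x, f a \<otimes>\<^bsub>S\<^esub> s) | a x s.
       a \<in> carrier R \<and> x \<in> carrier M \<and> s \<in> carrier S}"

text \<open>Only the module structure is provided: the fields \<open>mult\<close> and \<open>one\<close> of the record play no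
  role in the locale \<^locale>\<open>module\<close>.\<close>

definition base_change ::
    "('a, 'r) ring_scheme \<Rightarrow> ('s, 't) ring_scheme \<Rightarrow> ('a \<Rightarrow> 's) \<Rightarrow> ('a, 'b, 'm) module_scheme
      \<Rightarrow> ('s, ('b \<times> 's \<Rightarrow>\<^sub>0 int) set) module"
  where "base_change R S f M =
    (let F = free_Abelian_group (carrier M \<times> carrier S);
         N = generate F (base_change_relations R S f M) in
      \<lparr>carrier = carrier (F Mod N), monoid.mult = undefined, one = undefined,
       ring.zero = one (F Mod N), add = monoid.mult (F Mod N),
       smult = (\<lambda>s C. \<Union>c\<in>C. N #>\<^bsub>F\<^esub> frag_extend (\<lambda>(x, t). frag_of (x, s \<otimes>\<^bsub>S\<^esub> t)) c)\<rparr>)"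

definition constant_rank ::
    "('a, 'r) ring_scheme \<Rightarrow> ('a, 'b, 'm) module_scheme \<Rightarrow> nat \<Rightarrow> bool"
  where "constant_rank R M r \<longleftrightarrow>
    (\<forall>p. primeideal p R \<longrightarrow>
      (let Rp = localization R (carrier R - p) in
        free_module_of_rank Rp
          (base_change R Rp (\<lambda>a. frac_class R (carrier R - p) a \<one>\<^bsub>R\<^esub>) M) r))"

end

theory Submission
  imports Defs
begin

text \<open>Constant rank yields, at every maximal ideal \<open>m\<close>, a local basis: a family of \<open>r\<close> elements that
  is a basis up to multiplication by elements outside \<open>m\<close>. A system of linear equations that is
  injective modulo \<open>m\<close> is injective locally at \<open>m\<close> (Gaussian elimination). Applied to the commutators
  with a local basis, this turns the centrality of \<open>A/mA\<close> into \<open>Z(A) = R \<cdot> 1\<close>, and an isomorphism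
  of rings respects centers.

  Conversely, identify \<open>R\<close> with \<open>R'\<close>. The preimage of \<open>mA'\<close> under \<open>\<phi>\<close> is a proper ideal containing
  \<open>mA\<close>, hence equal to \<open>mA\<close> by simplicity of \<open>A/mA\<close>. So \<open>\<phi>\<close> is injective modulo every \<open>m\<close>, which
  gives injectivity locally by elimination and, as the ranks agree, surjectivity locally by Steinitz
  exchange.\<close>

subsection \<open>Maximal ideals and linear systems modulo a prime\<close>

text \<open>Logically, localized rings and modules serve only to extract the local bases. All else
  happens inside \<open>R\<close> and \<open>M\<close>: a statement about the localization at
  \<open>m\<close> is read as "after multiplication by some element outside \<open>m\<close>". It
  becomes global through the ideal of all \<open>a\<close> with \<open>a x\<close> in a given
  submodule: an ideal that meets the complement of every maximal ideal contains 1. The obstacle for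
  the center is that 1 need not belong to a local basis. Since 1 is not in \<open>mA\<close>, one of
  its coordinates lies outside \<open>m\<close>, so 1 can take the place of one basis element. On
  the span of the others the commutator system is injective modulo \<open>m\<close>: an element
  central modulo \<open>mA\<close> is there a scalar multiple of 1, and the coordinate of the
  removed element forces that scalar into \<open>m\<close>. The commutator system has one equation
  for each element of the algebra, with a denominator that varies with the equation. Elimination
  tolerates this because it needs just one pivot equation for each of finitely many
  unknowns.\<close>

lemma (in cring) exists_maximalideal:
  assumes "ideal I R" "\<one> \<notin> I"
  obtains M where "maximalideal M R" "I \<subseteq> M"
proof -
  define F where "F = {J. ideal J R \<and> I \<subseteq> J \<and> \<one> \<notin> J}"
  have "\<exists>M\<in>F. \<forall>K\<in>F. M \<subseteq> K \<longrightarrow> K = M"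
  proof (rule subset_Zorn_nonempty)
    show "F \<noteq> {}"
      using assms by (auto simp: F_def)
    fix \<C> assume ne: "\<C> \<noteq> {}" and ch: "subset.chain F \<C>"
    have sub: "J \<in> \<C> \<Longrightarrow> ideal J R \<and> I \<subseteq> J \<and> \<one> \<notin> J" for J
      using ch by (auto simp: F_def subset_chain_def)
    have "ideal (\<Union>\<C>) R"
    proof (rule idealI)
      show "subgroup (\<Union>\<C>) (add_monoid R)"
      proof (rule add.subgroupI)
        show "\<Union>\<C> \<subseteq> carrier R"
          using sub by (meson Union_least additive_subgroup.a_subset ideal.axioms(1))
        show "\<Union>\<C> \<noteq> {}"
          using ne sub by (metis Union_empty_conv additive_subgroup.zero_closed empty_iff equals0I ideal.axioms(1))
        fix a assume "a \<in> \<Union>\<C>"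
        then show "\<ominus> a \<in> \<Union>\<C>"
          using sub by (meson UnionE UnionI additive_subgroup.a_inv_closed ideal.axioms(1))
        fix b assume "b \<in> \<Union>\<C>"
        then obtain J K where "J \<in> \<C>" "K \<in> \<C>" "a \<in> J" "b \<in> K"
          using \<open>a \<in> \<Union>\<C>\<close> by auto
        moreover have "J \<subseteq> K \<or> K \<subseteq> J"
          using ch \<open>J \<in> \<C>\<close> \<open>K \<in> \<C>\<close> by (auto simp: subset_chain_def)
        ultimately obtain L where "L \<in> \<C>" "a \<in> L" "b \<in> L"
          by blast
        then show "a \<oplus> b \<in> \<Union>\<C>"
          using sub by (meson UnionI additive_subgroup.a_closed ideal.axioms(1))
      qed
    qed (use sub ring_axioms in \<open>auto intro: ideal.I_l_closed ideal.I_r_closed\<close>)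
    then show "\<Union>\<C> \<in> F"
      using ne sub by (auto simp: F_def)
  qed
  then obtain M where M: "ideal M R" "I \<subseteq> M" "\<one> \<notin> M"
    and max: "\<And>K. ideal K R \<Longrightarrow> \<one> \<notin> K \<Longrightarrow> M \<subseteq> K \<Longrightarrow> K = M"
    by (auto simp: F_def)
  have "maximalideal M R"
    using M max by (intro maximalidealI) (auto dest: ideal.one_imp_carrier)
  with M(2) that show thesis
    by blast
qed

lemma (in primeideal) one_notin: "\<one> \<notin> I"
  using I_notcarr one_imp_carrier by blast

lemma (in primeideal) mult_notin:
  "\<lbrakk>s \<in> carrier R - I; t \<in> carrier R - I\<rbrakk> \<Longrightarrow> s \<otimes> t \<in> carrier R - I"
  by (auto dest: I_prime)

text \<open>Gaussian elimination: an equation with a coefficient outside the prime ideal is solved for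
  its unknown, up to multiplication with that coefficient.\<close>

lemma (in primeideal) locally_injective:
  assumes "finite J"
    and "\<And>q. q \<in> Q \<Longrightarrow> g q \<in> J \<rightarrow> carrier R"
    and "\<And>c. \<lbrakk>c \<in> J \<rightarrow> carrier R; \<And>q. q \<in> Q \<Longrightarrow> (\<Oplus>j\<in>J. c j \<otimes> g q j) \<in> I\<rbrakk> \<Longrightarrow> c \<in> J \<rightarrow> I"
    and "n \<in> J \<rightarrow> carrier R"
    and "\<And>q. q \<in> Q \<Longrightarrow> \<exists>t\<in>carrier R - I. t \<otimes> (\<Oplus>j\<in>J. n j \<otimes> g q j) = \<zero>"
  shows "\<exists>u\<in>carrier R - I. \<forall>j\<in>J. u \<otimes> n j = \<zero>"
  using assms
proof (induction J arbitrary: g n rule: finite_induct)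
  case empty
  show ?case
    using one_notin by auto
next
  case (insert i F)
  note g = insert.prems(1) and inj = insert.prems(2) and n = insert.prems(3) and eq = insert.prems(4)
  have gF: "\<And>q j. q \<in> Q \<Longrightarrow> j \<in> F \<Longrightarrow> g q j \<in> carrier R" and gi: "\<And>q. q \<in> Q \<Longrightarrow> g q i \<in> carrier R"
    using g by auto
  have sum_insert: "(\<Oplus>j\<in>insert i F. c j \<otimes> g q j) = c i \<otimes> g q i \<oplus> (\<Oplus>j\<in>F. c j \<otimes> g q j)"
    if "c \<in> insert i F \<rightarrow> carrier R" "q \<in> Q" for c q
    using that insert.hyps gF gi by (intro finsum_insert) auto
  \<comment> \<open>Otherwise the unit vector at \<open>i\<close> would solve every equation modulo
    \<open>I\<close>, although its entry 1 is not in \<open>I\<close>.\<close>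
  have "\<exists>p\<in>Q. g p i \<notin> I"
  proof (rule ccontr)
    assume none: "\<not> ?thesis"
    define c where "c = (\<lambda>j. if j = i then \<one> else \<zero>)"
    have "(\<Oplus>j\<in>insert i F. c j \<otimes> g q j) \<in> I" if "q \<in> Q" for q
    proof -
      have "(\<Oplus>j\<in>F. c j \<otimes> g q j) = \<zero>"
        using insert.hyps gF[OF that] by (intro add.finprod_one_eqI) (auto simp: c_def)
      then show ?thesis
        using none gi[OF that] that sum_insert[of c q] by (auto simp: c_def)
    qed
    then have "c i \<in> I"
      using inj[of c] by (auto simp: c_def)
    then show False
      using one_notin by (simp add: c_def)
  qed
  then obtain p where p: "p \<in> Q" and hI: "g p i \<notin> I"
    by blast
  define h where "h = g p i"
  have h: "h \<in> carrier R"
    using gi p by (simp add: h_def)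
  \<comment> \<open>Pivoting without fractions: the unknown \<open>i\<close> cancels from
    \<open>h\<close> times equation \<open>q\<close> minus \<open>g q i\<close> times equation
    \<open>p\<close>. Equation \<open>p\<close> itself becomes trivial, so \<open>Q\<close> can
    remain the index set.\<close>
  define g' where "g' = (\<lambda>q j. h \<otimes> g q j \<ominus> g q i \<otimes> g p j)"
  have g': "g' q \<in> F \<rightarrow> carrier R" if "q \<in> Q" for q
    using that gF gi p h by (auto simp: g'_def)
  have S: "(\<Oplus>j\<in>F. c j \<otimes> g q j) \<in> carrier R" if "c \<in> F \<rightarrow> carrier R" "q \<in> Q" for c q
    using that gF by (intro finsum_closed) auto
  have key: "(\<Oplus>j\<in>F. c j \<otimes> g' q j) = h \<otimes> (\<Oplus>j\<in>F. c j \<otimes> g q j) \<ominus> g q i \<otimes> (\<Oplus>j\<in>F. c j \<otimes> g p j)"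
    if "c \<in> F \<rightarrow> carrier R" and q: "q \<in> Q" for c q
    using \<open>finite F\<close> that(1) gF
  proof (induction F rule: finite_induct)
    case empty
    then show ?case
      using h gi[OF q] by simp algebra
  next
    case (insert x F)
    have cr: "c x \<in> carrier R" "g q x \<in> carrier R" "g p x \<in> carrier R"
      "(\<Oplus>j\<in>F. c j \<otimes> g q j) \<in> carrier R" "(\<Oplus>j\<in>F. c j \<otimes> g p j) \<in> carrier R"
      using insert p q by (auto intro!: finsum_closed)
    have ins: "(\<Oplus>j\<in>insert x F. c j \<otimes> f j) = c x \<otimes> f x \<oplus> (\<Oplus>j\<in>F. c j \<otimes> f j)"
      if "f \<in> insert x F \<rightarrow> carrier R" for f
      using that insert by (intro finsum_insert) auto
    have IH: "(\<Oplus>j\<in>F. c j \<otimes> g' q j) =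
        h \<otimes> (\<Oplus>j\<in>F. c j \<otimes> g q j) \<ominus> g q i \<otimes> (\<Oplus>j\<in>F. c j \<otimes> g p j)"
      using insert by auto
    have *: "(\<Oplus>j\<in>insert x F. c j \<otimes> g' q j) = c x \<otimes> (h \<otimes> g q x \<ominus> g q i \<otimes> g p x) \<oplus>
        (h \<otimes> (\<Oplus>j\<in>F. c j \<otimes> g q j) \<ominus> g q i \<otimes> (\<Oplus>j\<in>F. c j \<otimes> g p j))"
      using ins[of "g' q"] IH insert.prems p q gi h by (auto simp: g'_def)
    have **: "(\<Oplus>j\<in>insert x F. c j \<otimes> g q j) = c x \<otimes> g q x \<oplus> (\<Oplus>j\<in>F. c j \<otimes> g q j)"
      "(\<Oplus>j\<in>insert x F. c j \<otimes> g p j) = c x \<otimes> g p x \<oplus> (\<Oplus>j\<in>F. c j \<otimes> g p j)"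
      using insert.prems p q by (auto intro!: ins)
    have "a \<otimes> (h \<otimes> b \<ominus> d \<otimes> e) \<oplus> (h \<otimes> s \<ominus> d \<otimes> s') = h \<otimes> (a \<otimes> b \<oplus> s) \<ominus> d \<otimes> (a \<otimes> e \<oplus> s')"
      if "a \<in> carrier R" "b \<in> carrier R" "d \<in> carrier R" "e \<in> carrier R" "s \<in> carrier R"
        "s' \<in> carrier R" for a b d e s s'
      using that h by algebra
    then show ?case
      unfolding * ** using cr gi[OF q] by blast
  qed
  have "\<exists>u\<in>carrier R - I. \<forall>j\<in>F. u \<otimes> n j = \<zero>"
  proof (rule insert.IH[OF g'])
    fix c assume c: "c \<in> F \<rightarrow> carrier R" and cI: "\<And>q. q \<in> Q \<Longrightarrow> (\<Oplus>j\<in>F. c j \<otimes> g' q j) \<in> I"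
    \<comment> \<open>Back substitution: scaling \<open>c\<close> by \<open>h\<close> lets equation
      \<open>p\<close> be solved for the unknown \<open>i\<close> without division. Equation
      \<open>q\<close> at \<open>c'\<close> then has the same value as the reduced equation
      \<open>q\<close> at \<open>c\<close>.\<close>
    define c' where "c' = (\<lambda>j. if j = i then \<ominus> (\<Oplus>j\<in>F. c j \<otimes> g p j) else h \<otimes> c j)"
    have c': "c' \<in> insert i F \<rightarrow> carrier R"
      using c S[OF c p] h by (auto simp: c'_def Pi_iff)
    have "(\<Oplus>j\<in>insert i F. c' j \<otimes> g q j) \<in> I" if q: "q \<in> Q" for q
    proof -
      have "(\<Oplus>j\<in>F. c' j \<otimes> g q j) = (\<Oplus>j\<in>F. h \<otimes> (c j \<otimes> g q j))"
        using c h gF[OF q] insert.hyps by (intro finsum_cong') (auto simp: c'_def Pi_def m_assoc)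
      also have "\<dots> = h \<otimes> (\<Oplus>j\<in>F. c j \<otimes> g q j)"
        using c h gF[OF q] insert.hyps by (intro finsum_rdistr[symmetric]) auto
      finally have "(\<Oplus>j\<in>insert i F. c' j \<otimes> g q j) = (\<Oplus>j\<in>F. c j \<otimes> g' q j)"
        using sum_insert[OF c' q] key[OF c q] S[OF c p] S[OF c q] gi[OF q] h
        by (simp add: c'_def l_minus r_minus minus_eq a_comm m_comm)
      then show ?thesis
        using cI[OF q] by simp
    qed
    then have "c' \<in> insert i F \<rightarrow> I"
      using inj[OF c'] by blast
    then have "h \<otimes> c j \<in> I" if "j \<in> F" for j
      using that insert.hyps(2) funcset_mem[of c' "insert i F" I j]
      by (cases "j = i") (auto simp: c'_def)
    then show "c \<in> F \<rightarrow> I"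
      using c h hI I_prime by (auto simp: h_def Pi_def)
  next
    show "n \<in> F \<rightarrow> carrier R"
      using n by auto
  next
    fix q assume q: "q \<in> Q"
    have nF: "n \<in> F \<rightarrow> carrier R" and ni: "n i \<in> carrier R"
      using n by auto
    obtain t where t: "t \<in> carrier R - I" "t \<otimes> (n i \<otimes> g q i \<oplus> (\<Oplus>j\<in>F. n j \<otimes> g q j)) = \<zero>"
      using eq[OF q] sum_insert[OF n q] by auto
    obtain t' where t': "t' \<in> carrier R - I" "t' \<otimes> (n i \<otimes> h \<oplus> (\<Oplus>j\<in>F. n j \<otimes> g p j)) = \<zero>"
      using eq[OF p] sum_insert[OF n p] by (auto simp: h_def)
    \<comment> \<open>The terms in \<open>m\<close>, the value of the eliminated unknown, cancel.
      The right side combines the two given equations, each already multiplied by its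
      annihilator.\<close>
    have id: "t \<otimes> t' \<otimes> (h \<otimes> x \<ominus> d \<otimes> y) =
        t' \<otimes> h \<otimes> (t \<otimes> (m \<otimes> d \<oplus> x)) \<ominus> t \<otimes> d \<otimes> (t' \<otimes> (m \<otimes> h \<oplus> y))"
      if "t \<in> carrier R" "t' \<in> carrier R" "h \<in> carrier R" "m \<in> carrier R" "d \<in> carrier R"
        "x \<in> carrier R" "y \<in> carrier R" for t t' h m d x y
      using that by algebra
    have "t \<otimes> t' \<otimes> (\<Oplus>j\<in>F. n j \<otimes> g' q j) =
        t' \<otimes> h \<otimes> (t \<otimes> (n i \<otimes> g q i \<oplus> (\<Oplus>j\<in>F. n j \<otimes> g q j))) \<ominus>
        t \<otimes> g q i \<otimes> (t' \<otimes> (n i \<otimes> h \<oplus> (\<Oplus>j\<in>F. n j \<otimes> g p j)))"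
      unfolding key[OF nF q]
      using id[OF _ _ h ni gi[OF q] S[OF nF q] S[OF nF p]] t(1) t'(1) by blast
    also have "\<dots> = \<zero>"
      using t t' h gi[OF q] by (simp add: minus_eq)
    finally show "\<exists>t\<in>carrier R - I. t \<otimes> (\<Oplus>j\<in>F. n j \<otimes> g' q j) = \<zero>"
      using t(1) t'(1) I_prime by (intro bexI[of _ "t \<otimes> t'"]) auto
  qed
  then obtain u where u: "u \<in> carrier R - I" "\<And>j. j \<in> F \<Longrightarrow> u \<otimes> n j = \<zero>"
    by blast
  have nF: "n \<in> F \<rightarrow> carrier R" and ni: "n i \<in> carrier R"
    using n by auto
  obtain t where t: "t \<in> carrier R - I" "t \<otimes> (n i \<otimes> h \<oplus> (\<Oplus>j\<in>F. n j \<otimes> g p j)) = \<zero>"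
    using eq[OF p] sum_insert[OF n p] by (auto simp: h_def)
  have "u \<otimes> (\<Oplus>j\<in>F. n j \<otimes> g p j) = (\<Oplus>j\<in>F. u \<otimes> (n j \<otimes> g p j))"
    using u nF gF[OF p] insert.hyps by (intro finsum_rdistr) auto
  also have "\<dots> = \<zero>"
    using u nF gF[OF p] by (intro add.finprod_one_eqI) (auto simp: m_assoc[symmetric] Pi_def)
  finally have "u \<otimes> (\<Oplus>j\<in>F. n j \<otimes> g p j) = \<zero>" .
  \<comment> \<open>Since \<open>u\<close> kills the sum \<open>y\<close> over the remaining
    unknowns, the pivot equation leaves only its term in \<open>n i\<close>.\<close>
  moreover have id: "u \<otimes> t \<otimes> h \<otimes> m = u \<otimes> (t \<otimes> (m \<otimes> h \<oplus> y)) \<ominus> t \<otimes> (u \<otimes> y)"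
    if "u \<in> carrier R" "t \<in> carrier R" "h \<in> carrier R" "m \<in> carrier R" "y \<in> carrier R" for u t h m y
    using that by algebra
  moreover have "u \<otimes> t \<otimes> h \<otimes> n i =
      u \<otimes> (t \<otimes> (n i \<otimes> h \<oplus> (\<Oplus>j\<in>F. n j \<otimes> g p j))) \<ominus> t \<otimes> (u \<otimes> (\<Oplus>j\<in>F. n j \<otimes> g p j))"
    using id[OF _ _ h ni S[OF nF p]] u(1) t(1) by blast
  ultimately have "u \<otimes> t \<otimes> h \<otimes> n i = \<zero>"
    using u t by (simp add: minus_eq)
  moreover have "u \<otimes> t \<otimes> h \<otimes> n j = \<zero>" if "j \<in> F" for j
  proof -
    have "u \<otimes> t \<otimes> h \<otimes> n j = t \<otimes> h \<otimes> (u \<otimes> n j)"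
      using u(1) t(1) h funcset_mem[OF nF that] by (simp add: m_ac)
    then show ?thesis
      using u t h that by simp
  qed
  moreover have "u \<otimes> t \<otimes> h \<in> carrier R - I"
    using mult_notin[OF mult_notin[OF u(1) t(1)], of h] h hI by (auto simp: h_def)
  ultimately show ?case
    by blast
qed

subsection \<open>Local bases of modules\<close>

context module
begin

lemma smult_commute:
  "\<lbrakk>a \<in> carrier R; b \<in> carrier R; x \<in> carrier M\<rbrakk> \<Longrightarrow> a \<odot>\<^bsub>M\<^esub> (b \<odot>\<^bsub>M\<^esub> x) = b \<odot>\<^bsub>M\<^esub> (a \<odot>\<^bsub>M\<^esub> x)"
  by (simp add: smult_assoc1[symmetric] R.m_comm)

abbreviation lincomb :: "('i \<Rightarrow> 'a) \<Rightarrow> ('i \<Rightarrow> 'c) \<Rightarrow> 'i set \<Rightarrow> 'c"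
  where "lincomb c e J \<equiv> (\<Oplus>\<^bsub>M\<^esub>j\<in>J. c j \<odot>\<^bsub>M\<^esub> e j)"

lemma lincomb_closed:
  "\<lbrakk>c \<in> J \<rightarrow> carrier R; e \<in> J \<rightarrow> carrier M\<rbrakk> \<Longrightarrow> lincomb c e J \<in> carrier M"
  by (intro M.finsum_closed) (auto simp: Pi_iff)

lemma lincomb_cong:
  assumes "e \<in> J \<rightarrow> carrier M" "d \<in> J \<rightarrow> carrier R" "\<And>j. j \<in> J \<Longrightarrow> c j = d j"
    "\<And>j. j \<in> J \<Longrightarrow> f j = e j"
  shows "lincomb c f J = lincomb d e J"
  using assms by (intro M.finsum_cong') (auto simp: Pi_iff)

lemma lincomb_insert:
  assumes "finite J" "j \<notin> J" "c \<in> insert j J \<rightarrow> carrier R" "e \<in> insert j J \<rightarrow> carrier M"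
  shows "lincomb c e (insert j J) = c j \<odot>\<^bsub>M\<^esub> e j \<oplus>\<^bsub>M\<^esub> lincomb c e J"
  using assms by (intro M.finsum_insert) (auto simp: Pi_iff)

lemma lincomb_add:
  assumes "c \<in> J \<rightarrow> carrier R" "d \<in> J \<rightarrow> carrier R" "e \<in> J \<rightarrow> carrier M"
  shows "lincomb (\<lambda>j. c j \<oplus> d j) e J = lincomb c e J \<oplus>\<^bsub>M\<^esub> lincomb d e J"
proof -
  have "lincomb (\<lambda>j. c j \<oplus> d j) e J = (\<Oplus>\<^bsub>M\<^esub>j\<in>J. c j \<odot>\<^bsub>M\<^esub> e j \<oplus>\<^bsub>M\<^esub> d j \<odot>\<^bsub>M\<^esub> e j)"
    using assms by (intro M.finsum_cong') (auto simp: Pi_iff smult_l_distr)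
  also have "\<dots> = lincomb c e J \<oplus>\<^bsub>M\<^esub> lincomb d e J"
    using assms by (intro M.finsum_addf) (auto simp: Pi_iff)
  finally show ?thesis .
qed

lemma smult_lincomb:
  assumes "finite J" "a \<in> carrier R" "c \<in> J \<rightarrow> carrier R" "e \<in> J \<rightarrow> carrier M"
  shows "a \<odot>\<^bsub>M\<^esub> lincomb c e J = lincomb (\<lambda>j. a \<otimes> c j) e J"
proof -
  have "a \<odot>\<^bsub>M\<^esub> lincomb c e J = (\<Oplus>\<^bsub>M\<^esub>j\<in>J. a \<odot>\<^bsub>M\<^esub> (c j \<odot>\<^bsub>M\<^esub> e j))"
    using assms by (intro finsum_smult_ldistr) (auto simp: Pi_iff)
  also have "\<dots> = lincomb (\<lambda>j. a \<otimes> c j) e J"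
    using assms by (intro M.finsum_cong') (auto simp: Pi_iff smult_assoc1)
  finally show ?thesis .
qed

lemma lincomb_zero: "(\<And>j. j \<in> J \<Longrightarrow> c j = \<zero>) \<Longrightarrow> e \<in> J \<rightarrow> carrier M \<Longrightarrow> lincomb c e J = \<zero>\<^bsub>M\<^esub>"
  by (intro M.add.finprod_one_eqI) (auto simp: Pi_iff)

lemma lincomb_uminus:
  assumes "finite J" "c \<in> J \<rightarrow> carrier R" "e \<in> J \<rightarrow> carrier M"
  shows "lincomb (\<lambda>j. \<ominus> c j) e J = \<ominus>\<^bsub>M\<^esub> lincomb c e J"
proof -
  have "lincomb (\<lambda>j. \<ominus> c j) e J = lincomb (\<lambda>j. \<ominus> \<one> \<otimes> c j) e J"
    using assms by (intro lincomb_cong) (auto simp: Pi_iff R.l_minus)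
  also have "\<dots> = \<ominus>\<^bsub>M\<^esub> lincomb c e J"
    using assms smult_lincomb[of J "\<ominus> \<one>" c e] lincomb_closed[of c J e] by (simp add: smult_l_minus)
  finally show ?thesis .
qed

lemma lincomb_lincomb:
  assumes "finite J" "finite K" "c \<in> J \<rightarrow> carrier R" "\<And>j. j \<in> J \<Longrightarrow> g j \<in> K \<rightarrow> carrier R"
    "e \<in> K \<rightarrow> carrier M"
  shows "lincomb c (\<lambda>j. lincomb (g j) e K) J = lincomb (\<lambda>k. \<Oplus>j\<in>J. c j \<otimes> g j k) e K"
  using assms
proof (induction J rule: finite_induct)
  case empty
  then show ?case
    by (simp add: lincomb_zero)
next
  case (insert i J)
  have closed: "(\<lambda>k. \<Oplus>j\<in>J. c j \<otimes> g j k) \<in> K \<rightarrow> carrier R"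
    using insert.prems by (auto intro!: R.finsum_closed simp: Pi_iff)
  have "lincomb c (\<lambda>j. lincomb (g j) e K) (insert i J) =
      lincomb (\<lambda>k. c i \<otimes> g i k) e K \<oplus>\<^bsub>M\<^esub> lincomb (\<lambda>k. \<Oplus>j\<in>J. c j \<otimes> g j k) e K"
    using insert by (subst lincomb_insert) (auto simp: lincomb_closed smult_lincomb)
  also have "\<dots> = lincomb (\<lambda>k. c i \<otimes> g i k \<oplus> (\<Oplus>j\<in>J. c j \<otimes> g j k)) e K"
    using insert.prems closed by (intro lincomb_add[symmetric]) (auto simp: Pi_iff)
  also have "\<dots> = lincomb (\<lambda>k. \<Oplus>j\<in>insert i J. c j \<otimes> g j k) e K"
    using insert by (intro lincomb_cong) (auto simp: Pi_iff R.finsum_closed)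
  finally show ?case .
qed

end

text \<open>For a prime \<open>P\<close> this is generation of the localization of \<open>M\<close>
  at \<open>P\<close>, with all denominators cleared so that only elements of \<open>R\<close> and
  \<open>M\<close> occur.\<close>

definition locally_spans ::
    "('a, 'r) ring_scheme \<Rightarrow> ('a, 'b, 'm) module_scheme \<Rightarrow> 'a set \<Rightarrow> 'i set \<Rightarrow> ('i \<Rightarrow> 'b) \<Rightarrow> bool"
  where "locally_spans R M P J e \<longleftrightarrow>
    (\<forall>x\<in>carrier M. \<exists>s\<in>carrier R - P. \<exists>c\<in>J \<rightarrow> carrier R. s \<odot>\<^bsub>M\<^esub> x = (\<Oplus>\<^bsub>M\<^esub>j\<in>J. c j \<odot>\<^bsub>M\<^esub> e j))"

lemma locally_spansE:
  assumes "locally_spans R M P J e" "x \<in> carrier M"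
  obtains s c where "s \<in> carrier R - P" "c \<in> J \<rightarrow> carrier R"
    "s \<odot>\<^bsub>M\<^esub> x = (\<Oplus>\<^bsub>M\<^esub>j\<in>J. c j \<odot>\<^bsub>M\<^esub> e j)"
  using assms unfolding locally_spans_def by blast

definition locally_independent ::
    "('a, 'r) ring_scheme \<Rightarrow> ('a, 'b, 'm) module_scheme \<Rightarrow> 'a set \<Rightarrow> 'i set \<Rightarrow> ('i \<Rightarrow> 'b) \<Rightarrow> bool"
  where "locally_independent R M P J e \<longleftrightarrow>
    (\<forall>c\<in>J \<rightarrow> carrier R. (\<Oplus>\<^bsub>M\<^esub>j\<in>J. c j \<odot>\<^bsub>M\<^esub> e j) = \<zero>\<^bsub>M\<^esub> \<longrightarrow>
      (\<exists>s\<in>carrier R - P. \<forall>j\<in>J. s \<otimes>\<^bsub>R\<^esub> c j = \<zero>\<^bsub>R\<^esub>))"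

text \<open>For a prime \<open>P\<close>, the images of the \<open>e j\<close> form a basis of the
  localization at \<open>P\<close>. An indexed family instead of a set allows the image of a basis
  under a map to be treated before that map is known to be injective.\<close>

definition local_basis ::
    "('a, 'r) ring_scheme \<Rightarrow> ('a, 'b, 'm) module_scheme \<Rightarrow> 'a set \<Rightarrow> 'i set \<Rightarrow> ('i \<Rightarrow> 'b) \<Rightarrow> bool"
  where "local_basis R M P J e \<longleftrightarrow>
    finite J \<and> e \<in> J \<rightarrow> carrier M \<and> locally_spans R M P J e \<and> locally_independent R M P J e"

context module
begin

lemma ideal_times_module_mult:
  "\<lbrakk>a \<in> I; x \<in> carrier M\<rbrakk> \<Longrightarrow> a \<odot>\<^bsub>M\<^esub> x \<in> ideal_times_module I M"
  unfolding ideal_times_module_def by (auto intro: generate.incl)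

text \<open>The generation is only additive; closure under scalars holds because a scalar multiple
  of a generator is again a generator.\<close>

lemma submodule_ideal_times_module:
  assumes "ideal I R"
  shows "submodule (ideal_times_module I M) R M"
proof -
  interpret I: ideal I R
    by fact
  let ?G = "{a \<odot>\<^bsub>M\<^esub> x | a x. a \<in> I \<and> x \<in> carrier M}"
  have G: "?G \<subseteq> carrier M"
    using I.Icarr by auto
  show ?thesis
  proof (rule submodule.intro)
    show "subgroup (ideal_times_module I M) (add_monoid M)"
      unfolding ideal_times_module_def using G by (intro M.add.generate_is_subgroup) auto
    show "submodule_axioms (ideal_times_module I M) R M"
    proof
      fix a x assume a: "a \<in> carrier R" and "x \<in> ideal_times_module I M"
      from this(2) show "a \<odot>\<^bsub>M\<^esub> x \<in> ideal_times_module I M"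
        unfolding ideal_times_module_def
      proof (induction x rule: generate.induct)
        case one
        show ?case
          using a generate.one[of "add_monoid M"] by simp
      next
        case (incl h)
        then obtain b y where "b \<in> I" "y \<in> carrier M" "h = b \<odot>\<^bsub>M\<^esub> y"
          by blast
        then have "a \<odot>\<^bsub>M\<^esub> h \<in> ?G"
          using a I.Icarr I.I_l_closed by (auto simp: smult_assoc1[symmetric])
        then show ?case
          by (rule generate.incl)
      next
        case (inv h)
        then obtain b y where h: "b \<in> I" "y \<in> carrier M" "h = b \<odot>\<^bsub>M\<^esub> y"
          by blast
        then have "a \<odot>\<^bsub>M\<^esub> h \<in> ?G"
          using a I.Icarr I.I_l_closed by (auto simp: smult_assoc1[symmetric])
        then have "inv\<^bsub>add_monoid M\<^esub> (a \<odot>\<^bsub>M\<^esub> h) \<in> generate (add_monoid M) ?G"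
          by (rule generate.inv)
        moreover have "a \<odot>\<^bsub>M\<^esub> (\<ominus>\<^bsub>M\<^esub> h) = \<ominus>\<^bsub>M\<^esub> (a \<odot>\<^bsub>M\<^esub> h)"
          using a h I.Icarr by (simp add: smult_r_minus)
        ultimately show ?case
          by (simp add: a_inv_def)
      next
        case (eng x y)
        then have "x \<in> carrier M" "y \<in> carrier M"
          using M.add.generate_incl[of ?G] G by auto
        then show ?case
          using eng a generate.eng[of _ "add_monoid M"] by (simp add: smult_r_distr)
      qed
    qed
  qed
qed

lemma lincomb_in_submodule:
  assumes "submodule W R M" "finite J" "\<And>j. j \<in> J \<Longrightarrow> c j \<odot>\<^bsub>M\<^esub> e j \<in> W"
  shows "lincomb c e J \<in> W"
  using assms(2,3)
proof (induction J rule: finite_induct)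
  case empty
  then show ?case
    using assms(1) by (simp add: submodule.axioms(1) subgroup.one_closed[of W "add_monoid M", simplified])
next
  case (insert j J)
  note W = submoduleE[OF assms(1)]
  have "lincomb c e (insert j J) = c j \<odot>\<^bsub>M\<^esub> e j \<oplus>\<^bsub>M\<^esub> lincomb c e J"
    using insert W(1) by (intro M.finsum_insert) auto
  then show ?case
    using insert W(5) by auto
qed

text \<open>For a generator \<open>a x\<close> with \<open>a\<close> in \<open>P\<close>, the
  coordinates of \<open>x\<close> get multiplied by \<open>a\<close> and so fall into
  \<open>P\<close>. Sums are brought to the product of the two denominators.\<close>

lemma ideal_times_module_coords:
  assumes P: "primeideal P R" and e: "local_basis R M P J e" and "y \<in> ideal_times_module P M"
  shows "\<exists>s\<in>carrier R - P. \<exists>c\<in>J \<rightarrow> P. s \<odot>\<^bsub>M\<^esub> y = lincomb c e J"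
proof -
  interpret P: primeideal P R
    by fact
  have J: "finite J" and eM: "e \<in> J \<rightarrow> carrier M" and span: "locally_spans R M P J e"
    using e by (auto simp: local_basis_def)
  have gen: "\<exists>s\<in>carrier R - P. \<exists>c\<in>J \<rightarrow> P. s \<odot>\<^bsub>M\<^esub> h = lincomb c e J"
    if h: "a \<in> P" "x \<in> carrier M" "h = a \<odot>\<^bsub>M\<^esub> x" for a x h
  proof -
    obtain s c where s: "s \<in> carrier R - P" and c: "c \<in> J \<rightarrow> carrier R" "s \<odot>\<^bsub>M\<^esub> x = lincomb c e J"
      using locally_spansE[OF span h(2)] by blast
    have "s \<odot>\<^bsub>M\<^esub> h = a \<odot>\<^bsub>M\<^esub> (s \<odot>\<^bsub>M\<^esub> x)"
      using s that P.Icarr by (simp add: smult_assoc1[symmetric] R.m_comm)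
    also have "\<dots> = lincomb (\<lambda>j. a \<otimes> c j) e J"
      using J eM c P.Icarr that by (simp add: smult_lincomb)
    finally show ?thesis
      using s c that P.I_r_closed by (intro bexI[of _ s] bexI[of _ "\<lambda>j. a \<otimes> c j"]) (auto simp: Pi_iff)
  qed
  let ?G = "{a \<odot>\<^bsub>M\<^esub> x | a x. a \<in> P \<and> x \<in> carrier M}"
  have G: "?G \<subseteq> carrier M"
    using P.Icarr by auto
  have "y \<in> generate (add_monoid M) ?G"
    using assms(3) by (simp add: ideal_times_module_def)
  then show ?thesis
  proof (induction y rule: generate.induct)
    case one
    show ?case
      using P.one_notin eM by (intro bexI[of _ \<one>] bexI[of _ "\<lambda>_. \<zero>"]) (auto simp: lincomb_zero)
  next
    case (incl h)
    then show ?case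
      using gen by blast
  next
    case (inv h)
    then obtain a x where "a \<in> P" "x \<in> carrier M" "h = a \<odot>\<^bsub>M\<^esub> x"
      by blast
    then have "inv\<^bsub>add_monoid M\<^esub> h = (\<ominus> a) \<odot>\<^bsub>M\<^esub> x"
      using P.Icarr by (simp add: smult_l_minus flip: a_inv_def)
    then show ?case
      using gen \<open>a \<in> P\<close> \<open>x \<in> carrier M\<close> by blast
  next
    case (eng y z)
    then have yz: "y \<in> carrier M" "z \<in> carrier M"
      using M.add.generate_incl[of ?G] G by auto
    obtain s c where s: "s \<in> carrier R - P" "c \<in> J \<rightarrow> P" "s \<odot>\<^bsub>M\<^esub> y = lincomb c e J"
      using eng by blast
    obtain t d where t: "t \<in> carrier R - P" "d \<in> J \<rightarrow> P" "t \<odot>\<^bsub>M\<^esub> z = lincomb d e J"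
      using eng by blast
    have c: "c \<in> J \<rightarrow> carrier R" and d: "d \<in> J \<rightarrow> carrier R"
      using s t P.Icarr by (auto simp: Pi_iff)
    have "(s \<otimes> t) \<odot>\<^bsub>M\<^esub> (y \<oplus>\<^bsub>M\<^esub> z) = t \<odot>\<^bsub>M\<^esub> (s \<odot>\<^bsub>M\<^esub> y) \<oplus>\<^bsub>M\<^esub> s \<odot>\<^bsub>M\<^esub> (t \<odot>\<^bsub>M\<^esub> z)"
      using s t yz by (simp add: smult_assoc1 smult_commute[of s t] smult_r_distr)
    also have "\<dots> = lincomb (\<lambda>j. t \<otimes> c j \<oplus> s \<otimes> d j) e J"
      using s t c d J eM by (subst lincomb_add) (auto simp: smult_lincomb Pi_iff)
    finally show ?case
      using P.mult_notin[OF s(1) t(1)] s t P.I_l_closed P.a_closed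
      by (intro bexI[of _ "s \<otimes> t"] bexI[of _ "\<lambda>j. t \<otimes> c j \<oplus> s \<otimes> d j"]) (auto simp: Pi_iff)
  qed
qed

text \<open>Elements of \<open>PM\<close> have coordinates in \<open>P\<close>, and coordinates are
  unique up to a factor outside \<open>P\<close>. Hence a local basis stays independent modulo
  \<open>PM\<close>.\<close>

lemma local_basis_independent_mod:
  assumes P: "primeideal P R" and e: "local_basis R M P J e"
    and n: "n \<in> J \<rightarrow> carrier R" "lincomb n e J \<in> ideal_times_module P M"
  shows "n \<in> J \<rightarrow> P"
proof -
  interpret P: primeideal P R
    by fact
  have J: "finite J" and eM: "e \<in> J \<rightarrow> carrier M" and ind: "locally_independent R M P J e"
    using e by (auto simp: local_basis_def)
  obtain s c where s: "s \<in> carrier R - P" and c: "c \<in> J \<rightarrow> P" "s \<odot>\<^bsub>M\<^esub> lincomb n e J = lincomb c e J"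
    using ideal_times_module_coords[OF P e n(2)] by blast
  have cR: "c \<in> J \<rightarrow> carrier R"
    using c P.Icarr by (auto simp: Pi_iff)
  have "lincomb (\<lambda>j. s \<otimes> n j \<oplus> \<ominus> c j) e J = lincomb (\<lambda>j. s \<otimes> n j) e J \<oplus>\<^bsub>M\<^esub> lincomb (\<lambda>j. \<ominus> c j) e J"
    using s n cR eM by (intro lincomb_add) (auto simp: Pi_iff)
  also have "\<dots> = lincomb c e J \<oplus>\<^bsub>M\<^esub> \<ominus>\<^bsub>M\<^esub> lincomb c e J"
    using s n cR c eM J by (simp add: lincomb_uminus smult_lincomb)
  also have "\<dots> = \<zero>\<^bsub>M\<^esub>"
    using cR eM by (simp add: M.r_neg lincomb_closed)
  finally obtain u where u: "u \<in> carrier R - P" "\<And>j. j \<in> J \<Longrightarrow> u \<otimes> (s \<otimes> n j \<oplus> \<ominus> c j) = \<zero>"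
    using ind s n cR unfolding locally_independent_def
    by (elim ballE[of _ _ "\<lambda>j. s \<otimes> n j \<oplus> \<ominus> c j"]) (auto simp: Pi_iff)
  have "n j \<in> P" if "j \<in> J" for j
  proof -
    have nj: "n j \<in> carrier R" "c j \<in> carrier R" "c j \<in> P"
      using n cR c that by auto
    \<comment> \<open>The bracket is killed by \<open>u\<close>, so only a multiple of
      \<open>c j\<close> in \<open>P\<close> remains, and primality removes the factor
      \<open>u \<otimes> s\<close>.\<close>
    have "(u \<otimes> s) \<otimes> n j = u \<otimes> (s \<otimes> n j \<oplus> \<ominus> c j) \<oplus> u \<otimes> c j"
      using u(1) s nj(1,2) unfolding Diff_iff by algebra
    also have "\<dots> = u \<otimes> c j"
      using u nj that by simp
    also have "\<dots> \<in> P"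
      using u nj P.I_l_closed by blast
    finally show ?thesis
      using P.mult_notin[OF u(1) s] nj P.I_prime by blast
  qed
  then show ?thesis
    by blast
qed

text \<open>The ideal of all \<open>a\<close> with \<open>a y\<close> in \<open>PM\<close> contains
  \<open>P\<close> and also \<open>s\<close>, so by maximality it is the whole ring; in other words,
  \<open>s\<close> acts invertibly on \<open>M/PM\<close>.\<close>

lemma ideal_times_module_saturated:
  assumes "maximalideal P R" "s \<in> carrier R - P" "y \<in> carrier M"
    and "s \<odot>\<^bsub>M\<^esub> y \<in> ideal_times_module P M"
  shows "y \<in> ideal_times_module P M"
proof -
  interpret P: maximalideal P R
    by fact
  note W = submoduleE[OF submodule_ideal_times_module[OF P.ideal_axioms]]
  let ?J = "{a \<in> carrier R. a \<odot>\<^bsub>M\<^esub> y \<in> ideal_times_module P M}"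
  have "ideal ?J R"
  proof (rule idealI)
    show "subgroup ?J (add_monoid R)"
    proof (rule R.add.subgroupI)
      show "?J \<noteq> {}"
        using assms by auto
    qed (use assms W in \<open>auto simp: smult_l_distr smult_l_minus\<close>)
    show "x \<otimes> a \<in> ?J" if "a \<in> ?J" "x \<in> carrier R" for a x
      using that assms W by (auto simp: smult_assoc1)
    then show "a \<otimes> x \<in> ?J" if "a \<in> ?J" "x \<in> carrier R" for a x
      using that by (simp add: R.m_comm)
  qed (rule R.ring_axioms)
  moreover have "P \<subseteq> ?J"
    using P.Icarr assms ideal_times_module_mult by auto
  moreover have "?J \<noteq> P"
    using assms by auto
  ultimately have "\<one> \<in> ?J"
    using P.I_maximal[of ?J] by auto
  then show ?thesis
    using assms by simp
qed

text \<open>With one denominator for the whole family the coordinates form a matrix over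
  \<open>R\<close>, as elimination requires.\<close>

lemma locally_spans_common_denominator:
  assumes P: "primeideal P R" and span: "locally_spans R M P K e" "finite K" "e \<in> K \<rightarrow> carrier M"
    and "finite J" "y \<in> J \<rightarrow> carrier M"
  shows "\<exists>s\<in>carrier R - P. \<exists>g. \<forall>j\<in>J. g j \<in> K \<rightarrow> carrier R \<and> s \<odot>\<^bsub>M\<^esub> y j = lincomb (g j) e K"
  using assms(5,6)
proof (induction J rule: finite_induct)
  case empty
  then show ?case
    using primeideal.one_notin[OF P] by auto
next
  case (insert i J)
  obtain s g where s: "s \<in> carrier R - P"
    and g: "\<And>j. j \<in> J \<Longrightarrow> g j \<in> K \<rightarrow> carrier R \<and> s \<odot>\<^bsub>M\<^esub> y j = lincomb (g j) e K"
    using insert by auto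
  have yi: "y i \<in> carrier M"
    using insert by auto
  then obtain t c where t: "t \<in> carrier R - P" and c: "c \<in> K \<rightarrow> carrier R" "t \<odot>\<^bsub>M\<^esub> y i = lincomb c e K"
    using locally_spansE[OF span(1)] by blast
  define h where "h = (\<lambda>j. if j = i then (\<lambda>k. s \<otimes> c k) else (\<lambda>k. t \<otimes> g j k))"
  have "h j \<in> K \<rightarrow> carrier R \<and> (s \<otimes> t) \<odot>\<^bsub>M\<^esub> y j = lincomb (h j) e K" if "j \<in> insert i J" for j
  proof (cases "j = i")
    case True
    then show ?thesis
      using s t c span yi by (auto simp: h_def smult_assoc1 smult_lincomb Pi_iff)
  next
    case False
    then have "j \<in> J" "y j \<in> carrier M"
      using that insert.prems by auto
    moreover have "(s \<otimes> t) \<odot>\<^bsub>M\<^esub> y j = t \<odot>\<^bsub>M\<^esub> (s \<odot>\<^bsub>M\<^esub> y j)"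
      using s t \<open>y j \<in> carrier M\<close> by (simp add: smult_assoc1[symmetric] R.m_comm)
    ultimately show ?thesis
      using s t g[of j] span False by (auto simp: h_def smult_lincomb Pi_iff)
  qed
  then show ?case
    using primeideal.mult_notin[OF P s t] by blast
qed

text \<open>Equations with values in \<open>M\<close> are split into their coordinates, which gives
  a scalar system indexed by \<open>Q \<times> K\<close> to which \<open>locally_injective\<close>
  applies. As \<open>Q\<close> may be infinite, the denominator \<open>s q\<close> is chosen
  separately for each equation.\<close>

lemma locally_injective_mod:
  assumes P: "maximalideal P R" and e: "local_basis R M P K e"
    and J: "finite J" and v: "\<And>q. q \<in> Q \<Longrightarrow> v q \<in> J \<rightarrow> carrier M"
    and inj: "\<And>c. \<lbrakk>c \<in> J \<rightarrow> carrier R; \<And>q. q \<in> Q \<Longrightarrow> lincomb c (v q) J \<in> ideal_times_module P M\<rbrakk>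
      \<Longrightarrow> c \<in> J \<rightarrow> P"
    and n: "n \<in> J \<rightarrow> carrier R" "\<And>q. q \<in> Q \<Longrightarrow> lincomb n (v q) J = \<zero>\<^bsub>M\<^esub>"
  shows "\<exists>u\<in>carrier R - P. \<forall>j\<in>J. u \<otimes> n j = \<zero>"
proof -
  have prime: "primeideal P R"
    using P by (rule R.maximalideal_prime)
  interpret P: primeideal P R
    by fact
  have K: "finite K" and eM: "e \<in> K \<rightarrow> carrier M" and ind: "locally_independent R M P K e"
    and span: "locally_spans R M P K e"
    using e by (auto simp: local_basis_def)
  have "\<forall>q\<in>Q. \<exists>s g. s \<in> carrier R - P \<and>
      (\<forall>j\<in>J. g j \<in> K \<rightarrow> carrier R \<and> s \<odot>\<^bsub>M\<^esub> v q j = lincomb (g j) e K)"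
    using locally_spans_common_denominator[OF prime span K eM J v] by blast
  from bchoice[OF this] obtain s where "\<forall>q\<in>Q. \<exists>g. s q \<in> carrier R - P \<and>
      (\<forall>j\<in>J. g j \<in> K \<rightarrow> carrier R \<and> s q \<odot>\<^bsub>M\<^esub> v q j = lincomb (g j) e K)"
    by (elim exE)
  from bchoice[OF this] obtain g where "\<forall>q\<in>Q. s q \<in> carrier R - P \<and>
      (\<forall>j\<in>J. g q j \<in> K \<rightarrow> carrier R \<and> s q \<odot>\<^bsub>M\<^esub> v q j = lincomb (g q j) e K)"
    by (elim exE)
  then have s: "\<And>q. q \<in> Q \<Longrightarrow> s q \<in> carrier R - P"
    and g: "\<And>q j. q \<in> Q \<Longrightarrow> j \<in> J \<Longrightarrow> g q j \<in> K \<rightarrow> carrier R"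
    and sg: "\<And>q j. q \<in> Q \<Longrightarrow> j \<in> J \<Longrightarrow> s q \<odot>\<^bsub>M\<^esub> v q j = lincomb (g q j) e K"
    by simp_all
  have coords: "s q \<odot>\<^bsub>M\<^esub> lincomb c (v q) J = lincomb (\<lambda>k. \<Oplus>j\<in>J. c j \<otimes> g q j k) e K"
    if c: "c \<in> J \<rightarrow> carrier R" and q: "q \<in> Q" for c q
  proof -
    have "s q \<odot>\<^bsub>M\<^esub> lincomb c (v q) J = lincomb (\<lambda>j. s q \<otimes> c j) (v q) J"
      using s[OF q] J c v[OF q] by (simp add: smult_lincomb)
    also have "\<dots> = lincomb c (\<lambda>j. lincomb (g q j) e K) J"
    proof (intro M.finsum_cong')
      show "(\<lambda>j. c j \<odot>\<^bsub>M\<^esub> lincomb (g q j) e K) \<in> J \<rightarrow> carrier M"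
        using c g[OF q] eM by (auto simp: Pi_iff intro!: lincomb_closed)
      fix j assume j: "j \<in> J"
      then have "c j \<in> carrier R" "v q j \<in> carrier M"
        using c v[OF q] by auto
      then show "(s q \<otimes> c j) \<odot>\<^bsub>M\<^esub> v q j = c j \<odot>\<^bsub>M\<^esub> lincomb (g q j) e K"
        unfolding sg[OF q j, symmetric] using s[OF q] by (simp add: smult_assoc1 smult_commute)
    qed rule
    also have "\<dots> = lincomb (\<lambda>k. \<Oplus>j\<in>J. c j \<otimes> g q j k) e K"
      using J K c g[OF q] eM by (intro lincomb_lincomb) auto
    finally show ?thesis .
  qed
  have closed: "(\<lambda>k. \<Oplus>j\<in>J. c j \<otimes> g q j k) \<in> K \<rightarrow> carrier R"
    if "c \<in> J \<rightarrow> carrier R" "q \<in> Q" for c q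
    using that g[OF that(2)] by (auto intro!: R.finsum_closed simp: Pi_iff)
  show ?thesis
  proof (rule P.locally_injective[of J "Q \<times> K" "\<lambda>(q, k) j. g q j k" n])
    fix c assume c: "c \<in> J \<rightarrow> carrier R"
      and cP: "\<And>q. q \<in> Q \<times> K \<Longrightarrow> (\<Oplus>j\<in>J. c j \<otimes> (case q of (q, k) \<Rightarrow> \<lambda>j. g q j k) j) \<in> P"
    show "c \<in> J \<rightarrow> P"
    proof (rule inj[OF c])
      fix q assume q: "q \<in> Q"
      \<comment> \<open>Coordinates in \<open>P\<close> place only the multiple by
        \<open>s q\<close> in \<open>PM\<close>; saturation then removes this factor.\<close>
      have "s q \<odot>\<^bsub>M\<^esub> lincomb c (v q) J \<in> ideal_times_module P M"
        unfolding coords[OF c q]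
      proof (intro lincomb_in_submodule ideal_times_module_mult)
        fix k assume "k \<in> K"
        then show "(\<Oplus>j\<in>J. c j \<otimes> g q j k) \<in> P" "e k \<in> carrier M"
          using cP[of "(q, k)"] q eM by auto
      qed (use K submodule_ideal_times_module[OF P.ideal_axioms] in auto)
      then show "lincomb c (v q) J \<in> ideal_times_module P M"
        using ideal_times_module_saturated[OF P s[OF q]] lincomb_closed[OF c v[OF q]] by blast
    qed
  next
    fix p assume "p \<in> Q \<times> K"
    then obtain q k where p: "p = (q, k)" "q \<in> Q" "k \<in> K"
      by blast
    have eq: "lincomb (\<lambda>k. \<Oplus>j\<in>J. n j \<otimes> g q j k) e K = \<zero>\<^bsub>M\<^esub>"
      using coords[OF n(1) p(2)] n(2)[OF p(2)] s[OF p(2)] by simp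
    from ind[unfolded locally_independent_def, rule_format, OF closed[OF n(1) p(2)] eq]
    obtain t where "t \<in> carrier R - P" "\<forall>k\<in>K. t \<otimes> (\<Oplus>j\<in>J. n j \<otimes> g q j k) = \<zero>"
      by (elim bexE)
    then show "\<exists>t\<in>carrier R - P. t \<otimes> (\<Oplus>j\<in>J. n j \<otimes> (case p of (q, k) \<Rightarrow> \<lambda>j. g q j k) j) = \<zero>"
      using p by auto
  qed (use J n(1) g in auto)
qed

end

section \<open>Steinitz exchange and the passage from local to global\<close>

context module
begin

text \<open>The relation for \<open>e i\<close> can be solved for \<open>b j\<close> times
  \<open>e j\<close>, and a factor outside \<open>P\<close> is allowed in local spanning.\<close>

lemma locally_spans_exchange:
  assumes P: "primeideal P R" and K: "finite K" "e \<in> K \<rightarrow> carrier M"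
    and span: "locally_spans R M P K e" and j: "j \<in> K" and i: "i \<notin> K" "e i \<in> carrier M"
    and s: "s \<in> carrier R" and b: "b \<in> K \<rightarrow> carrier R" "b j \<notin> P"
    and eq: "s \<odot>\<^bsub>M\<^esub> e i = lincomb b e K"
  shows "locally_spans R M P (insert i (K - {j})) e"
  unfolding locally_spans_def
proof
  interpret P: primeideal P R
    by fact
  fix x assume x: "x \<in> carrier M"
  obtain t c where t: "t \<in> carrier R - P" and c: "c \<in> K \<rightarrow> carrier R"
    and tx: "t \<odot>\<^bsub>M\<^esub> x = lincomb c e K"
    using locally_spansE[OF span x] by blast
  let ?L = "K - {j}"
  have L: "finite ?L" "e \<in> ?L \<rightarrow> carrier M" "b \<in> ?L \<rightarrow> carrier R" "c \<in> ?L \<rightarrow> carrier R" "i \<notin> ?L"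
    using K b c i by (auto simp: Pi_iff)
  have jR: "b j \<in> carrier R" "c j \<in> carrier R" "e j \<in> carrier M"
    using K b c j by auto
  have split: "lincomb d e K = d j \<odot>\<^bsub>M\<^esub> e j \<oplus>\<^bsub>M\<^esub> lincomb d e ?L" if "d \<in> K \<rightarrow> carrier R" for d
  proof -
    have "insert j ?L = K"
      using j by auto
    then show ?thesis
      using lincomb_insert[of ?L j d e] that K by auto
  qed
  have Lb: "lincomb b e ?L \<in> carrier M" and Lc: "lincomb c e ?L \<in> carrier M"
    using L by (auto intro: lincomb_closed)
  \<comment> \<open>From \<open>b j\<close> times the expansion of \<open>t x\<close>, replace
    \<open>b j\<close> times \<open>e j\<close> by \<open>s\<close> times \<open>e i\<close> minus
    the other terms of the relation. This gives \<open>c j \<otimes> s\<close> at \<open>i\<close>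
    and the cross difference of \<open>b\<close> and \<open>c\<close> elsewhere.\<close>
  let ?d = "\<lambda>k. if k = i then c j \<otimes> s else b j \<otimes> c k \<oplus> \<ominus> c j \<otimes> b k"
  have d: "?d \<in> insert i ?L \<rightarrow> carrier R"
    using L jR s by (auto simp: Pi_iff)
  have "lincomb ?d e (insert i ?L) = ?d i \<odot>\<^bsub>M\<^esub> e i \<oplus>\<^bsub>M\<^esub> lincomb ?d e ?L"
    using L i d by (intro lincomb_insert) (auto simp: Pi_iff)
  also have "lincomb ?d e ?L = lincomb (\<lambda>k. b j \<otimes> c k \<oplus> \<ominus> c j \<otimes> b k) e ?L"
    using L jR by (intro lincomb_cong) (auto simp: Pi_iff)
  also have "\<dots> = b j \<odot>\<^bsub>M\<^esub> lincomb c e ?L \<oplus>\<^bsub>M\<^esub> \<ominus> c j \<odot>\<^bsub>M\<^esub> lincomb b e ?L"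
    using L jR by (subst lincomb_add) (auto simp: smult_lincomb Pi_iff)
  also have "?d i \<odot>\<^bsub>M\<^esub> e i = c j \<odot>\<^bsub>M\<^esub> (b j \<odot>\<^bsub>M\<^esub> e j) \<oplus>\<^bsub>M\<^esub> c j \<odot>\<^bsub>M\<^esub> lincomb b e ?L"
    using eq split[OF b(1)] i s jR Lb by (simp add: smult_assoc1 smult_r_distr)
  also have "c j \<odot>\<^bsub>M\<^esub> (b j \<odot>\<^bsub>M\<^esub> e j) \<oplus>\<^bsub>M\<^esub> c j \<odot>\<^bsub>M\<^esub> lincomb b e ?L \<oplus>\<^bsub>M\<^esub>
      (b j \<odot>\<^bsub>M\<^esub> lincomb c e ?L \<oplus>\<^bsub>M\<^esub> \<ominus> c j \<odot>\<^bsub>M\<^esub> lincomb b e ?L) =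
      b j \<odot>\<^bsub>M\<^esub> (c j \<odot>\<^bsub>M\<^esub> e j) \<oplus>\<^bsub>M\<^esub> b j \<odot>\<^bsub>M\<^esub> lincomb c e ?L"
    using jR Lb Lc smult_commute[of "c j" "b j" "e j"]
    by (simp add: smult_l_minus M.a_ac M.r_neg M.r_neg1 M.r_neg2)
  also have "\<dots> = b j \<odot>\<^bsub>M\<^esub> (t \<odot>\<^bsub>M\<^esub> x)"
    using tx split[OF c] jR Lc by (simp add: smult_r_distr)
  finally have "(b j \<otimes> t) \<odot>\<^bsub>M\<^esub> x = lincomb ?d e (insert i ?L)"
    using t jR x by (simp add: smult_assoc1)
  moreover have "b j \<otimes> t \<in> carrier R - P"
    using P.mult_notin[OF _ t] jR b by blast
  ultimately show "\<exists>s\<in>carrier R - P. \<exists>c\<in>insert i ?L \<rightarrow> carrier R.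
      s \<odot>\<^bsub>M\<^esub> x = lincomb c e (insert i ?L)"
    using d by (intro bexI[of _ "b j \<otimes> t"] bexI[of _ ?d])
qed

lemma lincomb_reindex:
  assumes "inj_on h J" "c \<in> h ` J \<rightarrow> carrier R" "e \<in> h ` J \<rightarrow> carrier M"
  shows "lincomb c e (h ` J) = lincomb (c \<circ> h) (e \<circ> h) J"
proof -
  have "lincomb c e (h ` J) = (\<Oplus>\<^bsub>M\<^esub>j\<in>J. c (h j) \<odot>\<^bsub>M\<^esub> e (h j))"
    using assms by (intro M.finsum_reindex) (auto simp: Pi_iff)
  then show ?thesis
    by simp
qed

text \<open>Steinitz exchange: the sum type keeps the two families apart while the elements of the
  spanning family are replaced one at a time.\<close>

lemma independent_mod_imp_locally_spans:
  assumes P: "primeideal P R" and K: "finite K" "e \<in> K \<rightarrow> carrier M"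
    and span: "locally_spans R M P K e"
    and J: "finite J" "card J = card K" "v \<in> J \<rightarrow> carrier M"
    and ind: "\<And>c. \<lbrakk>c \<in> J \<rightarrow> carrier R; lincomb c v J \<in> ideal_times_module P M\<rbrakk> \<Longrightarrow> c \<in> J \<rightarrow> P"
  shows "locally_spans R M P J v"
proof -
  interpret P: primeideal P R
    by fact
  define f where "f = case_sum v e"
  have f_simps [simp]: "f (Inl i) = v i" "f (Inr k) = e k" for i k
    by (auto simp: f_def)
  \<comment> \<open>The count is the invariant: each \<open>v i\<close> brought in displaces exactly
    one \<open>e k\<close>.\<close>
  have exchange: "\<exists>L\<subseteq>K. card L + card I = card K \<and> locally_spans R M P (Inl ` I \<union> Inr ` L) f"
    if "I \<subseteq> J" for I
    using finite_subset[OF that J(1)] that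
  proof (induction I rule: finite_induct)
    case empty
    have "locally_spans R M P (Inr ` K) f"
      unfolding locally_spans_def
    proof
      fix x assume "x \<in> carrier M"
      then obtain s c where s: "s \<in> carrier R - P" and c: "c \<in> K \<rightarrow> carrier R"
        and sx: "s \<odot>\<^bsub>M\<^esub> x = lincomb c e K"
        using locally_spansE[OF span] by blast
      \<comment> \<open>The value \<open>undefined\<close> never enters, as all indices have the
        form \<open>Inr k\<close>.\<close>
      have "lincomb (case_sum undefined c) f (Inr ` K) = lincomb (case_sum undefined c \<circ> Inr) (f \<circ> Inr) K"
        using c K lincomb_reindex[of Inr K "case_sum undefined c" f] by (auto simp: Pi_iff)
      then have "s \<odot>\<^bsub>M\<^esub> x = lincomb (case_sum undefined c) f (Inr ` K)"
        using sx by simp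
      moreover have "case_sum undefined c \<in> Inr ` K \<rightarrow> carrier R"
        using c by auto
      ultimately show "\<exists>s\<in>carrier R - P. \<exists>c\<in>Inr ` K \<rightarrow> carrier R. s \<odot>\<^bsub>M\<^esub> x = lincomb c f (Inr ` K)"
        using s by blast
    qed
    then show ?case
      by (intro exI[of _ K]) simp
  next
    case (insert i I)
    obtain L where L: "L \<subseteq> K" "card L + card I = card K"
      and spanL: "locally_spans R M P (Inl ` I \<union> Inr ` L) f"
      using insert by auto
    have finL: "finite L" and vI: "v \<in> I \<rightarrow> carrier M" and vi: "v i \<in> carrier M" and eL: "e \<in> L \<rightarrow> carrier M"
      using L K insert.prems J finite_subset[of L K] by (auto simp: Pi_iff)
    let ?K = "Inl ` I \<union> Inr ` L"
    have finK: "finite ?K" and fK: "f \<in> ?K \<rightarrow> carrier M"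
      using finL insert.hyps vI eL by (auto simp: Pi_iff)
    obtain s b where s: "s \<in> carrier R - P" and b: "b \<in> ?K \<rightarrow> carrier R"
      and eq: "s \<odot>\<^bsub>M\<^esub> v i = lincomb b f ?K"
      using locally_spansE[OF spanL vi] by blast
    \<comment> \<open>Otherwise \<open>s\<close> times \<open>v i\<close> would be a combination of
      the other \<open>v\<close> modulo \<open>PM\<close>, and independence modulo \<open>PM\<close>
      would force \<open>s\<close> into \<open>P\<close>.\<close>
    have "\<exists>k\<in>L. b (Inr k) \<notin> P"
    proof (rule ccontr)
      assume "\<not> ?thesis"
      then have bP: "\<And>k. k \<in> L \<Longrightarrow> b (Inr k) \<in> P"
        by blast
      have bL: "b \<circ> Inr \<in> L \<rightarrow> carrier R" and bI: "b \<circ> Inl \<in> I \<rightarrow> carrier R"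
        using b by auto
      have "lincomb b f ?K = lincomb b f (Inl ` I) \<oplus>\<^bsub>M\<^esub> lincomb b f (Inr ` L)"
        using b fK finL insert.hyps by (intro M.finsum_Un_disjoint) (auto simp: Pi_iff)
      also have "lincomb b f (Inl ` I) = lincomb (b \<circ> Inl) (f \<circ> Inl) I"
        using b fK by (intro lincomb_reindex) auto
      also have "lincomb b f (Inr ` L) = lincomb (b \<circ> Inr) (f \<circ> Inr) L"
        using b fK by (intro lincomb_reindex) auto
      finally have sum: "s \<odot>\<^bsub>M\<^esub> v i = lincomb (b \<circ> Inl) v I \<oplus>\<^bsub>M\<^esub> lincomb (b \<circ> Inr) e L"
        using eq by simp
      \<comment> \<open>The relation among the \<open>v\<close>, extended by zero to all of
        \<open>J\<close> so that \<open>ind\<close> can be applied.\<close>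
      define c where "c = (\<lambda>j. if j = i then s else if j \<in> I then \<ominus> b (Inl j) else \<zero>)"
      have c: "c \<in> J \<rightarrow> carrier R"
        using s funcset_mem[OF bI] by (auto simp: c_def)
      have "lincomb c v J = lincomb c v (insert i I)"
        using J insert.prems c by (intro M.add.finprod_mono_neutral_cong_right)
          (auto simp: Pi_iff c_def)
      also have "\<dots> = c i \<odot>\<^bsub>M\<^esub> v i \<oplus>\<^bsub>M\<^esub> lincomb c v I"
        using c insert.hyps insert.prems vI vi by (intro lincomb_insert) (auto simp: Pi_iff)
      also have "lincomb c v I = lincomb (\<lambda>j. \<ominus> (b \<circ> Inl) j) v I"
        using insert.hyps vI bI by (intro lincomb_cong) (auto simp: c_def Pi_iff)
      also have "\<dots> = \<ominus>\<^bsub>M\<^esub> lincomb (b \<circ> Inl) v I"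
        using insert.hyps(1) bI vI by (rule lincomb_uminus)
      also have "c i \<odot>\<^bsub>M\<^esub> v i \<oplus>\<^bsub>M\<^esub> \<ominus>\<^bsub>M\<^esub> lincomb (b \<circ> Inl) v I = lincomb (b \<circ> Inr) e L"
        using sum lincomb_closed[OF bI vI] lincomb_closed[OF bL eL]
        by (simp add: c_def M.a_ac M.r_neg M.r_neg2 M.r_neg1)
      also have "\<dots> \<in> ideal_times_module P M"
        using finL bP eL submodule_ideal_times_module[OF P.ideal_axioms]
        by (intro lincomb_in_submodule ideal_times_module_mult) auto
      finally have "c i \<in> P"
        using ind[OF c] insert.prems by auto
      then show False
        using s by (simp add: c_def)
    qed
    then obtain k where k: "k \<in> L" "b (Inr k) \<notin> P"
      by blast
    have "locally_spans R M P (insert (Inl i) (?K - {Inr k})) f"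
      using P finK fK spanL _ _ _ _ b k(2)
    proof (rule locally_spans_exchange)
      show "s \<odot>\<^bsub>M\<^esub> f (Inl i) = lincomb b f ?K"
        using eq by simp
    qed (use k s vi insert.hyps in auto)
    moreover have "insert (Inl i) (?K - {Inr k}) = Inl ` insert i I \<union> Inr ` (L - {k})"
      by auto
    moreover have "card (L - {k}) + card (insert i I) = card K"
      using L(2) insert.hyps card.remove[OF finL k(1)] by simp
    moreover have "L - {k} \<subseteq> K"
      using L(1) by blast
    ultimately show ?case
      by (intro exI[of _ "L - {k}"] conjI) simp_all
  qed
  obtain L where "L \<subseteq> K" "card L + card J = card K" "locally_spans R M P (Inl ` J \<union> Inr ` L) f"
    using exchange[of J] by blast
  \<comment> \<open>All of \<open>J\<close> has been brought in and \<open>J\<close> is as large as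
    \<open>K\<close>, so nothing of the old family is left.\<close>
  moreover from this have "L = {}"
    using J K finite_subset[of L K] by simp
  ultimately have spanJ: "locally_spans R M P (Inl ` J) f"
    by simp
  show ?thesis
    unfolding locally_spans_def
  proof
    fix x assume "x \<in> carrier M"
    then obtain s c where s: "s \<in> carrier R - P" and c: "c \<in> Inl ` J \<rightarrow> carrier R"
      and sx: "s \<odot>\<^bsub>M\<^esub> x = lincomb c f (Inl ` J)"
      using locally_spansE[OF spanJ] by blast
    have "lincomb c f (Inl ` J) = lincomb (c \<circ> Inl) (f \<circ> Inl) J"
      using c J by (intro lincomb_reindex) (auto simp: Pi_iff)
    then have "s \<odot>\<^bsub>M\<^esub> x = lincomb (c \<circ> Inl) v J"
      using sx by simp
    moreover have "c \<circ> Inl \<in> J \<rightarrow> carrier R"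
      using c by auto
    ultimately show "\<exists>s\<in>carrier R - P. \<exists>c\<in>J \<rightarrow> carrier R. s \<odot>\<^bsub>M\<^esub> x = lincomb c v J"
      using s by blast
  qed
qed

text \<open>The ideal of all \<open>a\<close> with \<open>a x\<close> in \<open>W\<close> lies in no
  maximal ideal, so it contains 1.\<close>

lemma mem_submodule_if_locally:
  assumes W: "submodule W R M" and x: "x \<in> carrier M"
    and loc: "\<And>P. maximalideal P R \<Longrightarrow> \<exists>s\<in>carrier R - P. s \<odot>\<^bsub>M\<^esub> x \<in> W"
  shows "x \<in> W"
proof -
  note WE = submoduleE[OF W]
  let ?J = "{a \<in> carrier R. a \<odot>\<^bsub>M\<^esub> x \<in> W}"
  have "ideal ?J R"
  proof (rule idealI)
    show "subgroup ?J (add_monoid R)"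
    proof (rule R.add.subgroupI)
      have "\<zero>\<^bsub>M\<^esub> \<in> W"
        using W by (simp add: submodule.axioms(1) subgroup.one_closed[of W "add_monoid M", simplified])
      then show "?J \<noteq> {}"
        using x by (auto intro!: exI[of _ \<zero>])
    qed (use x WE in \<open>auto simp: smult_l_distr smult_l_minus\<close>)
    show "b \<otimes> a \<in> ?J" if "a \<in> ?J" "b \<in> carrier R" for a b
      using that x WE by (auto simp: smult_assoc1)
    then show "a \<otimes> b \<in> ?J" if "a \<in> ?J" "b \<in> carrier R" for a b
      using that by (simp add: R.m_comm)
  qed (rule R.ring_axioms)
  have "\<one> \<in> ?J"
  proof (rule ccontr)
    assume "\<one> \<notin> ?J"
    then obtain P where "maximalideal P R" "?J \<subseteq> P"
      using R.exists_maximalideal[OF \<open>ideal ?J R\<close>] by blast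
    then show False
      using loc by blast
  qed
  then show ?thesis
    using x by simp
qed

end

text \<open>The last hypothesis is injectivity of the induced map from \<open>M/PM\<close> to
  \<open>N/PN\<close>. Both spaces have dimension \<open>r\<close>, so it is an isomorphism for
  every \<open>P\<close>, and elimination and exchange lift the two halves of this to the
  localizations.\<close>

lemma bij_betw_linear_if_locally:
  fixes R (structure) and M and N
  assumes M: "module R M" and N: "module R N" and f: "f \<in> carrier M \<rightarrow> carrier N"
    and add: "\<And>x y. \<lbrakk>x \<in> carrier M; y \<in> carrier M\<rbrakk> \<Longrightarrow> f (x \<oplus>\<^bsub>M\<^esub> y) = f x \<oplus>\<^bsub>N\<^esub> f y"
    and smult: "\<And>a x. \<lbrakk>a \<in> carrier R; x \<in> carrier M\<rbrakk> \<Longrightarrow> f (a \<odot>\<^bsub>M\<^esub> x) = a \<odot>\<^bsub>N\<^esub> f x"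
    and bases: "\<And>P. maximalideal P R \<Longrightarrow>
      (\<exists>e. local_basis R M P {..<r} e) \<and> (\<exists>e. local_basis R N P {..<r::nat} e)"
    and inj: "\<And>P x. \<lbrakk>maximalideal P R; x \<in> carrier M; f x \<in> ideal_times_module P N\<rbrakk>
      \<Longrightarrow> x \<in> ideal_times_module P M"
  shows "bij_betw f (carrier M) (carrier N)"
proof -
  interpret M: module R M
    by fact
  interpret N: module R N
    by fact
  have f_zero: "f \<zero>\<^bsub>M\<^esub> = \<zero>\<^bsub>N\<^esub>"
  proof -
    have "f \<zero>\<^bsub>M\<^esub> = f (\<zero> \<odot>\<^bsub>M\<^esub> \<zero>\<^bsub>M\<^esub>)"
      by simp
    also have "\<dots> = \<zero>\<^bsub>N\<^esub>"
      using funcset_mem[OF f M.zero_closed] by (subst smult) auto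
    finally show ?thesis .
  qed
  have f_lincomb: "f (M.lincomb c e J) = N.lincomb c (f \<circ> e) J"
    if "finite J" "c \<in> J \<rightarrow> carrier R" "e \<in> J \<rightarrow> carrier M" for c e and J :: "nat set"
    using that
  proof (induction J rule: finite_induct)
    case empty
    then show ?case
      by (simp add: f_zero)
  next
    case (insert j J)
    have "f (M.lincomb c e (insert j J)) = f (c j \<odot>\<^bsub>M\<^esub> e j) \<oplus>\<^bsub>N\<^esub> f (M.lincomb c e J)"
      using insert by (subst M.lincomb_insert) (auto simp: add M.lincomb_closed)
    also have "\<dots> = N.lincomb c (f \<circ> e) (insert j J)"
      using insert f by (subst N.lincomb_insert) (auto simp: smult Pi_iff)
    finally show ?case .
  qed
  \<comment> \<open>Shared by both halves: the image of a local basis of \<open>M\<close> is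
    independent modulo \<open>PN\<close>.\<close>
  have indep: "c \<in> {..<r} \<rightarrow> P"
    if P: "maximalideal P R" and e: "local_basis R M P {..<r} e"
      and c: "c \<in> {..<r} \<rightarrow> carrier R" "N.lincomb c (f \<circ> e) {..<r} \<in> ideal_times_module P N" for P e c
  proof -
    have eM: "e \<in> {..<r} \<rightarrow> carrier M"
      using e by (simp add: local_basis_def)
    have "M.lincomb c e {..<r} \<in> ideal_times_module P M"
      using c eM f_lincomb[of "{..<r}" c e] by (intro inj[OF P]) (auto intro: M.lincomb_closed)
    then show ?thesis
      using M.local_basis_independent_mod[OF M.R.maximalideal_prime[OF P] e c(1)] by blast
  qed
  have "x = \<zero>\<^bsub>M\<^esub>" if x: "x \<in> carrier M" and fx: "f x = \<zero>\<^bsub>N\<^esub>" for x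
  proof -
    \<comment> \<open>Vanishing is membership in the zero submodule and can therefore be tested
      locally.\<close>
    have "submodule {\<zero>\<^bsub>M\<^esub>} R M"
      by (rule M.submoduleI) auto
    then have "x \<in> {\<zero>\<^bsub>M\<^esub>}"
      using x
    proof (rule M.mem_submodule_if_locally)
      fix P assume P: "maximalideal P R"
      obtain e e' where e: "local_basis R M P {..<r} e" and e': "local_basis R N P {..<r} e'"
        using bases[OF P] by blast
      have eM: "e \<in> {..<r} \<rightarrow> carrier M" and span: "locally_spans R M P {..<r} e"
        using e by (auto simp: local_basis_def)
      obtain s c where s: "s \<in> carrier R - P" and c: "c \<in> {..<r} \<rightarrow> carrier R"
        and sx: "s \<odot>\<^bsub>M\<^esub> x = M.lincomb c e {..<r}"
        using locally_spansE[OF span x] by blast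
      have fe: "f \<circ> e \<in> {..<r} \<rightarrow> carrier N"
        using eM f by auto
      have "N.lincomb c (f \<circ> e) {..<r} = \<zero>\<^bsub>N\<^esub>"
        using f_lincomb[OF _ c eM] sx[symmetric] s x fx by (simp add: smult)
      \<comment> \<open>There is a single equation in \<open>N\<close>, hence the index type
        \<open>unit\<close>; its solutions modulo \<open>PN\<close> are trivial by
        \<open>indep\<close>.\<close>
      then have "\<exists>u\<in>carrier R - P. \<forall>j\<in>{..<r}. u \<otimes> c j = \<zero>"
        using fe c indep[OF P e]
        by (intro N.locally_injective_mod[OF P e', where Q = "UNIV :: unit set" and v = "\<lambda>_. f \<circ> e"]) auto
      then obtain u where u: "u \<in> carrier R - P" "\<And>j. j \<in> {..<r} \<Longrightarrow> u \<otimes> c j = \<zero>"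
        by blast
      have "(u \<otimes> s) \<odot>\<^bsub>M\<^esub> x = u \<odot>\<^bsub>M\<^esub> M.lincomb c e {..<r}"
        using u(1) s x by (simp add: M.smult_assoc1 flip: sx)
      also have "\<dots> = M.lincomb (\<lambda>j. u \<otimes> c j) e {..<r}"
        using u(1) c eM by (simp add: M.smult_lincomb)
      also have "\<dots> = \<zero>\<^bsub>M\<^esub>"
        using u(2) eM by (intro M.lincomb_zero) auto
      finally show "\<exists>s\<in>carrier R - P. s \<odot>\<^bsub>M\<^esub> x \<in> {\<zero>\<^bsub>M\<^esub>}"
        using primeideal.mult_notin[OF M.R.maximalideal_prime[OF P] u(1) s] by auto
    qed
    then show ?thesis
      by simp
  qed
  note ker = this
  have "inj_on f (carrier M)"
  proof (rule inj_onI)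
    fix x y assume xy: "x \<in> carrier M" "y \<in> carrier M" "f x = f y"
    have fy: "f y \<in> carrier N"
      using f xy by blast
    have "f (\<ominus>\<^bsub>M\<^esub> y) = f (\<ominus> \<one> \<odot>\<^bsub>M\<^esub> y)"
      using xy by (simp add: M.smult_l_minus)
    also have "\<dots> = \<ominus>\<^bsub>N\<^esub> f y"
      using xy fy by (subst smult) (auto simp: N.smult_l_minus)
    finally have "f (x \<ominus>\<^bsub>M\<^esub> y) = \<zero>\<^bsub>N\<^esub>"
      using xy fy by (auto simp: a_minus_def add N.M.r_neg)
    then show "x = y"
      using ker[of "x \<ominus>\<^bsub>M\<^esub> y"] M.M.minus_equality[of x "\<ominus>\<^bsub>M\<^esub> y"] xy
      by (simp add: a_minus_def)
  qed
  moreover have "y \<in> f ` carrier M" if y: "y \<in> carrier N" for y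
  proof (rule N.mem_submodule_if_locally[OF _ y])
    show "submodule (f ` carrier M) R N"
    proof (rule N.submoduleI)
      show "f ` carrier M \<subseteq> carrier N"
        using f by auto
      show "\<zero>\<^bsub>N\<^esub> \<in> f ` carrier M"
        using f_zero by (metis M.zero_closed imageI)
      show closed: "a \<odot>\<^bsub>N\<^esub> z \<in> f ` carrier M" if "a \<in> carrier R" "z \<in> f ` carrier M" for a z
        using that by (auto simp flip: smult)
      show "\<ominus>\<^bsub>N\<^esub> z \<in> f ` carrier M" if z: "z \<in> f ` carrier M" for z
      proof -
        have "z \<in> carrier N"
          using z f by blast
        then show ?thesis
          using closed[OF _ z, of "\<ominus> \<one>"] by (simp add: N.smult_l_minus)
      qed
      show "a \<oplus>\<^bsub>N\<^esub> b \<in> f ` carrier M" if "a \<in> f ` carrier M" "b \<in> f ` carrier M" for a b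
        using that by (auto simp flip: add)
    qed
    fix P assume P: "maximalideal P R"
    obtain e e' where e: "local_basis R M P {..<r} e" and e': "local_basis R N P {..<r} e'"
      using bases[OF P] by blast
    have eM: "e \<in> {..<r} \<rightarrow> carrier M"
      using e by (auto simp: local_basis_def)
    then have fe: "f \<circ> e \<in> {..<r} \<rightarrow> carrier N"
      using f by auto
    have "e' \<in> {..<r} \<rightarrow> carrier N" "locally_spans R N P {..<r} e'"
      using e' by (simp_all add: local_basis_def)
    \<comment> \<open>The equality of the ranks enters here: \<open>f \<circ> e\<close> has as many
      members as the spanning family \<open>e'\<close>.\<close>
    then have "locally_spans R N P {..<r} (f \<circ> e)"
      by (rule N.independent_mod_imp_locally_spans[OF M.R.maximalideal_prime[OF P] finite_lessThan _ _
            finite_lessThan refl fe]) (rule indep[OF P e])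
    then obtain s c where s: "s \<in> carrier R - P" and c: "c \<in> {..<r} \<rightarrow> carrier R"
      and sy: "s \<odot>\<^bsub>N\<^esub> y = N.lincomb c (f \<circ> e) {..<r}"
      using locally_spansE[OF _ y] by blast
    have "s \<odot>\<^bsub>N\<^esub> y = f (M.lincomb c e {..<r})"
      using sy f_lincomb[OF _ c eM] by simp
    then show "\<exists>s\<in>carrier R - P. s \<odot>\<^bsub>N\<^esub> y \<in> f ` carrier M"
      using s M.lincomb_closed[OF c eM] by blast
  qed
  ultimately show ?thesis
    using f by (auto simp: bij_betw_def)
qed

subsection \<open>Base change to a localization\<close>

text \<open>The fraction \<open>x/s\<close> in the explicit model of the localized module, encoded
  like \<open>frac_class\<close>. The model is there to decide when two elements of the tensor
  product coincide.\<close>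

definition module_frac ::
    "('a, 'r) ring_scheme \<Rightarrow> 'a set \<Rightarrow> ('a, 'b, 'm) module_scheme \<Rightarrow> 'b \<Rightarrow> 'a \<Rightarrow> ('b \<times> 'a) set"
  where "module_frac R S M x s =
    {(y, t). y \<in> carrier M \<and> t \<in> S \<and>
      (\<exists>u\<in>S. u \<odot>\<^bsub>M\<^esub> (t \<odot>\<^bsub>M\<^esub> x) = u \<odot>\<^bsub>M\<^esub> (s \<odot>\<^bsub>M\<^esub> y))}"

text \<open>Addition is stored as the product of a monoid record, since this group is the target of
  a homomorphism from a free Abelian group.\<close>

definition localized_module ::
    "('a, 'r) ring_scheme \<Rightarrow> 'a set \<Rightarrow> ('a, 'b, 'm) module_scheme \<Rightarrow> ('b \<times> 'a) set monoid"
  where "localized_module R S M =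
    \<lparr>carrier = {module_frac R S M x s | x s. x \<in> carrier M \<and> s \<in> S},
     monoid.mult = (\<lambda>C D. \<Union>(x, s)\<in>C. \<Union>(y, t)\<in>D.
       module_frac R S M (t \<odot>\<^bsub>M\<^esub> x \<oplus>\<^bsub>M\<^esub> s \<odot>\<^bsub>M\<^esub> y) (s \<otimes>\<^bsub>R\<^esub> t)),
     one = module_frac R S M \<zero>\<^bsub>M\<^esub> \<one>\<^bsub>R\<^esub>\<rparr>"

lemma UN_eq_const: "\<lbrakk>C \<noteq> {}; \<And>x. x \<in> C \<Longrightarrow> f x = a\<rbrakk> \<Longrightarrow> (\<Union>x\<in>C. f x) = a"
  by auto

locale module_localization = module R M + S?: submonoid S R for S and R (structure) and M (structure)
begin

lemma S_carrier: "s \<in> S \<Longrightarrow> s \<in> carrier R"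
  using S.subset by blast

lemma module_frac_self: "\<lbrakk>x \<in> carrier M; s \<in> S\<rbrakk> \<Longrightarrow> (x, s) \<in> module_frac R S M x s"
  unfolding module_frac_def using S.one_closed by auto

lemma module_frac_eq_iff:
  assumes x: "x \<in> carrier M" "s \<in> S" and y: "y \<in> carrier M" "t \<in> S"
  shows "module_frac R S M x s = module_frac R S M y t \<longleftrightarrow>
    (\<exists>u\<in>S. u \<odot>\<^bsub>M\<^esub> (t \<odot>\<^bsub>M\<^esub> x) = u \<odot>\<^bsub>M\<^esub> (s \<odot>\<^bsub>M\<^esub> y))"
proof
  assume "module_frac R S M x s = module_frac R S M y t"
  then have "(y, t) \<in> module_frac R S M x s"
    using module_frac_self[OF y] by simp
  then show "\<exists>u\<in>S. u \<odot>\<^bsub>M\<^esub> (t \<odot>\<^bsub>M\<^esub> x) = u \<odot>\<^bsub>M\<^esub> (s \<odot>\<^bsub>M\<^esub> y)"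
    by (simp add: module_frac_def)
next
  have sub: "module_frac R S M x s \<subseteq> module_frac R S M y t"
    if x: "x \<in> carrier M" "s \<in> S" and y: "y \<in> carrier M" "t \<in> S"
      and u: "u \<in> S" "u \<odot>\<^bsub>M\<^esub> (t \<odot>\<^bsub>M\<^esub> x) = u \<odot>\<^bsub>M\<^esub> (s \<odot>\<^bsub>M\<^esub> y)" for x y s t u
  proof (clarsimp simp: module_frac_def)
    fix z w v assume z: "z \<in> carrier M" "w \<in> S" "v \<in> S"
      and v: "v \<odot>\<^bsub>M\<^esub> (w \<odot>\<^bsub>M\<^esub> x) = v \<odot>\<^bsub>M\<^esub> (s \<odot>\<^bsub>M\<^esub> z)"
    note [simp] = x y z u(1) S_carrier
    \<comment> \<open>Transitivity: the middle denominator \<open>s\<close> must be part of the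
      multiplier, as it cannot be cancelled.\<close>
    have "(u \<otimes> v \<otimes> s) \<odot>\<^bsub>M\<^esub> (w \<odot>\<^bsub>M\<^esub> y) = (v \<otimes> w) \<odot>\<^bsub>M\<^esub> (u \<odot>\<^bsub>M\<^esub> (s \<odot>\<^bsub>M\<^esub> y))"
      by (simp add: smult_assoc1[symmetric] R.m_ac)
    also have "\<dots> = (u \<otimes> t) \<odot>\<^bsub>M\<^esub> (v \<odot>\<^bsub>M\<^esub> (w \<odot>\<^bsub>M\<^esub> x))"
      unfolding u(2)[symmetric] by (simp add: smult_assoc1[symmetric] R.m_ac)
    also have "\<dots> = (u \<otimes> v \<otimes> s) \<odot>\<^bsub>M\<^esub> (t \<odot>\<^bsub>M\<^esub> z)"
      unfolding v by (simp add: smult_assoc1[symmetric] R.m_ac)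
    finally show "\<exists>u\<in>S. u \<odot>\<^bsub>M\<^esub> (w \<odot>\<^bsub>M\<^esub> y) = u \<odot>\<^bsub>M\<^esub> (t \<odot>\<^bsub>M\<^esub> z)"
      by (intro bexI[of _ "u \<otimes> v \<otimes> s"]) simp_all
  qed
  assume "\<exists>u\<in>S. u \<odot>\<^bsub>M\<^esub> (t \<odot>\<^bsub>M\<^esub> x) = u \<odot>\<^bsub>M\<^esub> (s \<odot>\<^bsub>M\<^esub> y)"
  then obtain u where u: "u \<in> S" "u \<odot>\<^bsub>M\<^esub> (t \<odot>\<^bsub>M\<^esub> x) = u \<odot>\<^bsub>M\<^esub> (s \<odot>\<^bsub>M\<^esub> y)"
    by blast
  show "module_frac R S M x s = module_frac R S M y t"
    by (rule equalityI[OF sub[OF x y u] sub[OF y x u(1) u(2)[symmetric]]])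
qed

lemma module_frac_eqI:
  assumes "x \<in> carrier M" "s \<in> S" "y \<in> carrier M" "t \<in> S" "t \<odot>\<^bsub>M\<^esub> x = s \<odot>\<^bsub>M\<^esub> y"
  shows "module_frac R S M x s = module_frac R S M y t"
  using assms S.one_closed by (auto simp: module_frac_eq_iff)

lemma module_frac_mem:
  assumes "x \<in> carrier M" "s \<in> S" "p \<in> module_frac R S M x s"
  obtains y t where "p = (y, t)" "y \<in> carrier M" "t \<in> S"
    "module_frac R S M y t = module_frac R S M x s"
proof -
  obtain y t where p: "p = (y, t)"
    by (cases p)
  then have "y \<in> carrier M" "t \<in> S"
    "\<exists>u\<in>S. u \<odot>\<^bsub>M\<^esub> (t \<odot>\<^bsub>M\<^esub> x) = u \<odot>\<^bsub>M\<^esub> (s \<odot>\<^bsub>M\<^esub> y)"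
    using assms(3) by (auto simp: module_frac_def)
  then show thesis
    using that[OF p] module_frac_eq_iff[OF assms(1,2)] by blast
qed

lemma module_frac_add_cong:
  assumes x: "x \<in> carrier M" "s \<in> S" and x': "x' \<in> carrier M" "s' \<in> S"
    and y: "y \<in> carrier M" "t \<in> S" and y': "y' \<in> carrier M" "t' \<in> S"
    and eq: "module_frac R S M x s = module_frac R S M x' s'"
      "module_frac R S M y t = module_frac R S M y' t'"
  shows "module_frac R S M (t \<odot>\<^bsub>M\<^esub> x \<oplus>\<^bsub>M\<^esub> s \<odot>\<^bsub>M\<^esub> y) (s \<otimes> t) =
    module_frac R S M (t' \<odot>\<^bsub>M\<^esub> x' \<oplus>\<^bsub>M\<^esub> s' \<odot>\<^bsub>M\<^esub> y') (s' \<otimes> t')"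
proof -
  note [simp] = x x' y y' S_carrier
  obtain u where u [simp]: "u \<in> S" and u_eq: "u \<odot>\<^bsub>M\<^esub> (s' \<odot>\<^bsub>M\<^esub> x) = u \<odot>\<^bsub>M\<^esub> (s \<odot>\<^bsub>M\<^esub> x')"
    using eq(1) by (auto simp: module_frac_eq_iff)
  obtain v where v [simp]: "v \<in> S" and v_eq: "v \<odot>\<^bsub>M\<^esub> (t' \<odot>\<^bsub>M\<^esub> y) = v \<odot>\<^bsub>M\<^esub> (t \<odot>\<^bsub>M\<^esub> y')"
    using eq(2) by (auto simp: module_frac_eq_iff)
  have "(u \<otimes> v) \<odot>\<^bsub>M\<^esub> ((s' \<otimes> t') \<odot>\<^bsub>M\<^esub> (t \<odot>\<^bsub>M\<^esub> x \<oplus>\<^bsub>M\<^esub> s \<odot>\<^bsub>M\<^esub> y)) =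
      (v \<otimes> t' \<otimes> t) \<odot>\<^bsub>M\<^esub> (u \<odot>\<^bsub>M\<^esub> (s' \<odot>\<^bsub>M\<^esub> x)) \<oplus>\<^bsub>M\<^esub>
      (u \<otimes> s' \<otimes> s) \<odot>\<^bsub>M\<^esub> (v \<odot>\<^bsub>M\<^esub> (t' \<odot>\<^bsub>M\<^esub> y))"
    by (simp add: smult_r_distr smult_assoc1[symmetric] R.m_ac)
  also have "\<dots> = (u \<otimes> v) \<odot>\<^bsub>M\<^esub> ((s \<otimes> t) \<odot>\<^bsub>M\<^esub> (t' \<odot>\<^bsub>M\<^esub> x' \<oplus>\<^bsub>M\<^esub> s' \<odot>\<^bsub>M\<^esub> y'))"
    unfolding u_eq v_eq by (simp add: smult_r_distr smult_assoc1[symmetric] R.m_ac)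
  finally show ?thesis
    by (subst module_frac_eq_iff) (auto intro!: bexI[of _ "u \<otimes> v"])
qed

abbreviation LM where "LM \<equiv> localized_module R S M"

lemma module_frac_closed: "\<lbrakk>x \<in> carrier M; s \<in> S\<rbrakk> \<Longrightarrow> module_frac R S M x s \<in> carrier LM"
  by (auto simp: localized_module_def)

text \<open>All representatives give the same class by \<open>module_frac_add_cong\<close>, so the
  union over them collapses.\<close>

lemma localized_module_add:
  assumes x: "x \<in> carrier M" "s \<in> S" and y: "y \<in> carrier M" "t \<in> S"
  shows "module_frac R S M x s \<otimes>\<^bsub>LM\<^esub> module_frac R S M y t =
    module_frac R S M (t \<odot>\<^bsub>M\<^esub> x \<oplus>\<^bsub>M\<^esub> s \<odot>\<^bsub>M\<^esub> y) (s \<otimes> t)"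
proof -
  have "(case p of (x', s') \<Rightarrow> case q of (y', t') \<Rightarrow>
      module_frac R S M (t' \<odot>\<^bsub>M\<^esub> x' \<oplus>\<^bsub>M\<^esub> s' \<odot>\<^bsub>M\<^esub> y') (s' \<otimes> t')) =
      module_frac R S M (t \<odot>\<^bsub>M\<^esub> x \<oplus>\<^bsub>M\<^esub> s \<odot>\<^bsub>M\<^esub> y) (s \<otimes> t)"
    if p: "p \<in> module_frac R S M x s" and q: "q \<in> module_frac R S M y t" for p q
  proof -
    obtain x' s' where p: "p = (x', s')" "x' \<in> carrier M" "s' \<in> S"
      "module_frac R S M x' s' = module_frac R S M x s"
      using module_frac_mem[OF x p] by blast
    obtain y' t' where q: "q = (y', t')" "y' \<in> carrier M" "t' \<in> S"
      "module_frac R S M y' t' = module_frac R S M y t"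
      using module_frac_mem[OF y q] by blast
    show ?thesis
      unfolding p(1) q(1) prod.case
      by (rule module_frac_add_cong[OF p(2,3) x q(2,3) y p(4) q(4)])
  qed
  then have "(\<Union>p\<in>module_frac R S M x s. \<Union>q\<in>module_frac R S M y t.
      case p of (x', s') \<Rightarrow> case q of (y', t') \<Rightarrow>
      module_frac R S M (t' \<odot>\<^bsub>M\<^esub> x' \<oplus>\<^bsub>M\<^esub> s' \<odot>\<^bsub>M\<^esub> y') (s' \<otimes> t')) =
      module_frac R S M (t \<odot>\<^bsub>M\<^esub> x \<oplus>\<^bsub>M\<^esub> s \<odot>\<^bsub>M\<^esub> y) (s \<otimes> t)"
    using module_frac_self[OF x] module_frac_self[OF y] by (intro UN_eq_const) blast+
  then show ?thesis
    by (simp add: localized_module_def case_prod_beta)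
qed

lemma comm_group_localized_module: "comm_group LM"
proof (rule comm_groupI)
  have carr: "\<exists>x s. C = module_frac R S M x s \<and> x \<in> carrier M \<and> s \<in> S" if "C \<in> carrier LM" for C
    using that by (auto simp: localized_module_def)
  have one: "\<one>\<^bsub>LM\<^esub> = module_frac R S M \<zero>\<^bsub>M\<^esub> \<one>"
    by (simp add: localized_module_def)
  show "\<one>\<^bsub>LM\<^esub> \<in> carrier LM"
    unfolding one by (simp add: module_frac_closed)
  fix C assume "C \<in> carrier LM"
  then obtain x s where C: "C = module_frac R S M x s" and x: "x \<in> carrier M" "s \<in> S"
    using carr by blast
  note [simp] = x S_carrier
  show "\<one>\<^bsub>LM\<^esub> \<otimes>\<^bsub>LM\<^esub> C = C"
    unfolding C one by (subst localized_module_add) (auto intro!: module_frac_eqI)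
  have "module_frac R S M (\<ominus>\<^bsub>M\<^esub> x) s \<otimes>\<^bsub>LM\<^esub> C = \<one>\<^bsub>LM\<^esub>"
    unfolding C one
    by (simp add: localized_module_add) (rule module_frac_eqI, simp_all add: smult_r_minus M.l_neg)
  then show "\<exists>D\<in>carrier LM. D \<otimes>\<^bsub>LM\<^esub> C = \<one>\<^bsub>LM\<^esub>"
    using module_frac_closed[of "\<ominus>\<^bsub>M\<^esub> x" s] by auto
  fix D assume "D \<in> carrier LM"
  then obtain y t where D: "D = module_frac R S M y t" and y: "y \<in> carrier M" "t \<in> S"
    using carr by blast
  note [simp] = y
  show "C \<otimes>\<^bsub>LM\<^esub> D \<in> carrier LM"
    unfolding C D by (subst localized_module_add) (auto intro: module_frac_closed)
  show "C \<otimes>\<^bsub>LM\<^esub> D = D \<otimes>\<^bsub>LM\<^esub> C"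
    unfolding C D by (simp add: localized_module_add M.a_comm R.m_comm)
  fix E assume "E \<in> carrier LM"
  then obtain z w where E: "E = module_frac R S M z w" and z: "z \<in> carrier M" "w \<in> S"
    using carr by blast
  note [simp] = z
  show "C \<otimes>\<^bsub>LM\<^esub> D \<otimes>\<^bsub>LM\<^esub> E = C \<otimes>\<^bsub>LM\<^esub> (D \<otimes>\<^bsub>LM\<^esub> E)"
    unfolding C D E
    by (simp add: localized_module_add smult_r_distr smult_assoc1[symmetric] M.a_ac R.m_ac)
qed

lemma frac_class_eq_iff:
  assumes "a \<in> carrier R" "s \<in> S" "b \<in> carrier R" "t \<in> S"
  shows "frac_class R S a s = frac_class R S b t \<longleftrightarrow> (\<exists>u\<in>S. u \<otimes> (t \<otimes> a) = u \<otimes> (s \<otimes> b))"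
proof -
  \<comment> \<open>As a module over itself, \<open>R\<close> has \<open>frac_class\<close> as its
    \<open>module_frac\<close>, so the criterion for modules applies.\<close>
  let ?R = "\<lparr>carrier = carrier R, monoid.mult = monoid.mult R, one = \<one>, ring.zero = \<zero>, add = add R,
    smult = monoid.mult R\<rparr> :: ('a, 'a) module"
  have "abelian_group ?R"
    by (rule abelian_groupI) (auto simp: R.a_ac intro: R.l_neg bexI[of _ "\<ominus> x" for x])
  then have "module R ?R"
    by (intro moduleI R.is_cring) (simp_all add: R.l_distr R.r_distr R.m_assoc)
  then interpret self: module_localization S R ?R
    by (intro module_localization.intro S.submonoid_axioms)
  have "frac_class R S = module_frac R S ?R"
    by (intro ext) (simp add: frac_class_def module_frac_def)
  then show ?thesis
    using self.module_frac_eq_iff[of a s b t] assms by simp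
qed

end

section \<open>Arithmetic of the localized ring\<close>

context module_localization
begin

abbreviation fr where "fr \<equiv> frac_class R S"
abbreviation RS where "RS \<equiv> localization R S"

lemma frac_class_eqI:
  assumes "a \<in> carrier R" "s \<in> S" "b \<in> carrier R" "t \<in> S" "t \<otimes> a = s \<otimes> b"
  shows "fr a s = fr b t"
  using assms S.one_closed by (auto simp: frac_class_eq_iff)

lemma frac_class_self: "\<lbrakk>a \<in> carrier R; s \<in> S\<rbrakk> \<Longrightarrow> (a, s) \<in> fr a s"
  unfolding frac_class_def using S.one_closed S_carrier by auto

lemma frac_class_mem:
  assumes "a \<in> carrier R" "s \<in> S" "p \<in> fr a s"
  obtains b t where "p = (b, t)" "b \<in> carrier R" "t \<in> S" "fr b t = fr a s"
proof -
  obtain b t where p: "p = (b, t)"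
    by (cases p)
  then have "b \<in> carrier R" "t \<in> S" "\<exists>u\<in>S. u \<otimes> (t \<otimes> a) = u \<otimes> (s \<otimes> b)"
    using assms(3) by (auto simp: frac_class_def)
  then show thesis
    using that[OF p] frac_class_eq_iff[OF assms(1,2)] by blast
qed

lemma RS_carrier: "carrier RS = {fr a s | a s. a \<in> carrier R \<and> s \<in> S}"
  by (simp add: localization_def)

lemma RS_elem:
  assumes "\<xi> \<in> carrier RS"
  obtains a s where "\<xi> = fr a s" "a \<in> carrier R" "s \<in> S"
  using assms unfolding RS_carrier by blast

lemma fr_closed: "\<lbrakk>a \<in> carrier R; s \<in> S\<rbrakk> \<Longrightarrow> fr a s \<in> carrier RS"
  unfolding RS_carrier by blast

text \<open>An operation that respects equality of fractions has one value on all representatives,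
  so the union is that value. Sum and product both rest on this.\<close>

lemma RS_binop:
  assumes a: "a \<in> carrier R" "s \<in> S" and b: "b \<in> carrier R" "t \<in> S"
    and cong: "\<And>a' s' b' t'. \<lbrakk>a' \<in> carrier R; s' \<in> S; b' \<in> carrier R; t' \<in> S;
      fr a' s' = fr a s; fr b' t' = fr b t\<rbrakk> \<Longrightarrow> F a' s' b' t' = F a s b t"
  shows "(\<Union>(a, s)\<in>fr a s. \<Union>(b, t)\<in>fr b t. F a s b t) = F a s b t"
proof -
  have "(case p of (a', s') \<Rightarrow> case q of (b', t') \<Rightarrow> F a' s' b' t') = F a s b t"
    if p: "p \<in> fr a s" and q: "q \<in> fr b t" for p q
  proof -
    obtain a' s' where p: "p = (a', s')" "a' \<in> carrier R" "s' \<in> S" "fr a' s' = fr a s"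
      using frac_class_mem[OF a p] by blast
    obtain b' t' where q: "q = (b', t')" "b' \<in> carrier R" "t' \<in> S" "fr b' t' = fr b t"
      using frac_class_mem[OF b q] by blast
    show ?thesis
      unfolding p(1) q(1) prod.case by (rule cong[OF p(2,3) q(2,3) p(4) q(4)])
  qed
  then have "(\<Union>p\<in>fr a s. \<Union>q\<in>fr b t. case p of (a, s) \<Rightarrow> case q of (b, t) \<Rightarrow> F a s b t) = F a s b t"
    using frac_class_self[OF a] frac_class_self[OF b] by (intro UN_eq_const) blast+
  then show ?thesis
    by (simp add: case_prod_beta)
qed

lemma RS_mult:
  assumes a: "a \<in> carrier R" "s \<in> S" and b: "b \<in> carrier R" "t \<in> S"
  shows "fr a s \<otimes>\<^bsub>RS\<^esub> fr b t = fr (a \<otimes> b) (s \<otimes> t)"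
proof -
  have "(\<Union>(a, s)\<in>fr a s. \<Union>(b, t)\<in>fr b t. fr (a \<otimes> b) (s \<otimes> t)) = fr (a \<otimes> b) (s \<otimes> t)"
  proof (rule RS_binop[OF a b])
    fix a' s' b' t' assume a': "a' \<in> carrier R" "s' \<in> S" and b': "b' \<in> carrier R" "t' \<in> S"
      and eq: "fr a' s' = fr a s" "fr b' t' = fr b t"
    note [simp] = a b a' b' S_carrier
    obtain u where u [simp]: "u \<in> S" and u_eq: "u \<otimes> (s \<otimes> a') = u \<otimes> (s' \<otimes> a)"
      using eq(1) by (auto simp: frac_class_eq_iff)
    obtain v where v [simp]: "v \<in> S" and v_eq: "v \<otimes> (t \<otimes> b') = v \<otimes> (t' \<otimes> b)"
      using eq(2) by (auto simp: frac_class_eq_iff)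
    have "(u \<otimes> v) \<otimes> ((s \<otimes> t) \<otimes> (a' \<otimes> b')) = (u \<otimes> (s \<otimes> a')) \<otimes> (v \<otimes> (t \<otimes> b'))"
      by (simp add: R.m_ac)
    also have "\<dots> = (u \<otimes> v) \<otimes> ((s' \<otimes> t') \<otimes> (a \<otimes> b))"
      unfolding u_eq v_eq by (simp add: R.m_ac)
    finally show "fr (a' \<otimes> b') (s' \<otimes> t') = fr (a \<otimes> b) (s \<otimes> t)"
      by (subst frac_class_eq_iff) (auto intro!: bexI[of _ "u \<otimes> v"])
  qed
  then show ?thesis
    by (simp add: localization_def)
qed

lemma RS_add:
  assumes a: "a \<in> carrier R" "s \<in> S" and b: "b \<in> carrier R" "t \<in> S"
  shows "fr a s \<oplus>\<^bsub>RS\<^esub> fr b t = fr (t \<otimes> a \<oplus> s \<otimes> b) (s \<otimes> t)"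
proof -
  have "(\<Union>(a, s)\<in>fr a s. \<Union>(b, t)\<in>fr b t. fr (t \<otimes> a \<oplus> s \<otimes> b) (s \<otimes> t)) =
      fr (t \<otimes> a \<oplus> s \<otimes> b) (s \<otimes> t)"
  proof (rule RS_binop[OF a b])
    fix a' s' b' t' assume a': "a' \<in> carrier R" "s' \<in> S" and b': "b' \<in> carrier R" "t' \<in> S"
      and eq: "fr a' s' = fr a s" "fr b' t' = fr b t"
    note [simp] = a b a' b' S_carrier
    obtain u where u [simp]: "u \<in> S" and u_eq: "u \<otimes> (s \<otimes> a') = u \<otimes> (s' \<otimes> a)"
      using eq(1) by (auto simp: frac_class_eq_iff)
    obtain v where v [simp]: "v \<in> S" and v_eq: "v \<otimes> (t \<otimes> b') = v \<otimes> (t' \<otimes> b)"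
      using eq(2) by (auto simp: frac_class_eq_iff)
    have "(u \<otimes> v) \<otimes> ((s \<otimes> t) \<otimes> (t' \<otimes> a' \<oplus> s' \<otimes> b')) =
        (v \<otimes> t \<otimes> t') \<otimes> (u \<otimes> (s \<otimes> a')) \<oplus> (u \<otimes> s \<otimes> s') \<otimes> (v \<otimes> (t \<otimes> b'))"
      by (simp add: R.m_ac R.r_distr)
    also have "\<dots> = (u \<otimes> v) \<otimes> ((s' \<otimes> t') \<otimes> (t \<otimes> a \<oplus> s \<otimes> b))"
      unfolding u_eq v_eq by (simp add: R.m_ac R.r_distr)
    finally show "fr (t' \<otimes> a' \<oplus> s' \<otimes> b') (s' \<otimes> t') = fr (t \<otimes> a \<oplus> s \<otimes> b) (s \<otimes> t)"
      by (subst frac_class_eq_iff) (auto intro!: bexI[of _ "u \<otimes> v"])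
  qed
  then show ?thesis
    by (simp add: localization_def)
qed

lemma RS_add_closed: "\<lbrakk>\<xi> \<in> carrier RS; \<eta> \<in> carrier RS\<rbrakk> \<Longrightarrow> \<xi> \<oplus>\<^bsub>RS\<^esub> \<eta> \<in> carrier RS"
  by (elim RS_elem) (simp add: RS_add fr_closed S_carrier)

lemma RS_mult_closed: "\<lbrakk>\<xi> \<in> carrier RS; \<eta> \<in> carrier RS\<rbrakk> \<Longrightarrow> \<xi> \<otimes>\<^bsub>RS\<^esub> \<eta> \<in> carrier RS"
  by (elim RS_elem) (simp add: RS_mult fr_closed)

lemma RS_r_distr:
  assumes "\<zeta> \<in> carrier RS" "\<xi> \<in> carrier RS" "\<eta> \<in> carrier RS"
  shows "\<zeta> \<otimes>\<^bsub>RS\<^esub> (\<xi> \<oplus>\<^bsub>RS\<^esub> \<eta>) = \<zeta> \<otimes>\<^bsub>RS\<^esub> \<xi> \<oplus>\<^bsub>RS\<^esub> \<zeta> \<otimes>\<^bsub>RS\<^esub> \<eta>"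
proof -
  obtain a s where a: "\<zeta> = fr a s" "a \<in> carrier R" "s \<in> S"
    using assms(1) by (rule RS_elem)
  obtain b t where b: "\<xi> = fr b t" "b \<in> carrier R" "t \<in> S"
    using assms(2) by (rule RS_elem)
  obtain c w where c: "\<eta> = fr c w" "c \<in> carrier R" "w \<in> S"
    using assms(3) by (rule RS_elem)
  note [simp] = a b c S_carrier
  show ?thesis
    by (simp add: RS_add RS_mult) (rule frac_class_eqI, simp_all add: R.r_distr R.m_ac)
qed

lemma RS_left_commute:
  assumes "\<zeta> \<in> carrier RS" "\<xi> \<in> carrier RS" "\<eta> \<in> carrier RS"
  shows "\<zeta> \<otimes>\<^bsub>RS\<^esub> (\<xi> \<otimes>\<^bsub>RS\<^esub> \<eta>) = \<xi> \<otimes>\<^bsub>RS\<^esub> (\<zeta> \<otimes>\<^bsub>RS\<^esub> \<eta>)"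
proof -
  obtain a s where a: "\<zeta> = fr a s" "a \<in> carrier R" "s \<in> S"
    using assms(1) by (rule RS_elem)
  obtain b t where b: "\<xi> = fr b t" "b \<in> carrier R" "t \<in> S"
    using assms(2) by (rule RS_elem)
  obtain c w where c: "\<eta> = fr c w" "c \<in> carrier R" "w \<in> S"
    using assms(3) by (rule RS_elem)
  note [simp] = a b c S_carrier
  show ?thesis
    by (simp add: RS_mult R.m_ac)
qed

section \<open>The tensor product of the module with the localized ring\<close>

abbreviation FA where "FA \<equiv> free_Abelian_group (carrier M \<times> carrier RS)"
abbreviation rels where "rels \<equiv> base_change_relations R RS (\<lambda>a. fr a \<one>) M"
abbreviation NR where "NR \<equiv> generate FA rels"
abbreviation T where "T \<equiv> base_change R RS (\<lambda>a. fr a \<one>) M"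

lemma rels_cases:
  assumes "r \<in> rels"
  obtains (left) x y \<xi> where "x \<in> carrier M" "y \<in> carrier M" "\<xi> \<in> carrier RS"
      "r = frag_of (x \<oplus>\<^bsub>M\<^esub> y, \<xi>) - frag_of (x, \<xi>) - frag_of (y, \<xi>)"
    | (right) x \<xi> \<eta> where "x \<in> carrier M" "\<xi> \<in> carrier RS" "\<eta> \<in> carrier RS"
      "r = frag_of (x, \<xi> \<oplus>\<^bsub>RS\<^esub> \<eta>) - frag_of (x, \<xi>) - frag_of (x, \<eta>)"
    | (balanced) a x \<xi> where "a \<in> carrier R" "x \<in> carrier M" "\<xi> \<in> carrier RS"
      "r = frag_of (a \<odot>\<^bsub>M\<^esub> x, \<xi>) - frag_of (x, fr a \<one> \<otimes>\<^bsub>RS\<^esub> \<xi>)"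
  using assms unfolding base_change_relations_def Un_iff mem_Collect_eq
  by (elim disjE exE conjE)
    ((rule that(1), assumption+) | (rule that(2), assumption+) | (rule that(3), assumption+))+

lemma FA_diff_closed: "\<lbrakk>f \<in> carrier FA; g \<in> carrier FA\<rbrakk> \<Longrightarrow> f - g \<in> carrier FA"
  using keys_diff[of f g] by auto

lemma rels_carrier: "rels \<subseteq> carrier FA"
proof
  fix r assume "r \<in> rels"
  then show "r \<in> carrier FA"
    by (cases rule: rels_cases)
      (auto intro!: FA_diff_closed simp del: carrier_free_Abelian_group_iff
        simp: RS_add_closed RS_mult_closed fr_closed)
qed

lemma comm_group_FA: "comm_group FA"
  by (rule abelian_free_Abelian_group)

lemma subgroup_NR: "subgroup NR FA"
  using rels_carrier by (intro group.generate_is_subgroup) auto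

lemma normal_NR: "NR \<lhd> FA"
  using comm_group.subgroup_imp_normal[OF comm_group_FA subgroup_NR] .

lemma abelian_group_T: "abelian_group T"
proof -
  interpret Q: comm_group "FA Mod NR"
    by (rule comm_group.abelian_FactGroup[OF comm_group_FA subgroup_NR])
  have "carrier T = carrier (FA Mod NR)" "\<zero>\<^bsub>T\<^esub> = \<one>\<^bsub>FA Mod NR\<^esub>"
    "x \<oplus>\<^bsub>T\<^esub> y = x \<otimes>\<^bsub>FA Mod NR\<^esub> y" for x y
    by (simp_all add: base_change_def Let_def)
  note T = this
  show ?thesis
    by (rule abelian_groupI; unfold T;
        (rule Q.m_closed Q.one_closed Q.m_assoc Q.m_comm Q.l_one Q.l_inv_ex; assumption))
qed

definition cls where "cls f = NR #>\<^bsub>FA\<^esub> f"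

lemma T_carrier: "carrier T = cls ` carrier FA"
  by (auto simp: base_change_def Let_def FactGroup_def RCOSETS_def cls_def)

lemma cls_zero: "cls 0 = \<zero>\<^bsub>T\<^esub>"
proof -
  have "NR #>\<^bsub>FA\<^esub> \<one>\<^bsub>FA\<^esub> = NR"
    using subgroup_NR by (intro group.coset_mult_one) (auto dest: subgroup.subset)
  then show ?thesis
    by (simp add: cls_def base_change_def Let_def FactGroup_def)
qed

lemma cls_add: "\<lbrakk>f \<in> carrier FA; g \<in> carrier FA\<rbrakk> \<Longrightarrow> cls (f + g) = cls f \<oplus>\<^bsub>T\<^esub> cls g"
  using normal.rcos_sum[OF normal_NR, of f g]
  by (simp add: cls_def base_change_def Let_def FactGroup_def)

lemma cls_eq_iff:
  assumes "f \<in> carrier FA" "g \<in> carrier FA"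
  shows "cls f = cls g \<longleftrightarrow> f - g \<in> NR"
proof -
  have "f - g \<in> NR \<longleftrightarrow> f \<in> cls g"
    using subgroup.rcos_module[OF subgroup_NR _ assms(2,1)] assms by (simp add: cls_def)
  also have "\<dots> \<longleftrightarrow> cls f = cls g"
    using group.repr_independence[of FA f NR g] group.rcos_self[of FA f NR] subgroup_NR assms
    by (auto simp: cls_def)
  finally show ?thesis
    by simp
qed

text \<open>Multiplying the second factor by \<open>\<zeta>\<close> is an endomorphism of the free
  group that sends each relation to one of the same kind. It thus preserves \<open>NR\<close>, and
  the union over representatives in \<open>base_change\<close> is a single coset.\<close>

lemma cls_smult:
  assumes \<zeta>: "\<zeta> \<in> carrier RS" and f: "f \<in> carrier FA"
  shows "\<zeta> \<odot>\<^bsub>T\<^esub> cls f = cls (frag_extend (\<lambda>(x, \<eta>). frag_of (x, \<zeta> \<otimes>\<^bsub>RS\<^esub> \<eta>)) f)"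
proof -
  define E where "E = frag_extend (\<lambda>(x :: 'c, \<eta>). frag_of (x, \<zeta> \<otimes>\<^bsub>RS\<^esub> \<eta>))"
  have E_diff: "E (f - g) = E f - E g" for f g
    by (simp add: E_def frag_extend_diff)
  have E_closed: "E f \<in> carrier FA" if "f \<in> carrier FA" for f
  proof -
    have "Poly_Mapping.keys (E f) \<subseteq> (\<Union>p\<in>Poly_Mapping.keys f. Poly_Mapping.keys (case p of (x, \<eta>) \<Rightarrow> frag_of (x, \<zeta> \<otimes>\<^bsub>RS\<^esub> \<eta>)))"
      unfolding E_def by (rule keys_frag_extend)
    also have "\<dots> \<subseteq> carrier M \<times> carrier RS"
      using that \<zeta> by (auto simp: subset_iff intro!: RS_mult_closed)
    finally show ?thesis
      by simp
  qed
  have E_rels: "E r \<in> rels" if "r \<in> rels" for r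
    using that
  proof (cases rule: rels_cases)
    case (left x y \<xi>)
    then have "E r = frag_of (x \<oplus>\<^bsub>M\<^esub> y, \<zeta> \<otimes>\<^bsub>RS\<^esub> \<xi>) - frag_of (x, \<zeta> \<otimes>\<^bsub>RS\<^esub> \<xi>) - frag_of (y, \<zeta> \<otimes>\<^bsub>RS\<^esub> \<xi>)"
      unfolding left(4) E_diff by (simp add: E_def)
    then show ?thesis
      using left RS_mult_closed[OF \<zeta>] unfolding base_change_relations_def by blast
  next
    case (right x \<xi> \<eta>)
    then have "E r = frag_of (x, \<zeta> \<otimes>\<^bsub>RS\<^esub> \<xi> \<oplus>\<^bsub>RS\<^esub> \<zeta> \<otimes>\<^bsub>RS\<^esub> \<eta>) - frag_of (x, \<zeta> \<otimes>\<^bsub>RS\<^esub> \<xi>) - frag_of (x, \<zeta> \<otimes>\<^bsub>RS\<^esub> \<eta>)"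
      unfolding right(4) E_diff by (simp add: E_def RS_r_distr[OF \<zeta>])
    then show ?thesis
      using right RS_mult_closed[OF \<zeta>] unfolding base_change_relations_def by blast
  next
    case (balanced a x \<xi>)
    then have "E r = frag_of (a \<odot>\<^bsub>M\<^esub> x, \<zeta> \<otimes>\<^bsub>RS\<^esub> \<xi>) - frag_of (x, fr a \<one> \<otimes>\<^bsub>RS\<^esub> (\<zeta> \<otimes>\<^bsub>RS\<^esub> \<xi>))"
      unfolding balanced(4) E_diff by (simp add: E_def RS_left_commute[OF \<zeta>] fr_closed)
    then show ?thesis
      using balanced RS_mult_closed[OF \<zeta>] unfolding base_change_relations_def by blast
  qed
  have E_NR: "E n \<in> NR" if "n \<in> NR" for n
    using that
  proof (induction n rule: generate.induct)
    case one
    show ?case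
      using generate.one[of FA rels] by (simp add: E_def)
  next
    case (incl h)
    then show ?case
      using E_rels by (blast intro: generate.incl)
  next
    case (inv h)
    have "E (inv\<^bsub>FA\<^esub> h) = inv\<^bsub>FA\<^esub> (E h)"
      using rels_carrier inv E_rels[OF inv]
      by (subst (1 2) inv_free_Abelian_group) (auto simp: E_def frag_extend_minus subset_iff)
    then show ?case
      using E_rels[OF inv] by (simp add: generate.inv)
  next
    case (eng h1 h2)
    then show ?case
      using generate.eng[of "E h1" FA rels "E h2"] by (simp add: E_def frag_extend_add)
  qed
  have "cls (E c) = cls (E f)" if "c \<in> cls f" for c
  proof -
    have c: "c \<in> carrier FA"
      using subgroup.elemrcos_carrier[OF subgroup_NR _ f] that by (simp add: cls_def)
    have "c - f \<in> NR"
      using subgroup.rcos_module[OF subgroup_NR _ f c] that f by (simp add: cls_def)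
    then have "E c - E f \<in> NR"
      using E_NR[of "c - f"] by (simp add: E_diff)
    then show ?thesis
      using E_closed c f by (simp add: cls_eq_iff del: carrier_free_Abelian_group_iff)
  qed
  moreover have "f \<in> cls f"
    using group.rcos_self[of FA f NR] f subgroup_NR by (simp add: cls_def)
  ultimately have "(\<Union>c\<in>cls f. cls (E c)) = cls (E f)"
    by (intro UN_eq_const) blast+
  then show ?thesis
    by (simp add: base_change_def Let_def cls_def E_def)
qed

end

section \<open>Elements of the tensor product as fractions\<close>

context module_localization
begin

text \<open>The tensor of \<open>x\<close> with \<open>1/s\<close>, which plays the role of the
  fraction \<open>x/s\<close>.\<close>

definition tensor_frac where "tensor_frac x s = cls (frag_of (x, fr \<one> s))"

lemma frag_FA: "\<lbrakk>x \<in> carrier M; \<xi> \<in> carrier RS\<rbrakk> \<Longrightarrow> frag_of (x, \<xi>) \<in> carrier FA"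
  by simp

lemma FA_add_closed: "\<lbrakk>f \<in> carrier FA; g \<in> carrier FA\<rbrakk> \<Longrightarrow> f + g \<in> carrier FA"
  using keys_add[of f g] by auto

lemma cls_closed: "f \<in> carrier FA \<Longrightarrow> cls f \<in> carrier T"
  unfolding T_carrier by blast

lemma tensor_frac_closed: "\<lbrakk>x \<in> carrier M; s \<in> S\<rbrakk> \<Longrightarrow> tensor_frac x s \<in> carrier T"
  unfolding tensor_frac_def by (intro cls_closed frag_FA fr_closed) simp_all

text \<open>As \<open>a/s\<close> is the product of \<open>a/1\<close> and \<open>1/s\<close>,
  balancedness moves the numerator into the module.\<close>

lemma cls_frag_fr:
  assumes "a \<in> carrier R" "x \<in> carrier M" "s \<in> S"
  shows "cls (frag_of (x, fr a s)) = tensor_frac (a \<odot>\<^bsub>M\<^esub> x) s"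
proof -
  have one_s: "fr \<one> s \<in> carrier RS"
    using assms by (intro fr_closed) simp_all
  have "frag_of (a \<odot>\<^bsub>M\<^esub> x, fr \<one> s) - frag_of (x, fr a \<one> \<otimes>\<^bsub>RS\<^esub> fr \<one> s) \<in> rels"
    unfolding base_change_relations_def using assms one_s by blast
  moreover have "fr a \<one> \<otimes>\<^bsub>RS\<^esub> fr \<one> s = fr a s"
    using assms S_carrier by (simp add: RS_mult)
  ultimately have "frag_of (a \<odot>\<^bsub>M\<^esub> x, fr \<one> s) - frag_of (x, fr a s) \<in> NR"
    by (simp add: generate.incl)
  then have "cls (frag_of (a \<odot>\<^bsub>M\<^esub> x, fr \<one> s)) = cls (frag_of (x, fr a s))"
    using assms one_s fr_closed by (subst cls_eq_iff) (auto intro: frag_FA)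
  then show ?thesis
    by (simp add: tensor_frac_def)
qed

lemma tensor_frac_add:
  assumes "x \<in> carrier M" "y \<in> carrier M" "s \<in> S"
  shows "tensor_frac (x \<oplus>\<^bsub>M\<^esub> y) s = tensor_frac x s \<oplus>\<^bsub>T\<^esub> tensor_frac y s"
proof -
  have one_s: "fr \<one> s \<in> carrier RS"
    using assms by (intro fr_closed) simp_all
  have "frag_of (x \<oplus>\<^bsub>M\<^esub> y, fr \<one> s) - frag_of (x, fr \<one> s) - frag_of (y, fr \<one> s) \<in> rels"
    unfolding base_change_relations_def using assms one_s by blast
  then have "frag_of (x \<oplus>\<^bsub>M\<^esub> y, fr \<one> s) - (frag_of (x, fr \<one> s) + frag_of (y, fr \<one> s)) \<in> NR"
    by (simp add: generate.incl diff_diff_eq)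
  then have "cls (frag_of (x \<oplus>\<^bsub>M\<^esub> y, fr \<one> s)) = cls (frag_of (x, fr \<one> s) + frag_of (y, fr \<one> s))"
    using assms one_s by (subst cls_eq_iff) (intro frag_FA FA_add_closed M.a_closed | assumption)+
  also have "\<dots> = cls (frag_of (x, fr \<one> s)) \<oplus>\<^bsub>T\<^esub> cls (frag_of (y, fr \<one> s))"
    using assms one_s by (intro cls_add frag_FA)
  finally show ?thesis
    by (simp add: tensor_frac_def)
qed

lemma tensor_frac_zero:
  assumes s: "s \<in> S"
  shows "tensor_frac \<zero>\<^bsub>M\<^esub> s = \<zero>\<^bsub>T\<^esub>"
proof -
  interpret T: abelian_group T
    by (rule abelian_group_T)
  have "tensor_frac \<zero>\<^bsub>M\<^esub> s \<oplus>\<^bsub>T\<^esub> tensor_frac \<zero>\<^bsub>M\<^esub> s = tensor_frac \<zero>\<^bsub>M\<^esub> s"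
    using tensor_frac_add[of "\<zero>\<^bsub>M\<^esub>" "\<zero>\<^bsub>M\<^esub>" s] s by simp
  then show ?thesis
    using tensor_frac_closed[OF M.zero_closed s] by (simp add: T.add.l_cancel_one')
qed

lemma tensor_frac_rescale:
  assumes "x \<in> carrier M" "s \<in> S" "t \<in> S"
  shows "tensor_frac x s = tensor_frac (t \<odot>\<^bsub>M\<^esub> x) (t \<otimes> s)"
proof -
  have "fr \<one> s = fr t (t \<otimes> s)"
    using assms S_carrier by (intro frac_class_eqI) (simp_all add: R.m_comm)
  then show ?thesis
    using cls_frag_fr[of t x "t \<otimes> s"] assms S_carrier by (simp add: tensor_frac_def)
qed

text \<open>A sum of tensors collapses to one tensor because fractions can be brought to a common
  denominator; the induction runs over the free Abelian group.\<close>

lemma tensor_frac_surj: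
  assumes "C \<in> carrier T"
  obtains x s where "C = tensor_frac x s" "x \<in> carrier M" "s \<in> S"
proof -
  interpret T: abelian_group T
    by (rule abelian_group_T)
  obtain f where f: "Poly_Mapping.keys f \<subseteq> carrier M \<times> carrier RS" "C = cls f"
    using assms by (auto simp: T_carrier)
  from f(1) have "\<exists>x s. cls f = tensor_frac x s \<and> x \<in> carrier M \<and> s \<in> S"
  proof (induction f rule: free_Abelian_group_induct[consumes 1, case_names zero diff frag])
    case zero
    show ?case
      using tensor_frac_zero[OF S.one_closed] S.one_closed
      by (intro exI[of _ "\<zero>\<^bsub>M\<^esub>"] exI[of _ "\<one>"]) (simp add: cls_zero)
  next
    case (diff f g)
    then obtain x s y t where x: "cls f = tensor_frac x s" "x \<in> carrier M" "s \<in> S"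
      and y: "cls g = tensor_frac y t" "y \<in> carrier M" "t \<in> S"
      by blast
    have fg: "f \<in> carrier FA" "g \<in> carrier FA"
      using diff by simp_all
    note [simp] = x(2,3) y(2,3) S_carrier
    have d: "t \<odot>\<^bsub>M\<^esub> x \<ominus>\<^bsub>M\<^esub> s \<odot>\<^bsub>M\<^esub> y \<in> carrier M"
      by (simp add: a_minus_def)
    \<comment> \<open>Over the common denominator \<open>t \<otimes> s\<close> the numerator of
      \<open>cls f\<close> is split so that \<open>cls g\<close> appears as a summand and can be
      cancelled.\<close>
    have "cls f = tensor_frac (t \<odot>\<^bsub>M\<^esub> x) (t \<otimes> s)"
      using x(1) tensor_frac_rescale[of x s t] by simp
    also have "t \<odot>\<^bsub>M\<^esub> x = (t \<odot>\<^bsub>M\<^esub> x \<ominus>\<^bsub>M\<^esub> s \<odot>\<^bsub>M\<^esub> y) \<oplus>\<^bsub>M\<^esub> s \<odot>\<^bsub>M\<^esub> y"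
      by (simp add: a_minus_def M.a_assoc M.l_neg)
    also have "tensor_frac \<dots> (t \<otimes> s) =
        tensor_frac (t \<odot>\<^bsub>M\<^esub> x \<ominus>\<^bsub>M\<^esub> s \<odot>\<^bsub>M\<^esub> y) (t \<otimes> s) \<oplus>\<^bsub>T\<^esub> tensor_frac (s \<odot>\<^bsub>M\<^esub> y) (t \<otimes> s)"
      by (intro tensor_frac_add) simp_all
    also have "tensor_frac (s \<odot>\<^bsub>M\<^esub> y) (t \<otimes> s) = cls g"
      using y(1) tensor_frac_rescale[of y t s] by (simp add: R.m_comm)
    finally have "cls (f - g) \<oplus>\<^bsub>T\<^esub> cls g = tensor_frac (t \<odot>\<^bsub>M\<^esub> x \<ominus>\<^bsub>M\<^esub> s \<odot>\<^bsub>M\<^esub> y) (t \<otimes> s) \<oplus>\<^bsub>T\<^esub> cls g"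
      using cls_add[OF FA_diff_closed[OF fg] fg(2)] by simp
    then have "cls (f - g) = tensor_frac (t \<odot>\<^bsub>M\<^esub> x \<ominus>\<^bsub>M\<^esub> s \<odot>\<^bsub>M\<^esub> y) (t \<otimes> s)"
      using T.add.right_cancel[OF cls_closed[OF fg(2)] cls_closed[OF FA_diff_closed[OF fg]]
          tensor_frac_closed[OF d, of "t \<otimes> s"]] by simp
    then show ?case
      using d by (intro exI[of _ "t \<odot>\<^bsub>M\<^esub> x \<ominus>\<^bsub>M\<^esub> s \<odot>\<^bsub>M\<^esub> y"] exI[of _ "t \<otimes> s"]) simp
  next
    case (frag p)
    then obtain x a s where "p = (x, fr a s)" "x \<in> carrier M" "a \<in> carrier R" "s \<in> S"
      by (auto elim: RS_elem)
    then show ?case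
      using cls_frag_fr[of a x s] by (intro exI[of _ "a \<odot>\<^bsub>M\<^esub> x"] exI[of _ s]) simp
  qed
  then show thesis
    using that f(2) by blast
qed

lemma smult_tensor_frac:
  assumes "a \<in> carrier R" "t \<in> S" "x \<in> carrier M" "s \<in> S"
  shows "fr a t \<odot>\<^bsub>T\<^esub> tensor_frac x s = tensor_frac (a \<odot>\<^bsub>M\<^esub> x) (t \<otimes> s)"
proof -
  have "fr a t \<odot>\<^bsub>T\<^esub> tensor_frac x s = cls (frag_of (x, fr a t \<otimes>\<^bsub>RS\<^esub> fr \<one> s))"
    unfolding tensor_frac_def using assms
    by (subst cls_smult) (auto intro: fr_closed frag_FA)
  also have "\<dots> = cls (frag_of (x, fr a (t \<otimes> s)))"
    using assms by (simp add: RS_mult)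
  also have "\<dots> = tensor_frac (a \<odot>\<^bsub>M\<^esub> x) (t \<otimes> s)"
    using assms by (intro cls_frag_fr) simp_all
  finally show ?thesis .
qed

text \<open>The pairing of \<open>a/s\<close> with \<open>x\<close> to \<open>(a x)/s\<close>; being
  biadditive and balanced, it induces the comparison map from the tensor product to the localized
  module.\<close>

definition frac_smult where "frac_smult \<xi> x = (\<Union>(a, s)\<in>\<xi>. module_frac R S M (a \<odot>\<^bsub>M\<^esub> x) s)"

lemma frac_smult_fr:
  assumes a: "a \<in> carrier R" "s \<in> S" and x: "x \<in> carrier M"
  shows "frac_smult (fr a s) x = module_frac R S M (a \<odot>\<^bsub>M\<^esub> x) s"
proof -
  have "(case p of (b, t) \<Rightarrow> module_frac R S M (b \<odot>\<^bsub>M\<^esub> x) t) = module_frac R S M (a \<odot>\<^bsub>M\<^esub> x) s"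
    if p: "p \<in> fr a s" for p
  proof -
    obtain b t where p: "p = (b, t)" and b: "b \<in> carrier R" "t \<in> S" and eq: "fr b t = fr a s"
      using frac_class_mem[OF a p] by blast
    note [simp] = a b x S_carrier
    obtain u where u [simp]: "u \<in> S" and u_eq: "u \<otimes> (s \<otimes> b) = u \<otimes> (t \<otimes> a)"
      using eq by (auto simp: frac_class_eq_iff)
    have "u \<odot>\<^bsub>M\<^esub> (s \<odot>\<^bsub>M\<^esub> (b \<odot>\<^bsub>M\<^esub> x)) = (u \<otimes> (s \<otimes> b)) \<odot>\<^bsub>M\<^esub> x"
      by (simp add: smult_assoc1)
    also have "\<dots> = u \<odot>\<^bsub>M\<^esub> (t \<odot>\<^bsub>M\<^esub> (a \<odot>\<^bsub>M\<^esub> x))"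
      unfolding u_eq by (simp add: smult_assoc1)
    finally show ?thesis
      unfolding p prod.case by (subst module_frac_eq_iff) (auto intro!: bexI[of _ u])
  qed
  then show ?thesis
    unfolding frac_smult_def using frac_class_self[OF a] by (intro UN_eq_const) blast+
qed

lemma frac_smult_closed: "\<lbrakk>\<xi> \<in> carrier RS; x \<in> carrier M\<rbrakk> \<Longrightarrow> frac_smult \<xi> x \<in> carrier LM"
  by (elim RS_elem) (simp add: frac_smult_fr module_frac_closed)

lemma frac_smult_add_right:
  assumes "\<xi> \<in> carrier RS" "x \<in> carrier M" "y \<in> carrier M"
  shows "frac_smult \<xi> (x \<oplus>\<^bsub>M\<^esub> y) = frac_smult \<xi> x \<otimes>\<^bsub>LM\<^esub> frac_smult \<xi> y"
proof -
  obtain a s where a: "\<xi> = fr a s" "a \<in> carrier R" "s \<in> S"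
    using assms(1) by (rule RS_elem)
  note [simp] = a assms(2,3) S_carrier
  show ?thesis
    by (simp add: frac_smult_fr localized_module_add)
      (rule module_frac_eqI, simp_all add: smult_r_distr smult_assoc1)
qed

lemma frac_smult_add_left:
  assumes "\<xi> \<in> carrier RS" "\<eta> \<in> carrier RS" "x \<in> carrier M"
  shows "frac_smult (\<xi> \<oplus>\<^bsub>RS\<^esub> \<eta>) x = frac_smult \<xi> x \<otimes>\<^bsub>LM\<^esub> frac_smult \<eta> x"
proof -
  obtain a s where a: "\<xi> = fr a s" "a \<in> carrier R" "s \<in> S"
    using assms(1) by (rule RS_elem)
  obtain b t where b: "\<eta> = fr b t" "b \<in> carrier R" "t \<in> S"
    using assms(2) by (rule RS_elem)
  note [simp] = a b assms(3) S_carrier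
  show ?thesis
    by (simp add: frac_smult_fr RS_add localized_module_add smult_l_distr smult_assoc1)
qed

lemma frac_smult_balanced:
  assumes "a \<in> carrier R" "\<xi> \<in> carrier RS" "x \<in> carrier M"
  shows "frac_smult \<xi> (a \<odot>\<^bsub>M\<^esub> x) = frac_smult (fr a \<one> \<otimes>\<^bsub>RS\<^esub> \<xi>) x"
proof -
  obtain b t where b: "\<xi> = fr b t" "b \<in> carrier R" "t \<in> S"
    using assms(2) by (rule RS_elem)
  note [simp] = b assms(1,3) S_carrier
  show ?thesis
    by (simp add: frac_smult_fr RS_mult smult_assoc1 smult_commute[of b a x])
qed

text \<open>The map to the localized module detects when an element of the tensor product vanishes.\<close>

lemma tensor_frac_eqD:
  assumes x: "x \<in> carrier M" "s \<in> S" and y: "y \<in> carrier M" "t \<in> S"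
    and eq: "tensor_frac x s = tensor_frac y t"
  shows "\<exists>u\<in>S. u \<odot>\<^bsub>M\<^esub> (t \<odot>\<^bsub>M\<^esub> x) = u \<odot>\<^bsub>M\<^esub> (s \<odot>\<^bsub>M\<^esub> y)"
proof -
  interpret LM: comm_group LM
    by (rule comm_group_localized_module)
  have "(\<lambda>(x, \<xi>). frac_smult \<xi> x) ` (carrier M \<times> carrier RS) \<subseteq> carrier LM"
    by (auto intro: frac_smult_closed)
  \<comment> \<open>The pairing extends to the free group by its universal property;
    \<open>h_eq\<close> shows that this extension respects the classes modulo
    \<open>NR\<close>.\<close>
  then obtain h where h: "h \<in> hom FA LM"
    and h_frag: "\<And>p. p \<in> carrier M \<times> carrier RS \<Longrightarrow> h (frag_of p) = (case p of (x, \<xi>) \<Rightarrow> frac_smult \<xi> x)"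
    by (rule LM.free_Abelian_group_universal) blast
  interpret h: group_hom FA LM h
    by (intro group_hom.intro group_hom_axioms.intro h LM.is_group group_free_Abelian_group)
  have h_diff: "h (f - g) = h f \<otimes>\<^bsub>LM\<^esub> inv\<^bsub>LM\<^esub> (h g)" if "f \<in> carrier FA" "g \<in> carrier FA" for f g
  proof -
    have "f - g = f \<otimes>\<^bsub>FA\<^esub> inv\<^bsub>FA\<^esub> g"
      using that by simp
    then show ?thesis
      by (simp only: h.hom_mult[OF that(1) h.G.inv_closed[OF that(2)]] h.hom_inv[OF that(2)])
  qed
  \<comment> \<open>The form in which the biadditivity relations arrive after \<open>h\<close> is
    applied.\<close>
  have cancel: "C \<otimes>\<^bsub>LM\<^esub> D \<otimes>\<^bsub>LM\<^esub> inv\<^bsub>LM\<^esub> C \<otimes>\<^bsub>LM\<^esub> inv\<^bsub>LM\<^esub> D = \<one>\<^bsub>LM\<^esub>"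
    if "C \<in> carrier LM" "D \<in> carrier LM" for C D
  proof -
    have "C \<otimes>\<^bsub>LM\<^esub> D \<otimes>\<^bsub>LM\<^esub> inv\<^bsub>LM\<^esub> C \<otimes>\<^bsub>LM\<^esub> inv\<^bsub>LM\<^esub> D =
        (C \<otimes>\<^bsub>LM\<^esub> D) \<otimes>\<^bsub>LM\<^esub> (inv\<^bsub>LM\<^esub> C \<otimes>\<^bsub>LM\<^esub> inv\<^bsub>LM\<^esub> D)"
      using that by (intro LM.m_assoc) simp_all
    also have "\<dots> = \<one>\<^bsub>LM\<^esub>"
      unfolding LM.inv_mult[OF that, symmetric] using that by (intro LM.r_inv) simp
    finally show ?thesis .
  qed
  have h_eq: "h f = h g" if "f - g \<in> NR" "f \<in> carrier FA" "g \<in> carrier FA" for f g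
  proof -
    \<comment> \<open>Each kind of relation is killed by one property of the pairing: additivity in
      the module, additivity in the scalar, balancedness.\<close>
    have rels_ker: "rels \<subseteq> kernel FA LM h"
    proof
      fix q assume "q \<in> rels"
      then show "q \<in> kernel FA LM h"
      proof (cases rule: rels_cases)
        case (left x y \<xi>)
        then have c: "frag_of (x \<oplus>\<^bsub>M\<^esub> y, \<xi>) \<in> carrier FA" "frag_of (x, \<xi>) \<in> carrier FA"
          "frag_of (y, \<xi>) \<in> carrier FA"
          by auto
        have "h q = \<one>\<^bsub>LM\<^esub>"
          unfolding left(4) using left c
          by (simp add: h_diff FA_diff_closed h_frag frac_smult_add_right frac_smult_closed
              cancel del: carrier_free_Abelian_group_iff)
        then show ?thesis
          using \<open>q \<in> rels\<close> subsetD[OF rels_carrier, of q] by (simp add: kernel_def)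
      next
        case (right x \<xi> \<eta>)
        then have c: "frag_of (x, \<xi> \<oplus>\<^bsub>RS\<^esub> \<eta>) \<in> carrier FA" "frag_of (x, \<xi>) \<in> carrier FA"
          "frag_of (x, \<eta>) \<in> carrier FA"
          by (auto simp: RS_add_closed)
        have "h q = \<one>\<^bsub>LM\<^esub>"
          unfolding right(4) using right c
          by (simp add: h_diff FA_diff_closed h_frag frac_smult_add_left frac_smult_closed RS_add_closed
              cancel del: carrier_free_Abelian_group_iff)
        then show ?thesis
          using \<open>q \<in> rels\<close> subsetD[OF rels_carrier, of q] by (simp add: kernel_def)
      next
        case (balanced a x \<xi>)
        then have c: "frag_of (a \<odot>\<^bsub>M\<^esub> x, \<xi>) \<in> carrier FA"
          "frag_of (x, fr a \<one> \<otimes>\<^bsub>RS\<^esub> \<xi>) \<in> carrier FA"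
          by (auto simp: RS_mult_closed fr_closed)
        have "h q = \<one>\<^bsub>LM\<^esub>"
          unfolding balanced(4) using balanced c
          by (simp add: h_diff h_frag frac_smult_balanced frac_smult_closed RS_mult_closed fr_closed
              del: carrier_free_Abelian_group_iff)
        then show ?thesis
          using \<open>q \<in> rels\<close> subsetD[OF rels_carrier, of q] by (simp add: kernel_def)
      qed
    qed
    have "NR \<subseteq> kernel FA LM h"
      using h.G.generate_subgroup_incl[OF rels_ker h.subgroup_kernel] .
    then have "h (f - g) = \<one>\<^bsub>LM\<^esub>"
      using that by (auto simp: kernel_def)
    then show ?thesis
      using that h.hom_closed LM.inv_equality[of "h f" "inv\<^bsub>LM\<^esub> (h g)"] by (simp add: h_diff)
  qed
  have one_s: "fr \<one> s \<in> carrier RS" "fr \<one> t \<in> carrier RS"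
    using x y by (auto intro: fr_closed)
  have "frag_of (x, fr \<one> s) - frag_of (y, fr \<one> t) \<in> NR"
    using eq x y one_s by (subst cls_eq_iff[symmetric]) (auto simp: tensor_frac_def)
  then have "h (frag_of (x, fr \<one> s)) = h (frag_of (y, fr \<one> t))"
    using x y one_s by (intro h_eq) auto
  then have "module_frac R S M x s = module_frac R S M y t"
    using x y one_s by (simp add: h_frag frac_smult_fr)
  then show ?thesis
    using module_frac_eq_iff[OF x y] by blast
qed

lemma finsum_tensor_frac:
  assumes "finite J" "x \<in> J \<rightarrow> carrier M" "s \<in> S"
  shows "(\<Oplus>\<^bsub>T\<^esub>j\<in>J. tensor_frac (x j) s) = tensor_frac (\<Oplus>\<^bsub>M\<^esub>j\<in>J. x j) s"
  using assms(1,2)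
proof (induction J rule: finite_induct)
  interpret T: abelian_group T
    by (rule abelian_group_T)
  case empty
  then show ?case
    using assms(3) by (simp add: tensor_frac_zero)
next
  interpret T: abelian_group T
    by (rule abelian_group_T)
  case (insert j J)
  have "(\<Oplus>\<^bsub>T\<^esub>j\<in>insert j J. tensor_frac (x j) s) = tensor_frac (x j) s \<oplus>\<^bsub>T\<^esub> (\<Oplus>\<^bsub>T\<^esub>j\<in>J. tensor_frac (x j) s)"
    using insert assms(3) by (intro T.finsum_insert) (auto intro: tensor_frac_closed)
  also have "\<dots> = tensor_frac (\<Oplus>\<^bsub>M\<^esub>j\<in>insert j J. x j) s"
    using insert assms(3) by (simp add: tensor_frac_add Pi_iff)
  finally show ?case .
qed

section \<open>Common denominators and the extraction of a local basis\<close>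

lemma tensor_frac_common_denominator:
  assumes "finite J" "b \<in> J \<rightarrow> carrier T"
  shows "\<exists>s\<in>S. \<exists>e\<in>J \<rightarrow> carrier M. \<forall>j\<in>J. b j = tensor_frac (e j) s"
  using assms
proof (induction J rule: finite_induct)
  case empty
  then show ?case
    using S.one_closed by (intro bexI[of _ \<one>]) auto
next
  case (insert i J)
  then obtain s e where s: "s \<in> S" and e: "e \<in> J \<rightarrow> carrier M" "\<And>j. j \<in> J \<Longrightarrow> b j = tensor_frac (e j) s"
    by auto
  obtain x t where x: "b i = tensor_frac x t" "x \<in> carrier M" "t \<in> S"
    using insert.prems by (auto elim: tensor_frac_surj)
  define e' where "e' = (\<lambda>j. if j = i then s \<odot>\<^bsub>M\<^esub> x else t \<odot>\<^bsub>M\<^esub> e j)"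
  have "e' \<in> insert i J \<rightarrow> carrier M"
    using s x e S_carrier by (auto simp: e'_def Pi_iff)
  moreover have "b j = tensor_frac (e' j) (s \<otimes> t)" if "j \<in> insert i J" for j
  proof (cases "j = i")
    case True
    then show ?thesis
      using x tensor_frac_rescale[of x t s] s by (simp add: e'_def)
  next
    case False
    then have "j \<in> J" "e j \<in> carrier M"
      using that e by auto
    then show ?thesis
      using False e(2) tensor_frac_rescale[of "e j" s t] s x S_carrier by (simp add: e'_def R.m_comm)
  qed
  ultimately show ?case
    using s x by (intro bexI[of _ "s \<otimes> t"] bexI[of _ e']) auto
qed

lemma frac_common_denominator:
  assumes "finite J" "c \<in> J \<rightarrow> carrier RS"
  shows "\<exists>s\<in>S. \<exists>a\<in>J \<rightarrow> carrier R. \<forall>j\<in>J. c j = fr (a j) s"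
  using assms
proof (induction J rule: finite_induct)
  case empty
  then show ?case
    using S.one_closed by (intro bexI[of _ \<one>]) auto
next
  case (insert i J)
  then obtain s a where s: "s \<in> S" and a: "a \<in> J \<rightarrow> carrier R" "\<And>j. j \<in> J \<Longrightarrow> c j = fr (a j) s"
    by auto
  obtain b t where b: "c i = fr b t" "b \<in> carrier R" "t \<in> S"
    using insert.prems by (auto elim: RS_elem)
  define a' where "a' = (\<lambda>j. if j = i then s \<otimes> b else t \<otimes> a j)"
  have "a' \<in> insert i J \<rightarrow> carrier R"
    using s b a S_carrier by (auto simp: a'_def Pi_iff)
  moreover have "c j = fr (a' j) (s \<otimes> t)" if "j \<in> insert i J" for j
  proof (cases "j = i")
    case True
    then show ?thesis
      unfolding True b(1) a'_def using s b(2,3) S_carrier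
      by (intro frac_class_eqI) (simp_all add: R.m_ac)
  next
    case False
    then have j: "j \<in> J" "a j \<in> carrier R"
      using that a by auto
    show ?thesis
      unfolding a(2)[OF j(1)] a'_def using s b(2,3) S_carrier j False
      by (intro frac_class_eqI) (simp_all add: R.m_ac)
  qed
  ultimately show ?case
    using s b by (intro bexI[of _ "s \<otimes> t"] bexI[of _ a']) auto
qed

lemma common_annihilator:
  assumes "finite J" "c \<in> J \<rightarrow> carrier R" "\<And>j. j \<in> J \<Longrightarrow> \<exists>u\<in>S. u \<otimes> c j = \<zero>"
  shows "\<exists>u\<in>S. \<forall>j\<in>J. u \<otimes> c j = \<zero>"
  using assms
proof (induction J rule: finite_induct)
  case empty
  then show ?case
    using S.one_closed by (intro bexI[of _ \<one>]) auto
next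
  case (insert i J)
  then obtain u where u: "u \<in> S" "\<And>j. j \<in> J \<Longrightarrow> u \<otimes> c j = \<zero>"
    by auto
  obtain v where v: "v \<in> S" "v \<otimes> c i = \<zero>"
    using insert.prems(2)[of i] by blast
  have "u \<otimes> v \<otimes> c j = \<zero>" if "j \<in> insert i J" for j
  proof -
    have cj: "c j \<in> carrier R"
      using insert.prems that by auto
    have "u \<otimes> v \<otimes> c j = v \<otimes> (u \<otimes> c j)" "u \<otimes> v \<otimes> c j = u \<otimes> (v \<otimes> c j)"
      using u v cj S_carrier by (simp_all add: R.m_ac)
    then show ?thesis
      using that u v S_carrier by auto
  qed
  then show ?case
    using u v by (intro bexI[of _ "u \<otimes> v"]) auto
qed

text \<open>The basis elements are brought to one denominator \<open>s\<close>; as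
  \<open>1/s\<close> is a unit, the numerators \<open>e i\<close> serve equally well. Existence of
  coefficients yields local spanning, and uniqueness yields local independence.\<close>

lemma free_imp_local_basis:
  assumes P: "S = carrier R - P" and free: "free_module_of_rank RS T r"
  shows "\<exists>e. local_basis R M P {..<r} e"
proof -
  interpret T: abelian_group T
    by (rule abelian_group_T)
  obtain B where basis: "finite B \<and> card B = r \<and> B \<subseteq> carrier T \<and>
      (\<forall>x\<in>carrier T. \<exists>!c. c \<in> B \<rightarrow>\<^sub>E carrier RS \<and> x = (\<Oplus>\<^bsub>T\<^esub>b\<in>B. c b \<odot>\<^bsub>T\<^esub> b))"
    using free unfolding free_module_of_rank_def by (rule exE)
  then have B: "finite B" "card B = r" "B \<subseteq> carrier T"
    by simp_all
  note uniq = basis[THEN conjunct2, THEN conjunct2, THEN conjunct2, rule_format]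
  obtain \<beta> where \<beta>: "bij_betw \<beta> {..<r} B"
    using ex_bij_betw_nat_finite[OF B(1)] B(2) by (auto simp: lessThan_atLeast0)
  have "\<beta> \<in> {..<r} \<rightarrow> carrier T"
    using \<beta> B(3) by (auto simp: bij_betw_def)
  then obtain s e where s: "s \<in> S" and e: "e \<in> {..<r} \<rightarrow> carrier M"
    and \<beta>e: "\<And>i. i < r \<Longrightarrow> \<beta> i = tensor_frac (e i) s"
    using tensor_frac_common_denominator[of "{..<r}" \<beta>] by auto
  \<comment> \<open>With \<open>t\<close> the denominator of the coefficients and \<open>s\<close>
    that of the basis elements, a sum over \<open>B\<close> is one fraction whose numerator is a
    combination in \<open>M\<close>.\<close>
  have sum_B: "(\<Oplus>\<^bsub>T\<^esub>b\<in>B. c b \<odot>\<^bsub>T\<^esub> b) = tensor_frac (lincomb a e {..<r}) (t \<otimes> s)"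
    if a: "a \<in> {..<r} \<rightarrow> carrier R" and t: "t \<in> S" and c: "\<And>i. i < r \<Longrightarrow> c (\<beta> i) = fr (a i) t" for c a t
  proof -
    have summand: "c (\<beta> i) \<odot>\<^bsub>T\<^esub> \<beta> i = tensor_frac (a i \<odot>\<^bsub>M\<^esub> e i) (t \<otimes> s)" if "i \<in> {..<r}" for i
    proof -
      have "a i \<in> carrier R" "e i \<in> carrier M"
        using that a e by auto
      then show ?thesis
        using that c[of i] \<beta>e[of i] smult_tensor_frac[of "a i" t "e i" s] t s by simp
    qed
    have closed: "tensor_frac (a i \<odot>\<^bsub>M\<^esub> e i) (t \<otimes> s) \<in> carrier T" if "i \<in> {..<r}" for i
      using that a e t s by (intro tensor_frac_closed) auto
    have inj: "inj_on \<beta> {..<r}" and img: "\<beta> ` {..<r} = B"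
      using \<beta> by (auto simp: bij_betw_def)
    have "(\<Oplus>\<^bsub>T\<^esub>b\<in>B. c b \<odot>\<^bsub>T\<^esub> b) = (\<Oplus>\<^bsub>T\<^esub>i\<in>{..<r}. c (\<beta> i) \<odot>\<^bsub>T\<^esub> \<beta> i)"
      unfolding img[symmetric] using summand closed by (intro T.finsum_reindex[OF _ inj]) auto
    also have "\<dots> = (\<Oplus>\<^bsub>T\<^esub>i\<in>{..<r}. tensor_frac (a i \<odot>\<^bsub>M\<^esub> e i) (t \<otimes> s))"
      using summand closed by (intro T.finsum_cong') auto
    also have "\<dots> = tensor_frac (lincomb a e {..<r}) (t \<otimes> s)"
      using a e t s by (intro finsum_tensor_frac) (auto simp: Pi_iff)
    finally show ?thesis .
  qed
  have "locally_spans R M P {..<r} e"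
    unfolding locally_spans_def
  proof
    fix x assume x: "x \<in> carrier M"
    obtain c where c: "c \<in> B \<rightarrow>\<^sub>E carrier RS" and xc: "tensor_frac x \<one> = (\<Oplus>\<^bsub>T\<^esub>b\<in>B. c b \<odot>\<^bsub>T\<^esub> b)"
      using uniq[OF tensor_frac_closed[OF x S.one_closed]] by blast
    have "c \<circ> \<beta> \<in> {..<r} \<rightarrow> carrier RS"
      using c \<beta> by (auto simp: bij_betw_def PiE_def Pi_iff)
    then obtain t a where t: "t \<in> S" and a: "a \<in> {..<r} \<rightarrow> carrier R"
      and ca: "\<And>i. i < r \<Longrightarrow> c (\<beta> i) = fr (a i) t"
      using frac_common_denominator[of "{..<r}" "c \<circ> \<beta>"] by auto
    have "tensor_frac x \<one> = tensor_frac (lincomb a e {..<r}) (t \<otimes> s)"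
      using xc sum_B[OF a t ca] by simp
    then obtain u where u: "u \<in> S"
      "u \<odot>\<^bsub>M\<^esub> ((t \<otimes> s) \<odot>\<^bsub>M\<^esub> x) = u \<odot>\<^bsub>M\<^esub> (\<one> \<odot>\<^bsub>M\<^esub> lincomb a e {..<r})"
      using tensor_frac_eqD[OF x S.one_closed lincomb_closed[OF a e], of "t \<otimes> s"] t s by auto
    have "(u \<otimes> (t \<otimes> s)) \<odot>\<^bsub>M\<^esub> x = u \<odot>\<^bsub>M\<^esub> lincomb a e {..<r}"
      using u t s x lincomb_closed[OF a e] S_carrier by (simp add: smult_assoc1)
    also have "\<dots> = lincomb (\<lambda>i. u \<otimes> a i) e {..<r}"
      using u a e S_carrier by (intro smult_lincomb) auto
    finally have eq: "(u \<otimes> (t \<otimes> s)) \<odot>\<^bsub>M\<^esub> x = lincomb (\<lambda>i. u \<otimes> a i) e {..<r}" .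
    have "u \<otimes> (t \<otimes> s) \<in> carrier R - P" "(\<lambda>i. u \<otimes> a i) \<in> {..<r} \<rightarrow> carrier R"
      using u t s a S_carrier unfolding P[symmetric] by (auto simp: Pi_iff)
    then show "\<exists>s\<in>carrier R - P. \<exists>c\<in>{..<r} \<rightarrow> carrier R. s \<odot>\<^bsub>M\<^esub> x = lincomb c e {..<r}"
      using eq by (intro bexI[of _ "u \<otimes> (t \<otimes> s)"] bexI[of _ "\<lambda>i. u \<otimes> a i"])
  qed
  moreover have "locally_independent R M P {..<r} e"
    unfolding locally_independent_def
  proof (intro ballI impI)
    fix c assume c: "c \<in> {..<r} \<rightarrow> carrier R" and zero: "lincomb c e {..<r} = \<zero>\<^bsub>M\<^esub>"
    \<comment> \<open>Coefficients in \<open>R\<close> become a coefficient function on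
      \<open>B\<close>. It is restricted to \<open>B\<close> because uniqueness is stated for
      extensional functions.\<close>
    define \<gamma> where "\<gamma> = (\<lambda>c. restrict (\<lambda>b. fr (c (the_inv_into {..<r} \<beta> b)) \<one>) B)"
    have \<gamma>_\<beta>: "\<gamma> c (\<beta> i) = fr (c i) \<one>" if "i < r" for i c
      using \<beta> that by (auto simp: \<gamma>_def bij_betw_def the_inv_into_f_f)
    have \<gamma>_closed: "\<gamma> c \<in> B \<rightarrow>\<^sub>E carrier RS" if "c \<in> {..<r} \<rightarrow> carrier R" for c
      using that the_inv_into_into[of \<beta> "{..<r}" _ "{..<r}"] \<beta>
      by (auto simp: \<gamma>_def bij_betw_def intro!: fr_closed)
    have sum_zero: "\<zero>\<^bsub>T\<^esub> = (\<Oplus>\<^bsub>T\<^esub>b\<in>B. \<gamma> d b \<odot>\<^bsub>T\<^esub> b)"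
      if "d \<in> {..<r} \<rightarrow> carrier R" "lincomb d e {..<r} = \<zero>\<^bsub>M\<^esub>" for d
      using sum_B[OF that(1) S.one_closed \<gamma>_\<beta>] that(2) s by (simp add: tensor_frac_zero)
    have "lincomb (\<lambda>_. \<zero>) e {..<r} = \<zero>\<^bsub>M\<^esub>"
      using e by (intro lincomb_zero) auto
    \<comment> \<open>Both represent zero, so uniqueness of coordinates identifies them.\<close>
    then have "\<gamma> c = \<gamma> (\<lambda>_. \<zero>)"
      using uniq[OF T.zero_closed] \<gamma>_closed[OF c] \<gamma>_closed[of "\<lambda>_. \<zero>"] sum_zero[OF c zero]
        sum_zero[of "\<lambda>_. \<zero>"] by auto
    then have "\<exists>u\<in>S. u \<otimes> c i = \<zero>" if "i \<in> {..<r}" for i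
    proof -
      have ci: "c i \<in> carrier R"
        using c that by blast
      have "fr (c i) \<one> = fr \<zero> \<one>"
        using \<gamma>_\<beta>[of i c] \<gamma>_\<beta>[of i "\<lambda>_. \<zero>"] that \<open>\<gamma> c = \<gamma> (\<lambda>_. \<zero>)\<close> by simp
      then obtain u where "u \<in> S" "u \<otimes> (\<one> \<otimes> c i) = u \<otimes> (\<one> \<otimes> \<zero>)"
        using frac_class_eq_iff[OF ci S.one_closed R.zero_closed S.one_closed] by blast
      then show ?thesis
        using ci S_carrier by auto
    qed
    then show "\<exists>s\<in>carrier R - P. \<forall>j\<in>{..<r}. s \<otimes> c j = \<zero>"
      using common_annihilator[OF finite_lessThan c] unfolding P by blast
  qed
  ultimately show ?thesis
    using e by (auto simp: local_basis_def)
qed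

end

lemma constant_rank_imp_local_basis:
  assumes M: "module R M" and rank: "constant_rank R M r" and P: "primeideal P R"
  shows "\<exists>e. local_basis R M P {..<r} e"
proof -
  interpret P: primeideal P R
    by fact
  interpret module R M
    by fact
  interpret module_localization "carrier R - P" R M
  proof (intro module_localization.intro M submonoid.intro)
    show "\<one>\<^bsub>R\<^esub> \<in> carrier R - P"
      using P.one_notin by simp
  qed (use P.mult_notin in auto)
  show ?thesis
    using rank P unfolding constant_rank_def Let_def by (intro free_imp_local_basis) auto
qed

subsection \<open>Azumaya algebras\<close>

context assoc_algebra
begin

lemma ideal_ideal_times_module:
  assumes "ideal I R"
  shows "ideal (ideal_times_module I M) M"
proof -
  interpret I: ideal I R
    by fact
  note W = submoduleE[OF submodule_ideal_times_module[OF assms]]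
  let ?G = "{a \<odot>\<^bsub>M\<^esub> x | a x. a \<in> I \<and> x \<in> carrier M}"
  \<comment> \<open>The elements whose products with everything, on both sides, lie in
    \<open>IM\<close>: an additive subgroup containing the generators, hence all of
    \<open>IM\<close>.\<close>
  let ?W = "{x \<in> carrier M. \<forall>y\<in>carrier M. x \<otimes>\<^bsub>M\<^esub> y \<in> ideal_times_module I M \<and>
    y \<otimes>\<^bsub>M\<^esub> x \<in> ideal_times_module I M}"
  have "subgroup ?W (add_monoid M)"
  proof (rule M.add.subgroupI)
    have "\<zero>\<^bsub>M\<^esub> \<in> ideal_times_module I M"
      unfolding ideal_times_module_def using generate.one[of "add_monoid M"] by simp
    then show "?W \<noteq> {}"
      by auto
  qed (use W in \<open>auto simp: l_minus r_minus l_distr r_distr\<close>)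
  moreover have "?G \<subseteq> ?W"
    using I.Icarr by (auto simp: smult_assoc2 smult_assoc3 ideal_times_module_mult)
  ultimately have sub: "ideal_times_module I M \<subseteq> ?W"
    unfolding ideal_times_module_def by (intro M.add.generate_subgroup_incl)
  show ?thesis
  proof (rule idealI)
    show "ring M"
      by (rule ring_axioms)
    show "subgroup (ideal_times_module I M) (add_monoid M)"
      using submodule_ideal_times_module[OF assms] by (rule submodule.axioms)
  qed (use sub in auto)
qed

text \<open>The commutator with a fixed \<open>q\<close> is linear over \<open>R\<close>, so
  centrality becomes a system of linear equations in the coordinates.\<close>

lemma commutator_lincomb:
  assumes "finite J" "c \<in> J \<rightarrow> carrier R" "e \<in> J \<rightarrow> carrier M" and q: "q \<in> carrier M"
  shows "lincomb c (\<lambda>i. e i \<otimes>\<^bsub>M\<^esub> q \<ominus>\<^bsub>M\<^esub> q \<otimes>\<^bsub>M\<^esub> e i) J =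
    lincomb c e J \<otimes>\<^bsub>M\<^esub> q \<ominus>\<^bsub>M\<^esub> q \<otimes>\<^bsub>M\<^esub> lincomb c e J"
  using assms(1-3)
proof (induction J rule: finite_induct)
  case empty
  then show ?case
    using q by (simp add: a_minus_def)
next
  case (insert i J)
  define V where "V = lincomb c e J"
  have V: "V \<in> carrier M"
    unfolding V_def using insert.prems by (intro lincomb_closed) auto
  have ci: "c i \<in> carrier R" "e i \<in> carrier M"
    using insert.prems by auto
  have "lincomb c (\<lambda>i. e i \<otimes>\<^bsub>M\<^esub> q \<ominus>\<^bsub>M\<^esub> q \<otimes>\<^bsub>M\<^esub> e i) (insert i J) =
      c i \<odot>\<^bsub>M\<^esub> (e i \<otimes>\<^bsub>M\<^esub> q \<ominus>\<^bsub>M\<^esub> q \<otimes>\<^bsub>M\<^esub> e i) \<oplus>\<^bsub>M\<^esub> (V \<otimes>\<^bsub>M\<^esub> q \<ominus>\<^bsub>M\<^esub> q \<otimes>\<^bsub>M\<^esub> V)"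
    using insert q by (subst lincomb_insert) (auto simp: V_def Pi_iff)
  also have "\<dots> = (c i \<odot>\<^bsub>M\<^esub> e i \<oplus>\<^bsub>M\<^esub> V) \<otimes>\<^bsub>M\<^esub> q \<ominus>\<^bsub>M\<^esub> q \<otimes>\<^bsub>M\<^esub> (c i \<odot>\<^bsub>M\<^esub> e i \<oplus>\<^bsub>M\<^esub> V)"
    using ci V q
    by (simp add: a_minus_def l_distr r_distr smult_r_distr smult_r_minus smult_assoc2
        smult_assoc3 M.minus_add M.a_ac)
  also have "c i \<odot>\<^bsub>M\<^esub> e i \<oplus>\<^bsub>M\<^esub> V = lincomb c e (insert i J)"
    unfolding V_def using insert by (intro lincomb_insert[symmetric]) auto
  finally show ?case .
qed

lemma smult_eq_scalar_mult: "\<lbrakk>a \<in> carrier R; x \<in> carrier M\<rbrakk> \<Longrightarrow> a \<odot>\<^bsub>M\<^esub> x = (a \<odot>\<^bsub>M\<^esub> \<one>\<^bsub>M\<^esub>) \<otimes>\<^bsub>M\<^esub> x"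
  by (simp add: smult_assoc2)

lemma submodule_scalars: "submodule (scalars R M) R M"
proof (rule submoduleI)
  show "\<zero>\<^bsub>M\<^esub> \<in> scalars R M"
    unfolding scalars_def by (intro image_eqI[of _ _ "\<zero>"]) simp_all
  show "\<ominus>\<^bsub>M\<^esub> x \<in> scalars R M" if "x \<in> scalars R M" for x
    using that unfolding scalars_def by (auto simp: smult_l_minus[symmetric])
  show "x \<oplus>\<^bsub>M\<^esub> y \<in> scalars R M" if "x \<in> scalars R M" "y \<in> scalars R M" for x y
    using that unfolding scalars_def by (auto simp: smult_l_distr[symmetric])
  show "a \<odot>\<^bsub>M\<^esub> x \<in> scalars R M" if "a \<in> carrier R" "x \<in> scalars R M" for a x
    using that unfolding scalars_def by (auto simp: smult_assoc1[symmetric])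
qed (auto simp: scalars_def)

lemma scalars_subset_center: "scalars R M \<subseteq> ring_center M"
  by (auto simp: scalars_def ring_center_def smult_assoc2 smult_assoc3)

text \<open>Injectivity is faithfulness: an element of \<open>R\<close> that kills 1 kills the whole
  algebra.\<close>

lemma scalars_ring_iso:
  assumes "faithful_module R M"
  shows "(\<lambda>a. a \<odot>\<^bsub>M\<^esub> \<one>\<^bsub>M\<^esub>) \<in> ring_iso R (M\<lparr>carrier := scalars R M\<rparr>)"
proof (rule ring_iso_memI)
  have "a = b" if ab: "a \<in> carrier R" "b \<in> carrier R" "a \<odot>\<^bsub>M\<^esub> \<one>\<^bsub>M\<^esub> = b \<odot>\<^bsub>M\<^esub> \<one>\<^bsub>M\<^esub>" for a b
  proof -
    have "(a \<ominus> b) \<odot>\<^bsub>M\<^esub> x = \<zero>\<^bsub>M\<^esub>" if x: "x \<in> carrier M" for x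
    proof -
      have "(a \<ominus> b) \<odot>\<^bsub>M\<^esub> x = ((a \<ominus> b) \<odot>\<^bsub>M\<^esub> \<one>\<^bsub>M\<^esub>) \<otimes>\<^bsub>M\<^esub> x"
        using ab x by (intro smult_eq_scalar_mult) simp_all
      also have "(a \<ominus> b) \<odot>\<^bsub>M\<^esub> \<one>\<^bsub>M\<^esub> = \<zero>\<^bsub>M\<^esub>"
        using ab by (simp add: a_minus_def smult_l_distr smult_l_minus M.r_neg)
      finally show ?thesis
        using x by simp
    qed
    then have "a \<ominus> b = \<zero>"
      using assms ab unfolding faithful_module_def by simp
    then show ?thesis
      using ab by simp
  qed
  then show "bij_betw (\<lambda>a. a \<odot>\<^bsub>M\<^esub> \<one>\<^bsub>M\<^esub>) (carrier R) (carrier (M\<lparr>carrier := scalars R M\<rparr>))"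
    by (auto simp: bij_betw_def inj_on_def scalars_def)
qed (auto simp: scalars_def smult_l_distr smult_assoc1 smult_assoc2)

end

context azumaya_algebra
begin

lemma quotient_simps:
  fixes P
  defines "J \<equiv> ideal_times_module P A"
  shows "carrier (quotient_algebra P A) = carrier (A Quot J)"
    "monoid.mult (quotient_algebra P A) = rcoset_mult A J"
    "add (quotient_algebra P A) = add (A Quot J)"
    "one (quotient_algebra P A) = J +> \<one>"
    "ring.zero (quotient_algebra P A) = J"
  by (simp_all add: quotient_algebra_def Let_def J_def FactRing_def)

text \<open>The image of \<open>K\<close> in the simple ring \<open>A/PA\<close> is zero or
  everything. In the second case 1 is the sum of an element of \<open>PA\<close> and an element of
  \<open>K\<close>, and both belong to \<open>K\<close>.\<close>

lemma mem_ideal_times_if_proper_ideal: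
  assumes P: "maximalideal P R" and K: "ideal K A" "ideal_times_module P A \<subseteq> K" "\<one> \<notin> K" and x: "x \<in> K"
  shows "x \<in> ideal_times_module P A"
proof -
  interpret P: maximalideal P R
    by fact
  define J where "J = ideal_times_module P A"
  have idealJ: "ideal J A"
    unfolding J_def by (rule ideal_ideal_times_module[OF P.ideal_axioms])
  interpret J: ideal J A
    by (rule idealJ)
  interpret K: ideal K A
    by (rule K(1))
  let ?Q = "quotient_algebra P A"
  let ?K = "(+>) J ` K"
  have simple: "simple_ring ?Q"
    using central_simple_quotient[OF P] by (simp add: central_simple_algebra_def)
  have idealK: "ideal ?K (A Quot J)"
    by (rule ring_ideal_imp_quot_ideal[OF idealJ K(1)])
  \<comment> \<open>The two quotient records have different types but the same ring operations, so
    the ideal axioms are transferred field by field.\<close>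
  have "ideal ?K ?Q"
  proof (rule idealI)
    show "ring ?Q"
      using simple by (simp add: simple_ring_def)
    show "subgroup ?K (add_monoid ?Q)"
      using additive_subgroup.a_subgroup[OF ideal.axioms(1)[OF idealK]]
      unfolding subgroup_def m_inv_def
      by (simp add: quotient_simps J_def[symmetric] FactRing_def)
  qed (use ideal.I_l_closed[OF idealK] ideal.I_r_closed[OF idealK] in
      \<open>simp_all add: quotient_simps J_def[symmetric] FactRing_def\<close>)
  then have "?K = {J} \<or> ?K = carrier (A Quot J)"
    using simple by (simp add: simple_ring_def quotient_simps J_def[symmetric])
  then show ?thesis
  proof
    assume "?K = {J}"
    then have "J +> x = J"
      using x by blast
    then show ?thesis
      using J.rcos_const_imp_mem[of x] K.Icarr[OF x] by (simp add: J_def)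
  next
    assume "?K = carrier (A Quot J)"
    then have "J +> \<one> \<in> ?K"
      by (auto simp: FactRing_def A_RCOSETS_def')
    then obtain k where k: "k \<in> K" "J +> \<one> = J +> k"
      by blast
    have "\<one> \<in> J +> \<one>"
      by (rule J.a_rcos_self) simp
    then have "\<one> \<in> J +> k"
      using k(2) by simp
    then obtain j where "j \<in> J" "\<one> = j \<oplus> k"
      by (auto simp: a_r_coset_def')
    then show ?thesis
      using K(2,3) k by (auto simp: J_def)
  qed
qed

lemma one_notin_ideal_times:
  assumes P: "maximalideal P R"
  shows "\<one> \<notin> ideal_times_module P A"
proof
  interpret P: maximalideal P R
    by fact
  define J where "J = ideal_times_module P A"
  interpret J: ideal J A
    unfolding J_def by (rule ideal_ideal_times_module[OF P.ideal_axioms])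
  assume "\<one> \<in> ideal_times_module P A"
  then have "J = carrier A"
    using J.one_imp_carrier by (simp add: J_def)
  then have "J +> x = J" if "x \<in> carrier A" for x
    using that J.a_rcos_const by simp
  then have "carrier (A Quot J) = {J}"
    by (auto simp: FactRing_def A_RCOSETS_def')
  then show False
    using central_simple_quotient[OF P]
    by (simp add: central_simple_algebra_def simple_ring_def quotient_simps J_def[symmetric])
qed

lemma scalar_mod_if_central_mod:
  assumes P: "maximalideal P R" and x: "x \<in> carrier A"
    and central: "\<And>y. y \<in> carrier A \<Longrightarrow> x \<otimes> y \<ominus> y \<otimes> x \<in> ideal_times_module P A"
  shows "\<exists>a\<in>carrier R. x \<ominus> a \<odot> \<one> \<in> ideal_times_module P A"
proof -
  interpret P: maximalideal P R
    by fact
  define J where "J = ideal_times_module P A"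
  have idealJ: "ideal J A"
    unfolding J_def by (rule ideal_ideal_times_module[OF P.ideal_axioms])
  interpret J: ideal J A
    by (rule idealJ)
  let ?Q = "quotient_algebra P A"
  have "J +> x \<in> ring_center ?Q"
    unfolding ring_center_def
  proof (intro CollectI conjI ballI)
    show "J +> x \<in> carrier ?Q"
      using x by (auto simp: quotient_simps J_def[symmetric] FactRing_def A_RCOSETS_def')
    fix D assume "D \<in> carrier ?Q"
    then obtain y where y: "y \<in> carrier A" "D = J +> y"
      by (auto simp: quotient_simps J_def[symmetric] FactRing_def A_RCOSETS_def')
    have "J +> x \<otimes> y = J +> y \<otimes> x"
      using quotient_eq_iff_same_a_r_cos[OF idealJ, of "x \<otimes> y" "y \<otimes> x"] x y central[OF y(1)]
      by (simp add: J_def)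
    then show "(J +> x) \<otimes>\<^bsub>?Q\<^esub> D = D \<otimes>\<^bsub>?Q\<^esub> (J +> x)"
      using x y by (simp add: quotient_simps J_def[symmetric] J.rcoset_mult_add)
  qed
  then have "J +> x \<in> scalars (R Quot P) ?Q"
    using central_simple_quotient[OF P] by (simp add: central_simple_algebra_def)
  then obtain C where C: "C \<in> carrier (R Quot P)" and xC: "J +> x = C \<odot>\<^bsub>?Q\<^esub> (J +> \<one>)"
    by (auto simp: scalars_def quotient_simps J_def[symmetric])
  obtain a where a: "a \<in> carrier R" "C = P +>\<^bsub>R\<^esub> a"
    using C by (auto simp: FactRing_def A_RCOSETS_def')
  \<comment> \<open>Scalar multiplication in the quotient is a union over representatives; choosing
    \<open>a\<close> in \<open>C\<close> and 1 in its coset puts \<open>a \<odot> \<one>\<close>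
    into the coset of \<open>x\<close>.\<close>
  have "J +> x = (\<Union>a\<in>C. \<Union>y\<in>J +> \<one>. J +> (a \<odot> y))"
    unfolding xC by (simp add: quotient_algebra_def Let_def J_def)
  moreover have "a \<in> C"
    using a P.a_rcos_self by simp
  moreover have "\<one> \<in> J +> \<one>"
    by (rule J.a_rcos_self) simp
  moreover have "a \<odot> \<one> \<in> J +> (a \<odot> \<one>)"
    using a by (intro J.a_rcos_self) simp
  ultimately have "a \<odot> \<one> \<in> J +> x"
    by blast
  then have "J +> x = J +> (a \<odot> \<one>)"
    using x by (intro a_repr_independence J.a_subgroup)
  then have "x \<ominus> a \<odot> \<one> \<in> J"
    using quotient_eq_iff_same_a_r_cos[OF idealJ x, of "a \<odot> \<one>"] a by simp
  then show ?thesis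
    using a by (auto simp: J_def)
qed

end

section \<open>The center of an Azumaya algebra of constant rank\<close>

context azumaya_algebra
begin

text \<open>Locally, 1 replaces a basis element \<open>e j\<close>. Subtracting from a multiple of
  \<open>z\<close> its component along 1 leaves a central \<open>w\<close> in the span of the other
  \<open>e i\<close>, and the commutator equations annihilate \<open>w\<close> locally.\<close>

lemma center_locally_scalar:
  fixes r :: nat
  assumes P: "maximalideal P R" and e: "local_basis R A P {..<r} e" and z: "z \<in> ring_center A"
  shows "\<exists>s\<in>carrier R - P. s \<odot> z \<in> scalars R A"
proof -
  have prime: "primeideal P R"
    using P by (rule R.maximalideal_prime)
  interpret P: primeideal P R
    by fact
  have eA: "e \<in> {..<r} \<rightarrow> carrier A" and span: "locally_spans R A P {..<r} e"
    using e by (auto simp: local_basis_def)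
  have zA: "z \<in> carrier A" and zc: "\<And>q. q \<in> carrier A \<Longrightarrow> z \<otimes> q = q \<otimes> z"
    using z by (auto simp: ring_center_def)
  note PA = submodule_ideal_times_module[OF P.ideal_axioms]
  note PAE = submoduleE[OF PA]
  obtain s d where s: "s \<in> carrier R - P" and d: "d \<in> {..<r} \<rightarrow> carrier R"
    and s1: "s \<odot> \<one> = lincomb d e {..<r}"
    using locally_spansE[OF span one_closed] by blast
  obtain t c where t: "t \<in> carrier R - P" and c: "c \<in> {..<r} \<rightarrow> carrier R"
    and tz: "t \<odot> z = lincomb c e {..<r}"
    using locally_spansE[OF span zA] by blast
  have sR: "s \<in> carrier R" and tR: "t \<in> carrier R"
    using s t by auto
  \<comment> \<open>If all coordinates of \<open>s \<odot> \<one>\<close> were in \<open>P\<close>,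
    saturation would put 1 into \<open>PA\<close>.\<close>
  have "\<exists>j<r. d j \<notin> P"
  proof (rule ccontr)
    assume "\<not> ?thesis"
    then have "s \<odot> \<one> \<in> ideal_times_module P A"
      unfolding s1 using eA by (intro lincomb_in_submodule[OF PA] ideal_times_module_mult) auto
    then show False
      using ideal_times_module_saturated[OF P s one_closed] one_notin_ideal_times[OF P] by blast
  qed
  then obtain j where j: "j < r" "d j \<notin> P"
    by blast
  have dj: "d j \<in> carrier R" and cj: "c j \<in> carrier R" and ej: "e j \<in> carrier A"
    using d c eA j by auto
  let ?L = "{..<r} - {j}"
  have eL: "e \<in> ?L \<rightarrow> carrier A"
    using eA by auto
  have split: "lincomb a e {..<r} = a j \<odot> e j \<oplus> lincomb a e ?L" if "a \<in> {..<r} \<rightarrow> carrier R" for a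
  proof -
    have "insert j ?L = {..<r}"
      using j by auto
    then show ?thesis
      using lincomb_insert[of ?L j a e] that eA by auto
  qed
  \<comment> \<open>The coordinate \<open>j\<close> is eliminated between \<open>t \<odot> z\<close>
    and \<open>s \<odot> \<one>\<close>, so \<open>n j\<close> vanishes.\<close>
  define n where "n = (\<lambda>i. d j \<otimes>\<^bsub>R\<^esub> c i \<oplus>\<^bsub>R\<^esub> (\<ominus>\<^bsub>R\<^esub> c j) \<otimes>\<^bsub>R\<^esub> d i)"
  have n: "n \<in> {..<r} \<rightarrow> carrier R"
    using c d dj cj by (auto simp: n_def Pi_iff)
  have nL: "n \<in> ?L \<rightarrow> carrier R"
    using n by auto
  define w where "w = d j \<odot> (t \<odot> z) \<oplus> (\<ominus>\<^bsub>R\<^esub> c j) \<odot> (s \<odot> \<one>)"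
  have wA: "w \<in> carrier A"
    using zA dj cj tR sR by (simp add: w_def)
  have "w = lincomb n e {..<r}"
    unfolding w_def n_def tz s1 using c d dj cj eA
    by (subst lincomb_add) (auto simp: smult_lincomb Pi_iff)
  also have "\<dots> = lincomb n e ?L"
  proof -
    have "n j = \<zero>\<^bsub>R\<^esub>"
      using dj cj by (simp add: n_def R.l_minus R.r_minus R.m_comm R.r_neg)
    then show ?thesis
      using split[OF n] ej lincomb_closed[OF nL eL] by simp
  qed
  finally have w: "w = lincomb n e ?L" .
  have wc: "w \<otimes> q = q \<otimes> w" if q: "q \<in> carrier A" for q
    using zA dj cj tR sR q zc[OF q]
    by (simp add: w_def l_distr r_distr smult_assoc2 smult_assoc3)
  have "\<exists>u\<in>carrier R - P. \<forall>i\<in>?L. u \<otimes>\<^bsub>R\<^esub> n i = \<zero>\<^bsub>R\<^esub>"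
  \<comment> \<open>The unknowns are the coefficients of the \<open>e i\<close> with
    \<open>i\<close> different from \<open>j\<close>; there is one equation for every
    \<open>q\<close> in the algebra.\<close>
  proof (rule locally_injective_mod[OF P e, of ?L "carrier A" "\<lambda>q i. e i \<otimes> q \<ominus> q \<otimes> e i" n])
    fix b assume b: "b \<in> ?L \<rightarrow> carrier R"
      and bP: "\<And>q. q \<in> carrier A \<Longrightarrow>
        lincomb b (\<lambda>i. e i \<otimes> q \<ominus> q \<otimes> e i) ?L \<in> ideal_times_module P A"
    define v where "v = lincomb b e ?L"
    have vA: "v \<in> carrier A"
      unfolding v_def using b eL by (rule lincomb_closed)
    have "v \<otimes> q \<ominus> q \<otimes> v \<in> ideal_times_module P A" if q: "q \<in> carrier A" for q
      using bP[OF q] commutator_lincomb[OF _ b eL q] by (simp add: v_def)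
    then obtain a where a: "a \<in> carrier R" and va: "v \<ominus> a \<odot> \<one> \<in> ideal_times_module P A"
      using scalar_mod_if_central_mod[OF P vA] by blast
    \<comment> \<open>Extension by zero at \<open>j\<close>, so that independence modulo
      \<open>PA\<close> of the full family can be used.\<close>
    define b' where "b' = (\<lambda>i. if i = j then \<zero>\<^bsub>R\<^esub> else b i)"
    have b': "b' \<in> {..<r} \<rightarrow> carrier R"
      using b by (auto simp: b'_def)
    have "lincomb b' e ?L = v"
      unfolding v_def using b eL by (intro lincomb_cong) (auto simp: b'_def)
    then have vb': "v = lincomb b' e {..<r}"
      using split[OF b'] ej vA by (simp add: b'_def)
    have "s \<odot> (v \<ominus> a \<odot> \<one>) = s \<odot> v \<oplus> (\<ominus>\<^bsub>R\<^esub> a) \<odot> (s \<odot> \<one>)"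
      using sR a vA smult_commute[of s a \<one>]
      by (simp add: a_minus_def smult_r_distr smult_r_minus smult_l_minus)
    also have "\<dots> = lincomb (\<lambda>i. s \<otimes>\<^bsub>R\<^esub> b' i \<oplus>\<^bsub>R\<^esub> (\<ominus>\<^bsub>R\<^esub> a) \<otimes>\<^bsub>R\<^esub> d i) e {..<r}"
      unfolding vb' s1 using b' d a sR eA
      by (subst lincomb_add) (auto simp: smult_lincomb Pi_iff)
    finally have "lincomb (\<lambda>i. s \<otimes>\<^bsub>R\<^esub> b' i \<oplus>\<^bsub>R\<^esub> (\<ominus>\<^bsub>R\<^esub> a) \<otimes>\<^bsub>R\<^esub> d i) e {..<r} \<in> ideal_times_module P A"
      using PAE(4)[OF sR va] by simp
    then have in_P: "(\<lambda>i. s \<otimes>\<^bsub>R\<^esub> b' i \<oplus>\<^bsub>R\<^esub> (\<ominus>\<^bsub>R\<^esub> a) \<otimes>\<^bsub>R\<^esub> d i) \<in> {..<r} \<rightarrow> P"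
      using b' d a sR by (intro local_basis_independent_mod[OF prime e]) (auto simp: Pi_iff)
    \<comment> \<open>At \<open>j\<close> the combination \<open>v\<close> has coordinate 0, so only
      the contribution of the scalar \<open>a\<close> remains.\<close>
    then have "(\<ominus>\<^bsub>R\<^esub> a) \<otimes>\<^bsub>R\<^esub> d j \<in> P"
      using j a dj sR funcset_mem[OF in_P, of j] by (simp add: b'_def)
    then have "\<ominus>\<^bsub>R\<^esub> a \<in> P"
      using P.I_prime[of "\<ominus>\<^bsub>R\<^esub> a" "d j"] a dj j by simp
    then have "a \<in> P"
      using P.a_inv_closed[of "\<ominus>\<^bsub>R\<^esub> a"] a by simp
    then have "v \<ominus> a \<odot> \<one> \<oplus> a \<odot> \<one> \<in> ideal_times_module P A"
      using va PAE(5) ideal_times_module_mult by simp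
    moreover have "v \<ominus> a \<odot> \<one> \<oplus> a \<odot> \<one> = v"
      using vA a by (simp add: a_minus_def M.a_assoc M.l_neg)
    ultimately have "lincomb b' e {..<r} \<in> ideal_times_module P A"
      by (simp add: vb')
    then have "b' \<in> {..<r} \<rightarrow> P"
      using local_basis_independent_mod[OF prime e b'] by blast
    then show "b \<in> ?L \<rightarrow> P"
      by (auto simp: b'_def Pi_iff split: if_splits)
  next
    fix q assume q: "q \<in> carrier A"
    show "lincomb n (\<lambda>i. e i \<otimes> q \<ominus> q \<otimes> e i) ?L = \<zero>"
      using commutator_lincomb[OF _ nL eL q] wc[OF q] wA q by (simp flip: w)
  qed (use eL nL in auto)
  then obtain u where u: "u \<in> carrier R - P" "\<And>i. i \<in> ?L \<Longrightarrow> u \<otimes>\<^bsub>R\<^esub> n i = \<zero>\<^bsub>R\<^esub>"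
    by blast
  have uR: "u \<in> carrier R"
    using u by simp
  have "u \<odot> w = lincomb (\<lambda>i. u \<otimes>\<^bsub>R\<^esub> n i) e ?L"
    unfolding w using uR nL eL by (intro smult_lincomb) auto
  also have "\<dots> = \<zero>"
    using u(2) eL by (intro lincomb_zero) auto
  \<comment> \<open>Since \<open>u\<close> kills \<open>w\<close>, a multiple of \<open>z\<close> by
    a factor outside \<open>P\<close> equals a multiple of 1.\<close>
  finally have "u \<odot> (d j \<odot> (t \<odot> z)) \<oplus> u \<odot> ((\<ominus>\<^bsub>R\<^esub> c j) \<odot> (s \<odot> \<one>)) = \<zero>"
    using uR dj cj tR sR zA by (simp add: w_def smult_r_distr)
  then have "u \<odot> (d j \<odot> (t \<odot> z)) = \<ominus> (u \<odot> ((\<ominus>\<^bsub>R\<^esub> c j) \<odot> (s \<odot> \<one>)))"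
    using uR dj cj tR sR zA by (intro M.minus_equality[symmetric]) simp_all
  also have "\<dots> \<in> scalars R A"
  proof -
    note S = submoduleE[OF submodule_scalars]
    have "\<one> \<in> scalars R A"
      unfolding scalars_def by (intro image_eqI[of _ _ "\<one>\<^bsub>R\<^esub>"]) simp_all
    then show ?thesis
      using uR cj sR by (intro S(3,4)) simp_all
  qed
  finally have "(u \<otimes>\<^bsub>R\<^esub> d j \<otimes>\<^bsub>R\<^esub> t) \<odot> z \<in> scalars R A"
    using uR dj tR zA by (simp add: smult_assoc1)
  moreover have "u \<otimes>\<^bsub>R\<^esub> d j \<otimes>\<^bsub>R\<^esub> t \<in> carrier R - P"
    using P.mult_notin[OF P.mult_notin[OF u(1)] t, of "d j"] dj j by blast
  ultimately show ?thesis
    by blast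
qed

text \<open>The scalars form a submodule, so membership in them can be tested locally.\<close>

lemma center_eq_scalars:
  assumes "constant_rank R A r"
  shows "ring_center A = scalars R A"
proof
  show "scalars R A \<subseteq> ring_center A"
    by (rule scalars_subset_center)
  show "ring_center A \<subseteq> scalars R A"
  proof
    fix z assume z: "z \<in> ring_center A"
    show "z \<in> scalars R A"
    proof (rule mem_submodule_if_locally[OF submodule_scalars])
      show "z \<in> carrier A"
        using z by (simp add: ring_center_def)
      fix P assume P: "maximalideal P R"
      obtain e where "local_basis R A P {..<r} e"
        using constant_rank_imp_local_basis[OF module_axioms assms R.maximalideal_prime[OF P]] by blast
      then show "\<exists>s\<in>carrier R - P. s \<odot> z \<in> scalars R A"
        using center_locally_scalar[OF P _ z] by blast
    qed
  qed
qed

end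

section \<open>Transport along an isomorphism of base rings\<close>

lemma maximalideal_vimage_iso:
  fixes R (structure) and R' (structure)
  assumes R: "ring R" and R': "ring R'" and f: "f \<in> ring_iso R R'" and P: "maximalideal P R'"
  shows "maximalideal {a \<in> carrier R. f a \<in> P} R"
proof -
  interpret R: ring R
    by fact
  interpret R': ring R'
    by fact
  interpret P: maximalideal P R'
    by fact
  define g where "g = inv_into (carrier R) f"
  have bij: "bij_betw f (carrier R) (carrier R')"
    using f by (simp add: ring_iso_def)
  have g: "g \<in> ring_iso R' R"
    unfolding g_def by (rule ring_iso_set_sym[OF R f])
  interpret f: ring_hom_ring R R' f
    using f by (intro ring_hom_ringI2 R R') (simp add: ring_iso_def)
  interpret g: ring_hom_ring R' R g
    using g by (intro ring_hom_ringI2 R R') (simp add: ring_iso_def)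
  have gf: "\<And>a. a \<in> carrier R \<Longrightarrow> g (f a) = a" and fg: "\<And>b. b \<in> carrier R' \<Longrightarrow> f (g b) = b"
    using bij by (simp_all add: g_def bij_betw_inv_into_left bij_betw_inv_into_right)
  show ?thesis
  proof (rule maximalidealI)
    show "ideal {a \<in> carrier R. f a \<in> P} R"
      by (rule f.ideal_vimage[OF P.ideal_axioms])
    show "carrier R \<noteq> {a \<in> carrier R. f a \<in> P}"
    proof
      assume "carrier R = {a \<in> carrier R. f a \<in> P}"
      then have "\<one>\<^bsub>R'\<^esub> \<in> P"
        using R.one_closed f.hom_one by force
      then show False
        using P.one_imp_carrier P.I_notcarr by blast
    qed
    fix J assume J: "ideal J R" "{a \<in> carrier R. f a \<in> P} \<subseteq> J" "J \<subseteq> carrier R"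
    have "ideal {b \<in> carrier R'. g b \<in> J} R'"
      by (rule g.ideal_vimage[OF J(1)])
    moreover have "P \<subseteq> {b \<in> carrier R'. g b \<in> J}"
      using J(2) fg P.Icarr by auto
    moreover have in_vimage: "f a \<in> {b \<in> carrier R'. g b \<in> J}" if "a \<in> J" for a
      using that J(3) gf[of a] f.hom_closed[of a] by auto
    ultimately have "{b \<in> carrier R'. g b \<in> J} = P \<or> {b \<in> carrier R'. g b \<in> J} = carrier R'"
      using P.I_maximal by blast
    then show "J = {a \<in> carrier R. f a \<in> P} \<or> J = carrier R"
    proof
      assume "{b \<in> carrier R'. g b \<in> J} = P"
      then have "J \<subseteq> {a \<in> carrier R. f a \<in> P}"
        using J(3) in_vimage by blast
      then show ?thesis
        using J(2) by blast
    next
      assume "{b \<in> carrier R'. g b \<in> J} = carrier R'"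
      then have "g (f a) \<in> J" if "a \<in> carrier R" for a
        using f.hom_closed[OF that] by blast
      then have "carrier R \<subseteq> J"
        using gf by auto
      then show ?thesis
        using J(3) by blast
    qed
  qed
qed

text \<open>The formation of \<open>generate\<close> depends only on unit, product and inverse, so
  it can be compared across records of different types.\<close>

lemma generate_mono_structure:
  assumes "\<one>\<^bsub>G\<^esub> = \<one>\<^bsub>H\<^esub>" "monoid.mult G = monoid.mult H" "m_inv G = m_inv H"
  shows "generate G B \<subseteq> generate H B"
proof
  fix x assume "x \<in> generate G B"
  then show "x \<in> generate H B"
    by (induction rule: generate.induct) (use assms in \<open>auto intro: generate.intros\<close>)
qed

lemma generate_cong:
  assumes "\<one>\<^bsub>G\<^esub> = \<one>\<^bsub>H\<^esub>" "monoid.mult G = monoid.mult H" "m_inv G = m_inv H"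
  shows "generate G B = generate H B"
  using generate_mono_structure[OF assms] generate_mono_structure[OF assms[symmetric]] by blast

text \<open>Restriction of scalars along \<open>f\<close>. It places both algebras over the same
  base ring, where the homomorphism between them is linear.\<close>

definition restrict_scalars ::
    "('a \<Rightarrow> 'e) \<Rightarrow> ('e, 'b, 'm) module_scheme \<Rightarrow> ('a, 'b) module"
  where "restrict_scalars f M =
    \<lparr>carrier = carrier M, monoid.mult = monoid.mult M, one = one M, ring.zero = ring.zero M,
     add = add M, smult = (\<lambda>a x. f a \<odot>\<^bsub>M\<^esub> x)\<rparr>"

lemma restrict_scalars_simps [simp]:
  "carrier (restrict_scalars f M) = carrier M"
  "add (restrict_scalars f M) = add M"
  "ring.zero (restrict_scalars f M) = ring.zero M"
  "a \<odot>\<^bsub>restrict_scalars f M\<^esub> x = f a \<odot>\<^bsub>M\<^esub> x"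
  by (simp_all add: restrict_scalars_def)

lemma finsum_restrict_scalars: "finsum (restrict_scalars f M) = finsum M"
  by (intro ext) (simp add: finsum_def finprod_def)

lemma module_restrict_scalars:
  fixes R (structure) and R' (structure)
  assumes M: "module R M" and R': "cring R'" and f: "f \<in> ring_hom R' R"
  shows "module R' (restrict_scalars f M)"
proof -
  interpret module R M
    by fact
  interpret R': cring R'
    by fact
  note hom = ring_hom_closed[OF f] ring_hom_add[OF f] ring_hom_mult[OF f] ring_hom_one[OF f]
  have "abelian_group (restrict_scalars f M)"
    by (rule abelian_groupI) (auto simp: M.a_ac intro: M.l_neg bexI[of _ "\<ominus>\<^bsub>M\<^esub> x" for x])
  then show ?thesis
    by (intro moduleI R') (auto simp: hom smult_l_distr smult_r_distr smult_assoc1)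
qed

text \<open>The inverse \<open>g\<close> of \<open>f\<close> carries denominators and coefficients
  to the new base ring, and \<open>P\<close> is replaced by its preimage.\<close>

lemma local_basis_restrict_scalars:
  fixes R (structure) and R' (structure)
  assumes M: "module R M" and R: "ring R" and R': "ring R'" and f: "f \<in> ring_iso R' R"
    and e: "local_basis R M P J e" and P: "P \<subseteq> carrier R"
  shows "local_basis R' (restrict_scalars f M) {a \<in> carrier R'. f a \<in> P} J e"
proof -
  interpret module R M
    by fact
  interpret R': ring R'
    by fact
  define g where "g = inv_into (carrier R') f"
  have bij: "bij_betw f (carrier R') (carrier R)" and hom: "f \<in> ring_hom R' R"
    using f by (simp_all add: ring_iso_def)
  note hom' = ring_hom_closed[OF hom] ring_hom_mult[OF hom]
  have fg: "\<And>a. a \<in> carrier R \<Longrightarrow> f (g a) = a" and gR: "\<And>a. a \<in> carrier R \<Longrightarrow> g a \<in> carrier R'"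
    using bij bij_betwE[OF bij_betw_inv_into[OF bij]]
    by (auto simp: g_def bij_betw_inv_into_right)
  have inj: "\<And>a b. \<lbrakk>a \<in> carrier R'; b \<in> carrier R'; f a = f b\<rbrakk> \<Longrightarrow> a = b"
    using bij by (auto simp: bij_betw_def inj_on_def)
  have f0: "f \<zero>\<^bsub>R'\<^esub> = \<zero>"
    by (rule ring_hom_zero[OF hom R' R])
  let ?P = "{a \<in> carrier R'. f a \<in> P}"
  have eM: "e \<in> J \<rightarrow> carrier M" and J: "finite J"
    using e by (auto simp: local_basis_def)
  have "locally_spans R' (restrict_scalars f M) ?P J e"
    unfolding locally_spans_def
  proof
    fix x assume "x \<in> carrier (restrict_scalars f M)"
    then obtain s c where s: "s \<in> carrier R - P" and c: "c \<in> J \<rightarrow> carrier R"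
      and sx: "s \<odot>\<^bsub>M\<^esub> x = lincomb c e J"
      using locally_spansE[of R M P J e x] e by (auto simp: local_basis_def)
    have "lincomb (\<lambda>j. f (g (c j))) e J = lincomb c e J"
      using c eM fg by (intro lincomb_cong) (auto simp: Pi_iff)
    then have "f (g s) \<odot>\<^bsub>M\<^esub> x = lincomb (\<lambda>j. f (g (c j))) e J"
      using s sx fg by simp
    then show "\<exists>s\<in>carrier R' - ?P. \<exists>c\<in>J \<rightarrow> carrier R'. s \<odot>\<^bsub>restrict_scalars f M\<^esub> x =
        (\<Oplus>\<^bsub>restrict_scalars f M\<^esub>j\<in>J. c j \<odot>\<^bsub>restrict_scalars f M\<^esub> e j)"
      using s c gR fg
      by (intro bexI[of _ "g s"] bexI[of _ "\<lambda>j. g (c j)"]) (auto simp: finsum_restrict_scalars Pi_iff)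
  qed
  moreover have "locally_independent R' (restrict_scalars f M) ?P J e"
    unfolding locally_independent_def
  proof (intro ballI impI)
    fix c assume c: "c \<in> J \<rightarrow> carrier R'"
      and zero: "(\<Oplus>\<^bsub>restrict_scalars f M\<^esub>j\<in>J. c j \<odot>\<^bsub>restrict_scalars f M\<^esub> e j) = \<zero>\<^bsub>restrict_scalars f M\<^esub>"
    have fc: "(\<lambda>j. f (c j)) \<in> J \<rightarrow> carrier R"
      using c hom' by auto
    have "lincomb (\<lambda>j. f (c j)) e J = \<zero>\<^bsub>M\<^esub>"
      using zero by (simp add: finsum_restrict_scalars)
    moreover have "locally_independent R M P J e"
      using e by (simp add: local_basis_def)
    ultimately obtain s where s: "s \<in> carrier R - P" "\<And>j. j \<in> J \<Longrightarrow> s \<otimes> f (c j) = \<zero>"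
      using fc unfolding locally_independent_def by (elim ballE[of _ _ "\<lambda>j. f (c j)"]) auto
    have "g s \<otimes>\<^bsub>R'\<^esub> c j = \<zero>\<^bsub>R'\<^esub>" if "j \<in> J" for j
    proof (rule inj)
      have "c j \<in> carrier R'" "g s \<in> carrier R'"
        using c that gR s by auto
      then show "g s \<otimes>\<^bsub>R'\<^esub> c j \<in> carrier R'" "f (g s \<otimes>\<^bsub>R'\<^esub> c j) = f \<zero>\<^bsub>R'\<^esub>"
        using s that fg f0 hom' by simp_all
    qed simp
    then show "\<exists>s\<in>carrier R' - ?P. \<forall>j\<in>J. s \<otimes>\<^bsub>R'\<^esub> c j = \<zero>\<^bsub>R'\<^esub>"
      using s gR fg by (intro bexI[of _ "g s"]) auto
  qed
  ultimately show ?thesis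
    using eM J by (simp add: local_basis_def)
qed

lemma ideal_times_restrict_scalars:
  assumes bij: "bij_betw f (carrier R') (carrier R)" and P: "P \<subseteq> carrier R"
  shows "ideal_times_module {a \<in> carrier R'. f a \<in> P} (restrict_scalars f M) = ideal_times_module P M"
proof -
  have "P = f ` {a \<in> carrier R'. f a \<in> P}"
    using bij P by (force simp: bij_betw_def)
  then have "{a \<odot>\<^bsub>restrict_scalars f M\<^esub> x | a x. a \<in> {a \<in> carrier R'. f a \<in> P} \<and>
      x \<in> carrier (restrict_scalars f M)} = {a \<odot>\<^bsub>M\<^esub> x | a x. a \<in> P \<and> x \<in> carrier M}"
    by force
  moreover have "generate (add_monoid (restrict_scalars f M)) B = generate (add_monoid M) B" for B
    by (rule generate_cong) (simp_all add: m_inv_def fun_eq_iff)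
  ultimately show ?thesis
    unfolding ideal_times_module_def by simp
qed

section \<open>Comparison of the two algebras\<close>

lemma ring_iso_image_center:
  assumes A: "ring A" and h: "h \<in> ring_iso A A'"
  shows "h ` ring_center A = ring_center A'"
proof
  have hom: "h \<in> ring_hom A A'" and bij: "bij_betw h (carrier A) (carrier A')"
    using h by (simp_all add: ring_iso_def)
  have img: "h ` carrier A = carrier A'" and inj: "inj_on h (carrier A)"
    using bij by (simp_all add: bij_betw_def)
  show "h ` ring_center A \<subseteq> ring_center A'"
  proof
    fix z assume "z \<in> h ` ring_center A"
    then obtain x where x: "x \<in> ring_center A" "z = h x"
      by blast
    have "z \<otimes>\<^bsub>A'\<^esub> y = y \<otimes>\<^bsub>A'\<^esub> z" if y: "y \<in> carrier A'" for y
    proof -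
      obtain w where "w \<in> carrier A" "y = h w"
        using y img by blast
      then show ?thesis
        using x by (simp add: ring_center_def flip: ring_hom_mult[OF hom])
    qed
    then show "z \<in> ring_center A'"
      using x img by (auto simp: ring_center_def)
  qed
  show "ring_center A' \<subseteq> h ` ring_center A"
  proof
    fix z assume z: "z \<in> ring_center A'"
    then obtain x where x: "x \<in> carrier A" "z = h x"
      using img by (auto simp: ring_center_def)
    have "x \<otimes>\<^bsub>A\<^esub> y = y \<otimes>\<^bsub>A\<^esub> x" if y: "y \<in> carrier A" for y
    proof (rule inj_onD[OF inj])
      have "h y \<in> carrier A'"
        using y img by blast
      then show "h (x \<otimes>\<^bsub>A\<^esub> y) = h (y \<otimes>\<^bsub>A\<^esub> x)"
        using z x y by (simp add: ring_hom_mult[OF hom] ring_center_def)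
    qed (use x y ring.ring_simprules(5)[OF A] in simp_all)
    then show "z \<in> h ` ring_center A"
      using x by (auto simp: ring_center_def)
  qed
qed

text \<open>The isomorphism on scalars amounts to one between \<open>R\<close> and
  \<open>R'\<close>. It reduces the claim to the local criterion for linear maps, and simplicity of
  \<open>A/PA\<close> supplies injectivity modulo \<open>P\<close>.\<close>

lemma azumaya_bij_if_iso_on_scalars:
  assumes A: "azumaya_algebra R A" and A': "azumaya_algebra R' A'"
    and rank: "constant_rank R A r" and rank': "constant_rank R' A' r"
    and h: "h \<in> ring_hom A A'"
    and iso: "h \<in> ring_iso (A\<lparr>carrier := scalars R A\<rparr>) (A'\<lparr>carrier := scalars R' A'\<rparr>)"
  shows "bij_betw h (carrier A) (carrier A')"
proof -
  interpret A: azumaya_algebra R A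
    by fact
  interpret A': azumaya_algebra R' A'
    by fact
  let ?i = "\<lambda>a. a \<odot>\<^bsub>A\<^esub> \<one>\<^bsub>A\<^esub>" and ?i' = "\<lambda>a. a \<odot>\<^bsub>A'\<^esub> \<one>\<^bsub>A'\<^esub>"
  have i: "?i \<in> ring_iso R (A\<lparr>carrier := scalars R A\<rparr>)"
    by (rule A.scalars_ring_iso[OF A.faithful])
  have i': "?i' \<in> ring_iso R' (A'\<lparr>carrier := scalars R' A'\<rparr>)"
    by (rule A'.scalars_ring_iso[OF A'.faithful])
  \<comment> \<open>The composite of \<open>R\<close> with its image in \<open>A\<close>, then
    \<open>h\<close>, then the image of \<open>R'\<close> in \<open>A'\<close> back to
    \<open>R'\<close>.\<close>
  define \<theta> where "\<theta> = inv_into (carrier R') ?i' \<circ> (h \<circ> ?i)"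
  have \<theta>: "\<theta> \<in> ring_iso R R'"
    unfolding \<theta>_def
    by (rule ring_iso_set_trans[OF ring_iso_set_trans[OF i iso] ring_iso_set_sym[OF A'.R.ring_axioms i']])
  define \<psi> where "\<psi> = inv_into (carrier R) \<theta>"
  have \<psi>: "\<psi> \<in> ring_iso R' R"
    unfolding \<psi>_def by (rule ring_iso_set_sym[OF A.R.ring_axioms \<theta>])
  have bij: "bij_betw \<theta> (carrier R) (carrier R')" and bij': "bij_betw \<psi> (carrier R') (carrier R)"
    using \<theta> \<psi> by (simp_all add: ring_iso_def)
  have \<psi>_hom: "\<psi> \<in> ring_hom R' R"
    using \<psi> by (simp add: ring_iso_def)
  have \<theta>\<psi>: "\<theta> (\<psi> a) = a" if "a \<in> carrier R'" for a
    using bij that by (simp add: \<psi>_def bij_betw_inv_into_right)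
  have \<psi>_closed: "\<psi> a \<in> carrier R" if "a \<in> carrier R'" for a
    using ring_hom_closed[OF \<psi>_hom that] .
  have h_scalar: "h (?i a) = ?i' (\<theta> a)" if a: "a \<in> carrier R" for a
  proof -
    have "?i a \<in> scalars R A"
      using a by (auto simp: scalars_def)
    then have "h (?i a) \<in> scalars R' A'"
      using iso by (auto simp: ring_iso_def bij_betw_def)
    then show ?thesis
      unfolding \<theta>_def comp_apply scalars_def by (rule f_inv_into_f[of _ ?i' "carrier R'", symmetric])
  qed
  have h_smult: "h (a \<odot>\<^bsub>A\<^esub> x) = \<theta> a \<odot>\<^bsub>A'\<^esub> h x" if a: "a \<in> carrier R" and x: "x \<in> carrier A" for a x
  proof -
    have "h (a \<odot>\<^bsub>A\<^esub> x) = h (?i a \<otimes>\<^bsub>A\<^esub> x)"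
      using A.smult_eq_scalar_mult[OF a x] by simp
    also have "\<dots> = ?i' (\<theta> a) \<otimes>\<^bsub>A'\<^esub> h x"
      using a x by (simp add: ring_hom_mult[OF h] h_scalar)
    also have "\<dots> = \<theta> a \<odot>\<^bsub>A'\<^esub> h x"
      using bij_betwE[OF bij] a ring_hom_closed[OF h x] by (intro A'.smult_eq_scalar_mult[symmetric]) auto
    finally show ?thesis .
  qed
  \<comment> \<open>Over \<open>R\<close> the map \<open>h\<close> is only semilinear along
    \<open>\<theta>\<close>; through the inverse \<open>\<psi>\<close> it becomes linear over
    \<open>R'\<close>.\<close>
  let ?B = "restrict_scalars \<psi> A"
  have "bij_betw h (carrier ?B) (carrier A')"
  proof (rule bij_betw_linear_if_locally[where R = R' and r = r])
    show "module R' ?B"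
      by (rule module_restrict_scalars[OF A.module_axioms A'.R.is_cring \<psi>_hom])
    show "module R' A'"
      by (rule A'.module_axioms)
    show "h \<in> carrier ?B \<rightarrow> carrier A'"
      using ring_hom_closed[OF h] by simp
    show "h (x \<oplus>\<^bsub>?B\<^esub> y) = h x \<oplus>\<^bsub>A'\<^esub> h y" if "x \<in> carrier ?B" "y \<in> carrier ?B" for x y
      using that ring_hom_add[OF h] by simp
    show "h (a \<odot>\<^bsub>?B\<^esub> x) = a \<odot>\<^bsub>A'\<^esub> h x" if "a \<in> carrier R'" "x \<in> carrier ?B" for a x
      using that h_smult[OF \<psi>_closed[OF that(1)]] \<theta>\<psi> by simp
  next
    fix P' assume P': "maximalideal P' R'"
    interpret P': maximalideal P' R'
      by fact
    define P where "P = {a \<in> carrier R. \<theta> a \<in> P'}"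
    have P: "maximalideal P R"
      unfolding P_def by (rule maximalideal_vimage_iso[OF A.R.ring_axioms A'.R.ring_axioms \<theta> P'])
    have PR: "P \<subseteq> carrier R"
      by (auto simp: P_def)
    \<comment> \<open>The preimages along \<open>\<theta>\<close> and \<open>\<psi>\<close> undo
      each other, so local data at \<open>P\<close> become local data at \<open>P'\<close>.\<close>
    have P'_eq: "{a \<in> carrier R'. \<psi> a \<in> P} = P'"
      using \<psi>_closed \<theta>\<psi> P'.Icarr by (auto simp: P_def)
    obtain e where "local_basis R A P {..<r} e"
      using constant_rank_imp_local_basis[OF A.module_axioms rank A.R.maximalideal_prime[OF P]] by blast
    then have "local_basis R' ?B P' {..<r} e"
      using local_basis_restrict_scalars[OF A.module_axioms A.R.ring_axioms A'.R.ring_axioms \<psi> _ PR]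
        P'_eq by simp
    then show "(\<exists>e. local_basis R' ?B P' {..<r} e) \<and> (\<exists>e. local_basis R' A' P' {..<r} e)"
      using constant_rank_imp_local_basis[OF A'.module_axioms rank' A'.R.maximalideal_prime[OF P']] by blast
    fix x assume x: "x \<in> carrier ?B" and hx: "h x \<in> ideal_times_module P' A'"
    interpret h: ring_hom_ring A A' h
      by (rule ring_hom_ringI2[OF A.ring_axioms A'.ring_axioms h])
    \<comment> \<open>Semilinearity puts \<open>PA\<close> inside \<open>?K\<close>, and 1 stays
      outside because \<open>h\<close> preserves it; simplicity leaves no room above
      \<open>PA\<close>.\<close>
    let ?K = "{y \<in> carrier A. h y \<in> ideal_times_module P' A'}"
    have K: "ideal ?K A"
      by (rule h.ideal_vimage[OF A'.ideal_ideal_times_module[OF P'.ideal_axioms]])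
    have "{a \<odot>\<^bsub>A\<^esub> x | a x. a \<in> P \<and> x \<in> carrier A} \<subseteq> ?K"
      by (auto simp: P_def h_smult intro!: A'.ideal_times_module_mult)
    then have "ideal_times_module P A \<subseteq> ?K"
      unfolding ideal_times_module_def[of P]
      by (rule A.M.add.generate_subgroup_incl) (rule additive_subgroup.a_subgroup[OF ideal.axioms(1)[OF K]])
    moreover have "\<one>\<^bsub>A\<^esub> \<notin> ?K"
      using A'.one_notin_ideal_times[OF P'] by simp
    ultimately have "x \<in> ideal_times_module P A"
      using A.mem_ideal_times_if_proper_ideal[OF P K] x hx by simp
    then show "x \<in> ideal_times_module P' ?B"
      using ideal_times_restrict_scalars[OF bij' PR, of A] P'_eq by simp
  qed
  then show ?thesis
    by simp
qed

text \<open>Shrinking the carriers to the images of \<open>R\<close> and \<open>R'\<close> makes the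
  restriction of \<open>\<phi>\<close> a map between commutative rings. That these images are the
  centers is \<open>center_eq_scalars\<close>.\<close>

theorem corollary5p4:
  fixes R :: "('a, 'r) ring_scheme" and A :: "('a, 'b, 'm) module_scheme"
    and R' :: "('c, 's) ring_scheme" and A' :: "('c, 'd, 'n) module_scheme"
    and r :: nat and \<phi> :: "'b \<Rightarrow> 'd"
  assumes "azumaya_algebra R A" and "azumaya_algebra R' A'"
    and "constant_rank R A r" and "constant_rank R' A' r"
    and "\<phi> \<in> ring_hom A A'"
  shows "\<phi> \<in> ring_iso A A' \<longleftrightarrow>
    \<phi> \<in> ring_iso (A\<lparr>carrier := scalars R A\<rparr>) (A'\<lparr>carrier := scalars R' A'\<rparr>)"
proof
  interpret A: azumaya_algebra R A
    by fact
  interpret A': azumaya_algebra R' A'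
    by fact
  assume iso: "\<phi> \<in> ring_iso A A'"
  \<comment> \<open>An isomorphism matches the centers, and constant rank identifies both of them
    with the scalars.\<close>
  have "\<phi> ` scalars R A = scalars R' A'"
    using ring_iso_image_center[OF A.ring_axioms iso]
    by (simp add: A.center_eq_scalars[OF assms(3)] A'.center_eq_scalars[OF assms(4)])
  moreover have "scalars R A \<subseteq> carrier A"
    using A.submoduleE(1)[OF A.submodule_scalars] .
  moreover have "inj_on \<phi> (carrier A)"
    using iso by (simp add: ring_iso_def bij_betw_def)
  ultimately show "\<phi> \<in> ring_iso (A\<lparr>carrier := scalars R A\<rparr>) (A'\<lparr>carrier := scalars R' A'\<rparr>)"
    using assms(5)
    by (intro ring_iso_memI)
      (auto simp: bij_betw_def inj_on_subset subset_iff ring_hom_mult ring_hom_add ring_hom_one)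
next
  assume "\<phi> \<in> ring_iso (A\<lparr>carrier := scalars R A\<rparr>) (A'\<lparr>carrier := scalars R' A'\<rparr>)"
  then show "\<phi> \<in> ring_iso A A'"
    using azumaya_bij_if_iso_on_scalars[OF assms] assms(5) by (simp add: ring_iso_def)
qed

end
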